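(* Let $n\ge 2$, $s\in(0,1)$, $p\in\left(1,\frac{n+2s}{n-2s}\right)$, and let $\Omega\subset\mathbf R^n$ be a smooth bounded domain. There exist $\varepsilon_0>0$ and positive constants $C_1,C_2$ depending only on $n,s,p,\Omega$ such that for every $\varepsilon\in(0,\varepsilon_0)$ there exists a nonnegative weak solution $u_\varepsilon\in H^s_{\varepsilon,\Omega}$ of the Neumann problem $$\varepsilon^{2s}(-\Delta)^su+u=|u|^{p-1}u\ \text{ in }\Omega,\qquad \mathcal N_su=0\ \text{ on }\mathbf R^n\setminus\bar\Omega,$$ satisfying $$0<I_\varepsilon(u_\varepsilon)\le C_1\varepsilon^n .$$ Moreover, $u_\varepsilon$ is nonconstant, and $$\|u_\varepsilon\|_{H^s_{\varepsilon,\Omega}}\le C_2\,\varepsilon^{n/2}.$$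
   Context: Write $\Omega^c=\mathbf R^n\setminus\Omega$. Let $C_{n,s}>0$ be the usual normalization constant in the fractional Laplacian $(-\Delta)^su(x)=C_{n,s}\,\mathrm{P.V.}\int_{\mathbf R^n}\frac{u(x)-u(y)}{|x-y|^{n+2s}}dy$. The nonlocal Neumann operator is $\mathcal N_su(x)=C_{n,s}\int_\Omega\frac{u(x)-u(y)}{|x-y|^{n+2s}}dy$ for $x\in\mathbf R^n\setminus\bar\Omega$. For $\varepsilon>0$ set $$\langle u,v\rangle_{H^s_{\varepsilon,\Omega}}=\frac{C_{n,s}\varepsilon^{2s}}{2}\int_{\mathbf R^{2n}\setminus(\Omega^c)^2}\frac{(u(x)-u(y))(v(x)-v(y))}{|x-y|^{n+2s}}dxdy+\int_\Omega uv\,dx,$$ $\|u\|_{H^s_{\varepsilon,\Omega}}=\langle u,u\rangle_{H^s_{\varepsilon,\Omega}}^{1/2}$, and $H^s_{\varepsilon,\Omega}=\{u:\mathbf R^n\to\mathbf R\text{ measurable}:\ \|u\|_{H^s_{\varepsilon,\Omega}}<\infty\}$ (functions equal a.e. are identified); this is a Hilbert space. The energy functional on $H^s_{\varepsilon,\Omega}$ is $$I_\varepsilon(u)=\frac{C_{n,s}\varepsilon^{2s}}{4}\int_{\mathbf R^{2n}\setminus(\Omega^c)^2}\frac{|u(x)-u(y)|^2}{|x-y|^{n+2s}}dxdy+\frac12\int_\Omega u^2dx-\frac1{p+1}\int_\Omega|u|^{p+1}dx.$$ A function $u\in H^s_{\varepsilon,\Omega}$ is a weak solution of the Neumann problem if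 for all $v\in H^s_{\varepsilon,\Omega}$ $$\frac{C_{n,s}\varepsilon^{2s}}{2}\int_{\mathbf R^{2n}\setminus(\Omega^c)^2}\frac{(u(x)-u(y))(v(x)-v(y))}{|x-y|^{n+2s}}dxdy+\int_\Omega uv\,dx-\int_\Omega|u|^{p-1}uv\,dx=0.$$ *)

theory Defs
  imports "HOL-Analysis.Analysis"
begin

text \<open>Smooth (\<open>C\<^sup>\<infinity>\<close>) functions on the whole space: directional derivatives may be
  taken to every order.\<close>

fun Ck :: "nat \<Rightarrow> ('a::real_normed_vector \<Rightarrow> 'b::real_normed_vector) \<Rightarrow> bool" where
  "Ck 0 f \<longleftrightarrow> continuous_on UNIV f"
| "Ck (Suc k) f \<longleftrightarrow> (\<forall>x. f differentiable (at x)) \<and>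
     (\<forall>v. Ck k (\<lambda>x. frechet_derivative f (at x) v))"

definition smooth :: "('a::real_normed_vector \<Rightarrow> 'b::real_normed_vector) \<Rightarrow> bool" where
  "smooth f \<longleftrightarrow> (\<forall>k. Ck k f)"

text \<open>The boundary is locally the graph of a smooth function of the \<open>n - 1\<close> coordinates
  orthogonal to some unit vector \<open>e\<close>, with \<open>\<Omega>\<close> lying on one side of it. The function is given on
  all of \<open>\<real>\<^sup>n\<close>, but only its values on the hyperplane orthogonal to \<open>e\<close> matter.\<close>

definition smooth_boundary :: "(real ^ 'n) set \<Rightarrow> bool" where
  "smooth_boundary \<Omega> \<longleftrightarrow>
     (\<forall>x0 \<in> frontier \<Omega>. \<exists>r > 0. \<exists>e. \<exists>\<gamma> :: real ^ 'n \<Rightarrow> real.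
        norm e = 1 \<and> smooth \<gamma> \<and>
        \<Omega> \<inter> ball x0 r = {x \<in> ball x0 r. x \<bullet> e > \<gamma> (x - (x \<bullet> e) *\<^sub>R e)})"

definition smooth_bounded_domain :: "(real ^ 'n) set \<Rightarrow> bool" where
  "smooth_bounded_domain \<Omega> \<longleftrightarrow>
     open \<Omega> \<and> connected \<Omega> \<and> \<Omega> \<noteq> {} \<and> bounded \<Omega> \<and> smooth_boundary \<Omega>"

text \<open>The constant for which the fractional Laplacian has Fourier symbol \<open>|\<xi>|\<close> to the
  power \<open>2s\<close>; the absolute value is needed since \<open>\<Gamma>(-s) < 0\<close> for \<open>0 < s < 1\<close>.\<close>

definition frac_const :: "nat \<Rightarrow> real \<Rightarrow> real" where
  "frac_const n s = 4 powr s * Gamma (real n / 2 + s) / (pi powr (real n / 2) * \<bar>Gamma (- s)\<bar>)"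

definition kernel :: "real \<Rightarrow> (real ^ 'n) \<Rightarrow> (real ^ 'n) \<Rightarrow> real" where
  "kernel s x y = 1 / norm (x - y) powr (real CARD('n) + 2 * s)"

definition cross_set :: "(real ^ 'n) set \<Rightarrow> ((real ^ 'n) \<times> (real ^ 'n)) set" where
  "cross_set \<Omega> = - ((- \<Omega>) \<times> (- \<Omega>))"

definition gagliardo_form ::
  "real \<Rightarrow> (real ^ 'n) set \<Rightarrow> (real ^ 'n \<Rightarrow> real) \<Rightarrow> (real ^ 'n \<Rightarrow> real) \<Rightarrow> real" where
  "gagliardo_form s \<Omega> u v =
     set_lebesgue_integral lebesgue (cross_set \<Omega>)
       (\<lambda>(x, y). (u x - u y) * (v x - v y) * kernel s x y)"

definition Hs_inner ::
  "real \<Rightarrow> real \<Rightarrow> (real ^ 'n) set \<Rightarrow> (real ^ 'n \<Rightarrow> real) \<Rightarrow> (real ^ 'n \<Rightarrow> real) \<Rightarrow> real" where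
  "Hs_inner s \<epsilon> \<Omega> u v =
     frac_const CARD('n) s * \<epsilon> powr (2 * s) / 2 * gagliardo_form s \<Omega> u v
     + set_lebesgue_integral lebesgue \<Omega> (\<lambda>x. u x * v x)"

definition Hs_norm :: "real \<Rightarrow> real \<Rightarrow> (real ^ 'n) set \<Rightarrow> (real ^ 'n \<Rightarrow> real) \<Rightarrow> real" where
  "Hs_norm s \<epsilon> \<Omega> u = sqrt (Hs_inner s \<epsilon> \<Omega> u u)"

text \<open>Bochner integrals are 0 for non-integrable functions, so finiteness of the norm is
  expressed as integrability of its two nonnegative integrands. As \<open>\<epsilon> > 0\<close> only rescales the
  norm, the underlying set does not depend on \<open>\<epsilon>\<close>. Elements are representatives, not
  classes modulo a.e. equality.\<close>

definition Hs_space :: "real \<Rightarrow> (real ^ 'n) set \<Rightarrow> (real ^ 'n \<Rightarrow> real) set" where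
  "Hs_space s \<Omega> = {u. u \<in> borel_measurable lebesgue \<and>
     set_integrable lebesgue (cross_set \<Omega>) (\<lambda>(x, y). (u x - u y)\<^sup>2 * kernel s x y) \<and>
     set_integrable lebesgue \<Omega> (\<lambda>x. (u x)\<^sup>2)}"

definition energy ::
  "real \<Rightarrow> real \<Rightarrow> real \<Rightarrow> (real ^ 'n) set \<Rightarrow> (real ^ 'n \<Rightarrow> real) \<Rightarrow> real" where
  "energy s p \<epsilon> \<Omega> u =
     frac_const CARD('n) s * \<epsilon> powr (2 * s) / 4 *
       set_lebesgue_integral lebesgue (cross_set \<Omega>) (\<lambda>(x, y). \<bar>u x - u y\<bar>\<^sup>2 * kernel s x y)
     + 1 / 2 * set_lebesgue_integral lebesgue \<Omega> (\<lambda>x. (u x)\<^sup>2)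
     - 1 / (p + 1) * set_lebesgue_integral lebesgue \<Omega> (\<lambda>x. \<bar>u x\<bar> powr (p + 1))"

text \<open>Weak solutions of the Neumann problem for \<open>\<epsilon>\<^sup>2\<^sup>s(-\<Delta>)\<^sup>s u + u = |u|\<^sup>p\<^sup>-\<^sup>1 u\<close> in \<open>\<Omega>\<close> with
  \<open>N\<^sub>s u = 0\<close> outside the closure of \<open>\<Omega>\<close>. Integrability of the nonlinear term, automatic for
  subcritical \<open>p\<close> by the fractional Sobolev embedding, is required explicitly so that the
  equation never refers to the default value 0 of a divergent integral (taking \<open>v = u\<close>, the
  same holds for the last term of the energy).\<close>

definition weak_solution ::
  "real \<Rightarrow> real \<Rightarrow> real \<Rightarrow> (real ^ 'n) set \<Rightarrow> (real ^ 'n \<Rightarrow> real) \<Rightarrow> bool" where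
  "weak_solution s p \<epsilon> \<Omega> u \<longleftrightarrow> u \<in> Hs_space s \<Omega> \<and>
     (\<forall>v \<in> Hs_space s \<Omega>.
        set_integrable lebesgue \<Omega> (\<lambda>x. \<bar>u x\<bar> powr (p - 1) * u x * v x) \<and>
        frac_const CARD('n) s * \<epsilon> powr (2 * s) / 2 * gagliardo_form s \<Omega> u v
        + set_lebesgue_integral lebesgue \<Omega> (\<lambda>x. u x * v x)
        - set_lebesgue_integral lebesgue \<Omega> (\<lambda>x. \<bar>u x\<bar> powr (p - 1) * u x * v x) = 0)"

end

theory Submission
  imports Defs "HOL-Complex_Analysis.Great_Picard"
begin

text \<open>
  Up to a factor, a minimiser \<open>w\<close> of the squared norm under the constraint
  \<open>\<integral>\<^bsub>\<Omega>\<^esub> |w|\<^sup>q = 1\<close>, \<open>q = p + 1\<close>, is a solution, and its energy is a power of the minimum; testing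
  with a Lipschitz bump of radius \<open>\<epsilon>\<close> gives the bounds of order \<open>\<epsilon>\<^sup>n\<close>. The constant solution \<open>1\<close> has
  squared norm \<open>|\<Omega>|\<close>, so for small \<open>\<epsilon>\<close> the solution is nonconstant.

  Write \<open>G x\<close> for the integral of \<open>(u x - u y)\<^sup>2 / |x - y|\<^sup>n\<^sup>+\<^sup>2\<^sup>s\<close> over all \<open>y\<close>. Since \<open>\<Omega>\<close> has uniformly
  positive density at its points, Chebyshev's inequality bounds a power of \<open>|u x|\<close> by \<open>G x\<close>: from a
  bound in \<open>L\<^sup>q\<close> one gets a bound in \<open>L\<^sup>q\<close> with exponent \<open>2 + 2 s q / n\<close>, and iterating this reaches every
  subcritical exponent. Comparing \<open>u x\<close> with averages over small balls, on which \<open>G\<close> controls the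
  difference, gives compactness in \<open>L\<^sup>2(\<Omega>)\<close>. A minimising sequence therefore converges in \<open>L\<^sup>q(\<Omega>)\<close>, and by
  the parallelogram identity it is Cauchy in the norm, hence, along a subsequence, converges almost
  everywhere in \<open>\<real>\<^sup>n\<close>; Fatou's lemma gives the minimiser.
\<close>

section \<open>The kernel and cut-off functions\<close>

text \<open>The form sees values of \<open>u\<close> outside \<Omega>, where compactness in \<Omega>
  says nothing; a limit of the functions themselves has to be found on the whole space before
  Fatou's lemma can be used. The map q -> 2 + 2 s q / n is affine with slope 2 s / n < 1, and its
  fixed point is 2 n / (n - 2 s), the critical Sobolev exponent: the iteration comes arbitrarily
  near it without reaching it. The radius \<epsilon> of the bump is the length at which both terms
  of the squared norm scale alike: \<epsilon>^(2 s) times \<epsilon>^(n - 2 s) against \<epsilon>^n.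
  The quotient of the squared norm by the power 2/q of the constraint integral is then of order
  \<epsilon>^(n (1 - 2/q)), and the power q / (q - 2), which comes from scaling the Lagrange
  multiplier away, turns this into \<epsilon>^n. Estimates are made for Borel functions with
  nonnegative integrals over \<open>lborel\<close>, where Tonelli and Fatou ask for no
  integrability; the Lebesgue measurable test functions of the statement enter at the very end
  through Borel representatives.\<close>

lemma kernel_nonneg: "0 \<le> kernel s x y"
  by (simp add: kernel_def)

lemma kernel_commute: "kernel s x y = kernel s y x"
  by (simp add: kernel_def norm_minus_commute)

lemma measurable_kernel [measurable (raw)]:
  assumes "f \<in> borel_measurable M" "g \<in> borel_measurable M"
  shows "(\<lambda>x. kernel s (f x) (g x :: real ^ 'n)) \<in> borel_measurable M"
  unfolding kernel_def using assms by measurable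

text \<open>On the diagonal the bound fails: \<open>0 powr a = 0\<close> and division by zero make
  \<open>kernel s x x = 0\<close>. For this reason the diagonal is a separate case in the estimates
  that follow.\<close>

lemma kernel_lower_bound:
  fixes x y :: "real ^ 'n"
  assumes "0 \<le> s" "x \<noteq> y" "norm (x - y) \<le> r"
  shows "r powr - (real CARD('n) + 2 * s) \<le> kernel s x y"
proof -
  have "r powr - (real CARD('n) + 2 * s) \<le> norm (x - y) powr - (real CARD('n) + 2 * s)"
    using assms by (intro powr_mono2') auto
  then show ?thesis
    by (simp only: kernel_def powr_minus_divide)
qed

text \<open>With values in \<open>ennreal\<close> the density exists for every function, and
  pointwise estimates hold also at points where it is infinite.\<close>

definition energy_density :: "real \<Rightarrow> (real ^ 'n \<Rightarrow> real) \<Rightarrow> real ^ 'n \<Rightarrow> ennreal" where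
  "energy_density s u x = (\<integral>\<^sup>+y. ennreal ((u x - u y)\<^sup>2 * kernel s x y) \<partial>lborel)"

abbreviation energy_on :: "real \<Rightarrow> (real ^ 'n) set \<Rightarrow> (real ^ 'n \<Rightarrow> real) \<Rightarrow> ennreal" where
  "energy_on s \<Omega> u \<equiv> \<integral>\<^sup>+x\<in>\<Omega>. energy_density s u x \<partial>lborel"

abbreviation square_on :: "(real ^ 'n) set \<Rightarrow> (real ^ 'n \<Rightarrow> real) \<Rightarrow> ennreal" where
  "square_on \<Omega> u \<equiv> \<integral>\<^sup>+x\<in>\<Omega>. ennreal ((u x)\<^sup>2) \<partial>lborel"

abbreviation power_on :: "real \<Rightarrow> (real ^ 'n) set \<Rightarrow> (real ^ 'n \<Rightarrow> real) \<Rightarrow> ennreal" where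
  "power_on q \<Omega> u \<equiv> \<integral>\<^sup>+x\<in>\<Omega>. ennreal (\<bar>u x\<bar> powr q) \<partial>lborel"

lemma measurable_energy_density [measurable]:
  assumes [measurable]: "u \<in> borel_measurable borel"
  shows "energy_density s u \<in> borel_measurable borel"
  unfolding energy_density_def by measurable

lemma sum_le_suminf_ennreal: "f k \<le> (\<Sum>k. f k)" for f :: "nat \<Rightarrow> ennreal"
  using sum_le_suminf[of f "{k}"] by auto

text \<open>Cut the space into dyadic shells around \<open>x\<close>. Inside radius \<open>h\<close>
  the quadratic factor gains \<open>1 / 4 ^ k\<close> against the singularity, and
  \<open>s < 1\<close> makes the series geometric with ratio \<open>q1 < 1\<close>; outside, the
  kernel alone decays with ratio \<open>q2 < 1\<close> because \<open>0 < s\<close>. The truncated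
  factor bounds the squared difference of a function with Lipschitz constant \<open>1 / h\<close>
  and oscillation at most 1.\<close>

lemma nn_integral_truncated_kernel:
  fixes s :: real
  assumes "0 < s" "s < 1"
  shows "\<exists>C>0. \<forall>h>0. \<forall>x :: real ^ 'n.
    (\<integral>\<^sup>+y. ennreal (min 1 ((norm (x - y))\<^sup>2 / h\<^sup>2) * kernel s x y) \<partial>lborel) \<le> ennreal (C * h powr (- 2 * s))"
proof -
  define N where "N = real CARD('n)"
  define \<omega> where "\<omega> = unit_ball_vol N"
  define q1 where "q1 = 2 powr (2 * s) / (4::real)"
  define q2 where "q2 = (2::real) powr (- 2 * s)"
  have N0: "0 \<le> N" and \<omega>0: "0 < \<omega>" by (auto simp: N_def \<omega>_def)
  have "2 powr (2 * s) < (2::real) powr 2" using assms by (intro powr_less_mono) auto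
  then have q1: "0 \<le> q1" "q1 < 1" by (auto simp: q1_def)
  have "2 powr (- 2 * s) < (2::real) powr 0" using assms by (intro powr_less_mono) auto
  then have q2: "0 \<le> q2" "q2 < 1" by (auto simp: q2_def)
  define C1 where "C1 = \<omega> * 2 powr (N + 2 * s)"
  define C2 where "C2 = \<omega> * 2 powr N"
  have C12: "0 < C1" "0 < C2" using \<omega>0 by (auto simp: C1_def C2_def)
  define C where "C = C1 / (1 - q1) + C2 / (1 - q2)"
  have "0 < C" unfolding C_def using C12 q1 q2 by (intro add_pos_pos divide_pos_pos) auto
  moreover have "(\<integral>\<^sup>+y. ennreal (min 1 ((norm (x - y))\<^sup>2 / h\<^sup>2) * kernel s x y) \<partial>lborel) \<le> ennreal (C * h powr (- 2 * s))"
    if e: "0 < h" for h and x :: "real ^ 'n"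
  proof -
    define F where "F y = ennreal (min 1 ((norm (x - y))\<^sup>2 / h\<^sup>2) * kernel s x y)" for y
    define a where "a k = (1 / 4 ^ k) * (h / 2 ^ Suc k) powr - (N + 2 * s)" for k :: nat
    define b where "b k = (h * 2 ^ k) powr - (N + 2 * s)" for k :: nat
    \<comment> \<open>Each shell is enlarged to the full ball around it. This costs only a constant
      factor, because the kernel is bounded by its value on the inner sphere of the shell.\<close>
    define inn where "inn k y = ennreal (a k) * indicator (cball x (h / 2 ^ k)) y" for k y
    define out where "out k y = ennreal (b k) * indicator (cball x (h * 2 ^ Suc k)) y" for k y
    have ab0: "0 \<le> a k" "0 \<le> b k" for k by (auto simp: a_def b_def)
    have F_le: "F y \<le> (\<Sum>k. inn k y) + (\<Sum>k. out k y)" for y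
    proof (cases "y = x")
      case True
      then show ?thesis by (simp add: F_def)
    next
      case False
      define d where "d = norm (x - y)"
      have d0: "0 < d" using False by (simp add: d_def)
      have ker: "kernel s x y = d powr - (N + 2 * s)"
        by (simp only: kernel_def d_def N_def powr_minus_divide)
      show ?thesis
      proof (cases "d \<le> h")
        case True
        have ex: "\<exists>k. h / 2 ^ Suc k < d"
        proof -
          obtain m where m: "(1/2::real) ^ m < d / h"
            using real_arch_pow_inv[of "d / h" "1/2"] d0 e by auto
          have "h / 2 ^ Suc m \<le> h / 2 ^ m" using e by (intro divide_left_mono) auto
          also have "\<dots> < d" using m e by (simp add: field_simps power_divide)
          finally show ?thesis by blast
        qed
        \<comment> \<open>Minimality gives the opposite bound \<open>d \<le> h / 2 ^ k\<close>; for
          \<open>k = 0\<close> it is the case assumption.\<close>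
        define k where "k = (LEAST k. h / 2 ^ Suc k < d)"
        have k1: "h / 2 ^ Suc k < d" unfolding k_def by (rule LeastI_ex[OF ex])
        have k2: "d \<le> h / 2 ^ k"
        proof (cases k)
          case 0
          then show ?thesis using True by simp
        next
          case (Suc j)
          then have "\<not> h / 2 ^ Suc j < d" using not_less_Least[of j "\<lambda>k. h / 2 ^ Suc k < d"] k_def by auto
          then show ?thesis using Suc by simp
        qed
        have "d\<^sup>2 / h\<^sup>2 \<le> (h / 2 ^ k)\<^sup>2 / h\<^sup>2"
          using k2 d0 by (intro divide_right_mono power_mono) auto
        also have "\<dots> = 1 / 4 ^ k"
          using e by (simp add: power_divide power2_eq_square power_mult_distrib[symmetric])
        finally have 1: "min 1 (d\<^sup>2 / h\<^sup>2) \<le> 1 / 4 ^ k" by simp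
        have 2: "d powr - (N + 2 * s) \<le> (h / 2 ^ Suc k) powr - (N + 2 * s)"
          using k1 e assms N0 by (intro powr_mono2') auto
        have "min 1 (d\<^sup>2 / h\<^sup>2) * kernel s x y \<le> a k"
          unfolding ker a_def using 1 2 by (intro mult_mono) auto
        then have "F y \<le> inn k y"
          using k2 unfolding F_def inn_def d_def[symmetric]
          by (auto simp: dist_norm indicator_def d_def intro!: ennreal_leI)
        also have "\<dots> \<le> (\<Sum>k. inn k y)" by (rule sum_le_suminf_ennreal)
        finally show ?thesis by (simp add: add_increasing2)
      next
        case False
        have ex: "\<exists>k. d \<le> h * 2 ^ Suc k"
        proof -
          obtain m where m: "d / h < 2 ^ m"
            using real_arch_pow[of 2 "d / h"] by auto
          have "d \<le> h * 2 ^ m" using m e by (simp add: field_simps)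
          also have "\<dots> \<le> h * 2 ^ Suc m" using e by (intro mult_left_mono) auto
          finally show ?thesis by blast
        qed
        define k where "k = (LEAST k. d \<le> h * 2 ^ Suc k)"
        have k1: "d \<le> h * 2 ^ Suc k" unfolding k_def by (rule LeastI_ex[OF ex])
        have k2: "h * 2 ^ k \<le> d"
        proof (cases k)
          case 0
          then show ?thesis using False by simp
        next
          case (Suc j)
          then have "\<not> d \<le> h * 2 ^ Suc j" using not_less_Least[of j "\<lambda>k. d \<le> h * 2 ^ Suc k"] k_def by auto
          then show ?thesis using Suc by simp
        qed
        have 2: "d powr - (N + 2 * s) \<le> b k"
          unfolding b_def using k2 e assms N0 by (intro powr_mono2') auto
        have "min 1 (d\<^sup>2 / h\<^sup>2) * kernel s x y \<le> 1 * b k"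
          unfolding ker using 2 by (intro mult_mono) auto
        then have "F y \<le> out k y"
          using k1 unfolding F_def out_def d_def[symmetric]
          by (auto simp: dist_norm indicator_def d_def intro!: ennreal_leI)
        also have "\<dots> \<le> (\<Sum>k. out k y)" by (rule sum_le_suminf_ennreal)
        finally show ?thesis by (simp add: add_increasing)
      qed
    qed
    have [measurable]: "cball x r \<in> sets borel" for r by simp
    have [measurable]: "inn k \<in> borel_measurable borel" "out k \<in> borel_measurable borel" for k
      unfolding inn_def out_def by measurable
    have pk: "(2 ^ k) powr t = ((2::real) powr t) ^ k" for k :: nat and t
    proof -
      have "(2 ^ k) powr t = (2 powr real k) powr (t :: real)" by (simp add: powr_realpow)
      also have "\<dots> = (2 powr t) powr real k" by (simp only: powr_powr mult.commute)
      also have "\<dots> = (2 powr t) ^ k" by (rule powr_realpow) simp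
      finally show ?thesis .
    qed
    have lt: "r ^ CARD('n) * r powr - (N + 2 * s) = r powr (- 2 * s)" if "0 < r" for r :: real
      by (simp add: N_def powr_realpow[OF that, symmetric] powr_add[symmetric])
    have half_powr: "(r / 2) powr - t = r powr - t * 2 powr t" if "0 < r" for r t :: real
      using that by (simp add: powr_divide powr_minus field_simps)
    have I_in: "(\<integral>\<^sup>+y. inn k y \<partial>lborel) = ennreal (C1 * h powr (- 2 * s) * q1 ^ k)" for k
    proof -
      have "(\<integral>\<^sup>+y. inn k y \<partial>lborel) = ennreal (a k) * emeasure lborel (cball x (h / 2 ^ k))"
        unfolding inn_def by (subst nn_integral_cmult_indicator) auto
      also have "\<dots> = ennreal (a k * (\<omega> * (h / 2 ^ k) ^ CARD('n)))"
        using e ab0 \<omega>0 by (subst emeasure_cball) (auto simp: \<omega>_def N_def ennreal_mult)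
      also have "a k * (\<omega> * (h / 2 ^ k) ^ CARD('n)) = C1 * h powr (- 2 * s) * q1 ^ k"
      proof -
        define r where "r = h / 2 ^ k"
        have r0: "0 < r" using e by (simp add: r_def)
        have "a k = (1 / 4 ^ k) * (r / 2) powr - (N + 2 * s)" by (simp add: a_def r_def mult.commute)
        also have "(r / 2) powr - (N + 2 * s) = r powr - (N + 2 * s) * 2 powr (N + 2 * s)"
          using half_powr[OF r0] .
        finally have "a k * (\<omega> * (h / 2 ^ k) ^ CARD('n))
            = (1 / 4 ^ k) * C1 * (r ^ CARD('n) * r powr - (N + 2 * s))"
          by (simp add: C1_def r_def[symmetric] mult_ac)
        also have "\<dots> = (1 / 4 ^ k) * C1 * r powr (- 2 * s)"
          using lt[OF r0] by simp
        also have "r powr (- 2 * s) = h powr (- 2 * s) * (2 powr (2 * s)) ^ k"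
          unfolding r_def using e pk[of k "- 2 * s"] pk[of k "2 * s"]
          by (simp add: powr_divide powr_minus field_simps)
        finally show ?thesis by (simp add: q1_def power_divide field_simps)
      qed
      finally show ?thesis .
    qed
    have I_out: "(\<integral>\<^sup>+y. out k y \<partial>lborel) = ennreal (C2 * h powr (- 2 * s) * q2 ^ k)" for k
    proof -
      have "(\<integral>\<^sup>+y. out k y \<partial>lborel) = ennreal (b k) * emeasure lborel (cball x (h * 2 ^ Suc k))"
        unfolding out_def by (subst nn_integral_cmult_indicator) auto
      also have "\<dots> = ennreal (b k * (\<omega> * (h * 2 ^ Suc k) ^ CARD('n)))"
        using e ab0 \<omega>0 by (subst emeasure_cball) (auto simp: \<omega>_def N_def ennreal_mult)
      also have "b k * (\<omega> * (h * 2 ^ Suc k) ^ CARD('n)) = C2 * h powr (- 2 * s) * q2 ^ k"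
      proof -
        define r where "r = h * 2 ^ k"
        have r0: "0 < r" using e by (simp add: r_def)
        have "b k * (\<omega> * (h * 2 ^ Suc k) ^ CARD('n)) = r powr - (N + 2 * s) * (\<omega> * (2 * r) ^ CARD('n))"
          by (simp add: b_def r_def mult_ac)
        also have "\<dots> = C2 * (r ^ CARD('n) * r powr - (N + 2 * s))"
          by (simp add: C2_def power_mult_distrib N_def powr_realpow)
        also have "\<dots> = C2 * r powr (- 2 * s)"
          using lt[OF r0] by simp
        also have "r powr (- 2 * s) = h powr (- 2 * s) * q2 ^ k"
          unfolding r_def q2_def using e pk[of k "- 2 * s"]
          by (simp add: powr_mult)
        finally show ?thesis by simp
      qed
      finally show ?thesis .
    qed
    have S_in: "(\<Sum>k. ennreal (C1 * h powr (- 2 * s) * q1 ^ k)) = ennreal (C1 * h powr (- 2 * s) * (1 / (1 - q1)))"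
      using q1 C12 by (intro suminf_ennreal_eq sums_mult geometric_sums) auto
    have S_out: "(\<Sum>k. ennreal (C2 * h powr (- 2 * s) * q2 ^ k)) = ennreal (C2 * h powr (- 2 * s) * (1 / (1 - q2)))"
      using q2 C12 by (intro suminf_ennreal_eq sums_mult geometric_sums) auto
    have "(\<integral>\<^sup>+y. F y \<partial>lborel) \<le> (\<integral>\<^sup>+y. (\<Sum>k. inn k y) + (\<Sum>k. out k y) \<partial>lborel)"
      by (intro nn_integral_mono F_le)
    also have "\<dots> = (\<Sum>k. \<integral>\<^sup>+y. inn k y \<partial>lborel) + (\<Sum>k. \<integral>\<^sup>+y. out k y \<partial>lborel)"
      by (subst nn_integral_add) (auto simp: nn_integral_suminf)
    also have "\<dots> = ennreal (C1 * h powr (- 2 * s) * (1 / (1 - q1))) + ennreal (C2 * h powr (- 2 * s) * (1 / (1 - q2)))"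
      unfolding I_in I_out S_in S_out ..
    also have "\<dots> = ennreal (C1 * h powr (- 2 * s) * (1 / (1 - q1)) + C2 * h powr (- 2 * s) * (1 / (1 - q2)))"
      using q1 q2 C12 by (intro ennreal_plus[symmetric]) auto
    also have "C1 * h powr (- 2 * s) * (1 / (1 - q1)) + C2 * h powr (- 2 * s) * (1 / (1 - q2)) = C * h powr (- 2 * s)"
      by (simp add: C_def field_simps)
    finally show ?thesis unfolding F_def .
  qed
  ultimately show ?thesis by blast
qed

text \<open>A Lipschitz tent is regular enough: since \<open>s < 1\<close>, functions of this kind
  have finite energy.\<close>

definition bump :: "real ^ 'n \<Rightarrow> real \<Rightarrow> real ^ 'n \<Rightarrow> real" where
  "bump x0 h x = max 0 (1 - dist x x0 / h)"

lemma measurable_bump [measurable]: "bump x0 h \<in> borel_measurable borel"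
  unfolding bump_def by measurable

lemma bump_bounds: "0 < h \<Longrightarrow> 0 \<le> bump x0 h x" "0 < h \<Longrightarrow> bump x0 h x \<le> 1"
  by (auto simp: bump_def)

lemma bump_eq_0: "0 < h \<Longrightarrow> x \<notin> ball x0 h \<Longrightarrow> bump x0 h x = 0"
  by (auto simp: bump_def dist_commute field_simps)

lemma bump_ge_half: "0 < h \<Longrightarrow> x \<in> ball x0 (h / 2) \<Longrightarrow> 1 / 2 \<le> bump x0 h x"
  by (auto simp: bump_def dist_commute field_simps)

text \<open>The indicators record that two points outside the ball contribute nothing; they confine
  one of the two integrations to a set of volume of order \<open>h ^ CARD('n)\<close>.\<close>

lemma bump_diff_square_le:
  assumes "0 < h"
  shows "(bump x0 h x - bump x0 h y)\<^sup>2
    \<le> min 1 ((norm (x - y))\<^sup>2 / h\<^sup>2) * (indicator (ball x0 h) x + indicator (ball x0 h) y)"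
proof (cases "x \<in> ball x0 h \<or> y \<in> ball x0 h")
  case True
  have "\<bar>bump x0 h x - bump x0 h y\<bar> \<le> \<bar>dist x x0 / h - dist y x0 / h\<bar>"
    by (auto simp: bump_def)
  also have "\<dots> = \<bar>dist x x0 - dist y x0\<bar> / h"
    using assms by (simp add: diff_divide_distrib[symmetric])
  also have "\<dots> \<le> norm (x - y) / h"
    using assms norm_triangle_ineq3[of "x - x0" "y - x0"] by (intro divide_right_mono) (auto simp: dist_norm)
  finally have 1: "(bump x0 h x - bump x0 h y)\<^sup>2 \<le> (norm (x - y) / h)\<^sup>2"
    using assms by (simp add: abs_le_square_iff[symmetric])
  have "\<bar>bump x0 h x - bump x0 h y\<bar> \<le> 1"
    using bump_bounds[OF assms, of x0 x] bump_bounds[OF assms, of x0 y] by auto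
  then have 2: "(bump x0 h x - bump x0 h y)\<^sup>2 \<le> 1"
    by (simp add: abs_square_le_1)
  have "(bump x0 h x - bump x0 h y)\<^sup>2 \<le> min 1 ((norm (x - y))\<^sup>2 / h\<^sup>2) * 1"
    using 1 2 by (simp add: power_divide)
  also have "\<dots> \<le> min 1 ((norm (x - y))\<^sup>2 / h\<^sup>2) * (indicator (ball x0 h) x + indicator (ball x0 h) y)"
    using True by (intro mult_left_mono) (auto simp: indicator_def)
  finally show ?thesis .
next
  case False
  then have "bump x0 h x = 0" "bump x0 h y = 0" by (auto intro!: bump_eq_0 assms)
  then show ?thesis by (auto simp: indicator_def)
qed

text \<open>One of the two variables lies in the ball, and by symmetry of the kernel both cases
  contribute equally: the volume of the ball times the bound \<open>C * h powr (- 2 * s)\<close> for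
  the other variable.\<close>

lemma bump_energy_bound:
  fixes s :: real
  assumes "0 < s" "s < 1"
  shows "\<exists>C>0. \<forall>h>0. \<forall>x0 :: real ^ 'n.
    (\<integral>\<^sup>+x. energy_density s (bump x0 h) x \<partial>lborel) \<le> ennreal (C * h powr (real CARD('n) - 2 * s))"
proof -
  define \<omega> where "\<omega> = unit_ball_vol (real CARD('n))"
  have \<omega>: "0 < \<omega>" by (simp add: \<omega>_def)
  obtain C where C: "0 < C" "\<And>h (x :: real ^ 'n). 0 < h \<Longrightarrow>
    (\<integral>\<^sup>+y. ennreal (min 1 ((norm (x - y))\<^sup>2 / h\<^sup>2) * kernel s x y) \<partial>lborel) \<le> ennreal (C * h powr (- 2 * s))"
    using nn_integral_truncated_kernel[OF assms, where 'n = 'n] by blast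
  have "(\<integral>\<^sup>+x. energy_density s (bump x0 h) x \<partial>lborel) \<le> ennreal ((2 * \<omega> * C) * h powr (real CARD('n) - 2 * s))"
    if e: "0 < h" for h and x0 :: "real ^ 'n"
  proof -
    define F where "F x y = ennreal (min 1 ((norm (x - y))\<^sup>2 / h\<^sup>2) * kernel s x y)" for x y :: "real ^ 'n"
    have [measurable]: "ball x0 h \<in> sets borel" by simp
    have F_sym: "F x y = F y x" for x y
      by (simp add: F_def kernel_commute[of s x] norm_minus_commute)
    have le: "ennreal ((bump x0 h x - bump x0 h y)\<^sup>2 * kernel s x y)
        \<le> F x y * indicator (ball x0 h) x + F x y * indicator (ball x0 h) y" for x y
    proof -
      have "(bump x0 h x - bump x0 h y)\<^sup>2 * kernel s x y
        \<le> (min 1 ((norm (x - y))\<^sup>2 / h\<^sup>2) * (indicator (ball x0 h) x + indicator (ball x0 h) y)) * kernel s x y"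
        by (intro mult_right_mono bump_diff_square_le e kernel_nonneg)
      also have "\<dots> = (min 1 ((norm (x - y))\<^sup>2 / h\<^sup>2) * kernel s x y) * indicator (ball x0 h) x
          + (min 1 ((norm (x - y))\<^sup>2 / h\<^sup>2) * kernel s x y) * indicator (ball x0 h) y"
        by (simp add: algebra_simps)
      finally have "ennreal ((bump x0 h x - bump x0 h y)\<^sup>2 * kernel s x y) \<le> ennreal ((min 1 ((norm (x - y))\<^sup>2 / h\<^sup>2) * kernel s x y) * indicator (ball x0 h) x
          + (min 1 ((norm (x - y))\<^sup>2 / h\<^sup>2) * kernel s x y) * indicator (ball x0 h) y)"
        by (rule ennreal_leI)
      also have "\<dots> = F x y * indicator (ball x0 h) x + F x y * indicator (ball x0 h) y"
        by (auto simp: F_def indicator_def kernel_nonneg simp flip: ennreal_plus)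
      finally show ?thesis .
    qed
    have half: "(\<integral>\<^sup>+x. \<integral>\<^sup>+y. F x y * indicator (ball x0 h) x \<partial>lborel \<partial>lborel)
        \<le> ennreal (\<omega> * C * h powr (real CARD('n) - 2 * s))"
    proof -
      have "(\<integral>\<^sup>+x. \<integral>\<^sup>+y. F x y * indicator (ball x0 h) x \<partial>lborel \<partial>lborel)
          = (\<integral>\<^sup>+x. (\<integral>\<^sup>+y. F x y \<partial>lborel) * indicator (ball x0 h) x \<partial>lborel)"
        unfolding F_def by (subst nn_integral_multc) auto
      also have "\<dots> \<le> (\<integral>\<^sup>+x. ennreal (C * h powr (- 2 * s)) * indicator (ball x0 h) x \<partial>lborel)"
        unfolding F_def by (intro nn_integral_mono mult_right_mono C e) auto
      also have "\<dots> = ennreal (C * h powr (- 2 * s)) * emeasure lborel (ball x0 h)"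
        by (subst nn_integral_cmult_indicator) auto
      also have "\<dots> = ennreal (C * h powr (- 2 * s) * (\<omega> * h ^ CARD('n)))"
        using e C \<omega> by (subst emeasure_ball) (auto simp: \<omega>_def ennreal_mult)
      also have "C * h powr (- 2 * s) * (\<omega> * h ^ CARD('n)) = \<omega> * C * h powr (real CARD('n) - 2 * s)"
        using e by (simp add: powr_diff powr_minus powr_realpow field_simps)
      finally show ?thesis .
    qed
    have "(\<integral>\<^sup>+x. energy_density s (bump x0 h) x \<partial>lborel)
       \<le> (\<integral>\<^sup>+x. \<integral>\<^sup>+y. F x y * indicator (ball x0 h) x + F x y * indicator (ball x0 h) y \<partial>lborel \<partial>lborel)"
      unfolding energy_density_def by (intro nn_integral_mono le)
    also have "\<dots> = (\<integral>\<^sup>+x. \<integral>\<^sup>+y. F x y * indicator (ball x0 h) x \<partial>lborel \<partial>lborel)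
        + (\<integral>\<^sup>+x. \<integral>\<^sup>+y. F x y * indicator (ball x0 h) y \<partial>lborel \<partial>lborel)"
      unfolding F_def by (subst nn_integral_add; (subst nn_integral_add)?; measurable)
    also have "(\<integral>\<^sup>+x. \<integral>\<^sup>+y. F x y * indicator (ball x0 h) y \<partial>lborel \<partial>lborel)
        = (\<integral>\<^sup>+y. \<integral>\<^sup>+x. F x y * indicator (ball x0 h) y \<partial>lborel \<partial>lborel)"
      unfolding F_def by (rule lborel_pair.Fubini'[symmetric]) measurable
    also have "\<dots> = (\<integral>\<^sup>+y. \<integral>\<^sup>+x. F y x * indicator (ball x0 h) y \<partial>lborel \<partial>lborel)"
      by (subst F_sym) simp
    also have "(\<integral>\<^sup>+x. \<integral>\<^sup>+y. F x y * indicator (ball x0 h) x \<partial>lborel \<partial>lborel) + \<dots>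
        \<le> ennreal (\<omega> * C * h powr (real CARD('n) - 2 * s)) + ennreal (\<omega> * C * h powr (real CARD('n) - 2 * s))"
      by (intro add_mono half)
    also have "\<dots> = ennreal ((2 * \<omega> * C) * h powr (real CARD('n) - 2 * s))"
      using \<omega> C by (subst ennreal_plus[symmetric]) (auto simp: algebra_simps)
    finally show ?thesis .
  qed
  moreover have "0 < 2 * \<omega> * C" using \<omega> C by simp
  ultimately show ?thesis by blast
qed

section \<open>Interior balls of smooth domains\<close>

text \<open>The partial derivatives are continuous, hence bounded on the compact ball; the ball is
  convex, so the mean value inequality applies.\<close>

lemma smooth_locally_lipschitz:
  fixes \<gamma> :: "real ^ 'n \<Rightarrow> real"
  assumes "smooth \<gamma>"
  shows "\<exists>L\<ge>0. \<forall>x \<in> cball 0 R. \<forall>y \<in> cball 0 R. \<bar>\<gamma> x - \<gamma> y\<bar> \<le> L * norm (x - y)"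
proof -
  have "Ck 1 \<gamma>" using assms unfolding smooth_def by blast
  then have diff: "\<gamma> differentiable (at x)"
    and cont: "continuous_on UNIV (\<lambda>x. frechet_derivative \<gamma> (at x) v)" for x v
    by auto
  have der: "(\<gamma> has_derivative frechet_derivative \<gamma> (at x)) (at x)" for x
    using diff by (simp add: frechet_derivative_works[symmetric])
  have "\<exists>B. \<forall>x \<in> cball 0 R. \<bar>frechet_derivative \<gamma> (at x) b\<bar> \<le> B" for b
  proof -
    have "compact ((\<lambda>x. frechet_derivative \<gamma> (at x) b) ` cball 0 R)"
      by (intro compact_continuous_image continuous_on_subset[OF cont]) auto
    then have "bounded ((\<lambda>x. frechet_derivative \<gamma> (at x) b) ` cball 0 R)" by (rule compact_imp_bounded)
    then show ?thesis by (auto simp: bounded_iff)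
  qed
  then obtain B where B: "\<And>b x. x \<in> cball 0 R \<Longrightarrow> \<bar>frechet_derivative \<gamma> (at x) b\<bar> \<le> B b" by metis
  define L where "L = (\<Sum>b\<in>Basis. \<bar>B b\<bar>)"
  have "onorm (frechet_derivative \<gamma> (at x)) \<le> L" if "x \<in> cball 0 R" for x
  proof (rule onorm_componentwise_le[THEN order_trans])
    show "bounded_linear (frechet_derivative \<gamma> (at x))"
      using der by (rule has_derivative_bounded_linear)
    show "(\<Sum>i\<in>Basis. norm (frechet_derivative \<gamma> (at x) i)) \<le> L"
      unfolding L_def using B[OF that] by (intro sum_mono) (auto intro: order_trans[OF _ abs_ge_self])
  qed simp
  then have "norm (\<gamma> x - \<gamma> y) \<le> L * norm (x - y)" if "x \<in> cball 0 R" "y \<in> cball 0 R" for x y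
    using that by (intro differentiable_bound[where S = "cball 0 R" and f' = "\<lambda>x. frechet_derivative \<gamma> (at x)"]
        has_derivative_at_withinI[OF der]) auto
  moreover have "0 \<le> L" unfolding L_def by (intro sum_nonneg) auto
  ultimately show ?thesis by (auto simp: )
qed

text \<open>Starting from a point above the graph, a move by \<open>\<rho> / 2\<close> in the
  direction \<open>e\<close> leaves the foot point on the hyperplane unchanged. As the graph is
  Lipschitz, a ball around the new point whose radius is a fixed fraction of \<open>\<rho>\<close>
  stays above it.\<close>

lemma interior_ball_near_boundary:
  fixes \<Omega> :: "(real ^ 'n) set"
  assumes "smooth_boundary \<Omega>" "x0 \<in> frontier \<Omega>"
  shows "\<exists>r>0. \<exists>a>0. \<forall>x \<in> \<Omega> \<inter> ball x0 r. \<forall>\<rho>. 0 < \<rho> \<and> \<rho> \<le> r \<longrightarrow> (\<exists>z. ball z (a * \<rho>) \<subseteq> \<Omega> \<inter> ball x \<rho>)"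
proof -
  obtain r e and \<gamma> :: "real ^ 'n \<Rightarrow> real" where r: "r > 0" and e: "norm e = 1" and \<gamma>: "smooth \<gamma>"
    and loc: "\<Omega> \<inter> ball x0 r = {x \<in> ball x0 r. x \<bullet> e > \<gamma> (x - (x \<bullet> e) *\<^sub>R e)}"
    using assms unfolding smooth_boundary_def by blast
  define P where "P x = x - (x \<bullet> e) *\<^sub>R e" for x
  have loc': "x \<in> \<Omega> \<longleftrightarrow> x \<bullet> e > \<gamma> (P x)" if "x \<in> ball x0 r" for x
    using that eqset_imp_iff[OF loc, of x] unfolding P_def by blast
  have P_diff: "P x - P y = P (x - y)" for x y by (simp add: P_def algebra_simps inner_diff_left)
  have P_e: "P (t *\<^sub>R e) = 0" for t using e by (simp add: P_def norm_eq_1)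
  have P_add: "P (x + y) = P x + P y" for x y by (simp add: P_def algebra_simps inner_add_left)
  have ie: "\<bar>x \<bullet> e\<bar> \<le> norm x" for x using Cauchy_Schwarz_ineq2[of x e] e by simp
  have P_norm: "norm (P x) \<le> 2 * norm x" for x
    unfolding P_def using norm_triangle_ineq4[of x "(x \<bullet> e) *\<^sub>R e"] ie[of x] e by simp
  define R where "R = 2 * (norm x0 + r)"
  obtain L where L: "L \<ge> 0" "\<And>x y. x \<in> cball 0 R \<Longrightarrow> y \<in> cball 0 R \<Longrightarrow> \<bar>\<gamma> x - \<gamma> y\<bar> \<le> L * norm (x - y)"
    using smooth_locally_lipschitz[OF \<gamma>, of R] by blast
  have PR: "P x \<in> cball 0 R" if "x \<in> ball x0 r" for x
  proof -
    have "norm x \<le> norm x0 + r"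
      using that norm_triangle_ineq2[of x x0] by (auto simp: dist_norm norm_minus_commute)
    then show ?thesis using P_norm[of x] by (simp add: R_def)
  qed
  \<comment> \<open>A displacement \<open>w\<close> shorter than \<open>a * \<rho>\<close> lowers
    the height by less than \<open>a * \<rho>\<close> and, since
    \<open>norm (P w) \<le> 2 * norm w\<close>, raises the graph by at most
    \<open>2 * L * a * \<rho>\<close>. The value of \<open>a\<close> makes the sum of both equal to
    the gained height \<open>\<rho> / 2\<close>.\<close>
  define a where "a = 1 / (2 * (1 + 2 * L))"
  have a: "0 < a" "a \<le> 1 / 2" "1 / 2 - a = 2 * L * a"
    using L(1) by (auto simp: a_def field_simps)
  \<comment> \<open>Halving the radius keeps the whole of \<open>ball x \<rho>\<close> inside
    \<open>ball x0 r\<close>, where the description by the graph is valid.\<close>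
  have "\<exists>z. ball z (a * \<rho>) \<subseteq> \<Omega> \<inter> ball x \<rho>"
    if x: "x \<in> \<Omega> \<inter> ball x0 (r / 2)" and \<rho>: "0 < \<rho> \<and> \<rho> \<le> r / 2" for x \<rho>
  proof (intro exI[of _ "x + (\<rho> / 2) *\<^sub>R e"] subsetI)
    fix y assume y: "y \<in> ball (x + (\<rho> / 2) *\<^sub>R e) (a * \<rho>)"
    define w where "w = y - (x + (\<rho> / 2) *\<^sub>R e)"
    have w: "norm w < a * \<rho>" using y by (simp add: w_def dist_norm norm_minus_commute)
    have yx: "y = x + ((\<rho> / 2) *\<^sub>R e + w)" by (simp add: w_def)
    have "norm (y - x) \<le> norm ((\<rho> / 2) *\<^sub>R e) + norm w"
      unfolding yx using norm_triangle_ineq[of "(\<rho> / 2) *\<^sub>R e" w] by simp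
    also have "\<dots> < \<rho> / 2 + a * \<rho>" using w e \<rho> by simp
    also have "\<dots> \<le> \<rho> / 2 + 1 / 2 * \<rho>" using a \<rho> by (intro add_left_mono mult_right_mono) auto
    finally have d: "norm (y - x) < \<rho>" by simp
    have xb: "x \<in> ball x0 r" using x r by auto
    have yb: "y \<in> ball x0 r"
      using x d \<rho> dist_triangle[of x0 y x] by (auto simp: dist_norm norm_minus_commute)
    have gx: "x \<bullet> e > \<gamma> (P x)" using x loc'[OF xb] by blast
    have "\<bar>\<gamma> (P y) - \<gamma> (P x)\<bar> \<le> L * norm (P y - P x)" by (intro L PR xb yb)
    also have "P y - P x = P w" unfolding P_diff yx using P_e by (simp add: P_add)
    also have "L * norm (P w) \<le> L * (2 * (a * \<rho>))"
      using P_norm[of w] w L by (intro mult_left_mono) auto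
    also have "\<dots> = \<rho> / 2 - a * \<rho>"
    proof -
      have "(1 / 2 - a) * \<rho> = 2 * L * a * \<rho>" unfolding a(3) ..
      then show ?thesis by (simp add: algebra_simps)
    qed
    finally have 1: "\<gamma> (P y) \<le> \<gamma> (P x) + (\<rho> / 2 - a * \<rho>)" by simp
    have "y \<bullet> e = x \<bullet> e + \<rho> / 2 + w \<bullet> e"
      unfolding yx using e by (simp add: inner_add_left norm_eq_1)
    moreover have "w \<bullet> e > - (a * \<rho>)" using ie[of w] w by auto
    ultimately have "y \<bullet> e > \<gamma> (P y)" using 1 gx by simp
    then have "y \<in> \<Omega>" using loc'[OF yb] by blast
    then show "y \<in> \<Omega> \<inter> ball x \<rho>" using d by (simp add: dist_norm norm_minus_commute)
  qed
  then show ?thesis using a r by (intro exI[of _ "r / 2"] exI[of _ a]) auto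
qed

text \<open>Near each point of the closure there are a local radius and a local ratio: ratio 1 at
  interior points, the preceding lemma at boundary points. Finitely many neighbourhoods cover the
  compact closure, and minima give uniform constants.\<close>

lemma smooth_bounded_domain_interior_balls:
  fixes \<Omega> :: "(real ^ 'n) set"
  assumes "smooth_bounded_domain \<Omega>"
  shows "\<exists>r>0. \<exists>a>0. \<forall>x\<in>\<Omega>. \<forall>\<rho>. 0 < \<rho> \<and> \<rho> \<le> r \<longrightarrow> (\<exists>z. ball z (a * \<rho>) \<subseteq> \<Omega> \<inter> ball x \<rho>)"
proof -
  have \<Omega>: "open \<Omega>" "bounded \<Omega>" "smooth_boundary \<Omega>"
    using assms by (auto simp: smooth_bounded_domain_def)
  define good where "good r a S \<longleftrightarrow>
    (\<forall>x \<in> \<Omega> \<inter> S. \<forall>\<rho>. 0 < \<rho> \<and> \<rho> \<le> r \<longrightarrow> (\<exists>z. ball z (a * \<rho>) \<subseteq> \<Omega> \<inter> ball x \<rho>))" for r a :: real and S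
  have "\<exists>r>0. \<exists>a>0. good r a (ball x0 r)" if "x0 \<in> closure \<Omega>" for x0
  proof (cases "x0 \<in> \<Omega>")
    case True
    then obtain r where r: "0 < r" "ball x0 r \<subseteq> \<Omega>"
      using \<Omega>(1) unfolding open_contains_ball by blast
    have "good (r / 2) 1 (ball x0 (r / 2))"
      unfolding good_def
    proof (intro ballI allI impI)
      fix x \<rho> assume x: "x \<in> \<Omega> \<inter> ball x0 (r / 2)" and \<rho>: "0 < \<rho> \<and> \<rho> \<le> r / 2"
      have "ball x \<rho> \<subseteq> ball x0 r"
      proof
        fix y assume "y \<in> ball x \<rho>"
        then show "y \<in> ball x0 r" using x \<rho> dist_triangle[of x0 y x] by auto
      qed
      then show "\<exists>z. ball z (1 * \<rho>) \<subseteq> \<Omega> \<inter> ball x \<rho>"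
        using r(2) by (intro exI[of _ x]) auto
    qed
    then show ?thesis using r(1) by (intro exI[of _ "r / 2"] exI[of _ 1] conjI) auto
  next
    case False
    then have "x0 \<in> frontier \<Omega>" using that interior_open[OF \<Omega>(1)] by (simp add: frontier_def)
    then show ?thesis using interior_ball_near_boundary[OF \<Omega>(3)] unfolding good_def by blast
  qed
  then obtain rr aa where ra: "\<And>x. x \<in> closure \<Omega> \<Longrightarrow> 0 < rr x \<and> 0 < aa x \<and> good (rr x) (aa x) (ball x (rr x))"
    by metis
  have "compact (closure \<Omega>)" using \<Omega>(2) by (simp add: compact_closure)
  moreover have "closure \<Omega> \<subseteq> (\<Union>x\<in>closure \<Omega>. ball x (rr x))" using ra by fastforce
  ultimately obtain F where F: "F \<subseteq> closure \<Omega>" "finite F" "closure \<Omega> \<subseteq> (\<Union>x\<in>F. ball x (rr x))"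
    using compactE_image[of "closure \<Omega>" "closure \<Omega>" "\<lambda>x. ball x (rr x)"] by auto
  define r where "r = Min (insert 1 (rr ` F))"
  define a where "a = Min (insert 1 (aa ` F))"
  have "0 < r" "0 < a" unfolding r_def a_def using F ra by auto
  moreover have "\<exists>z. ball z (a * \<rho>) \<subseteq> \<Omega> \<inter> ball x \<rho>" if x: "x \<in> \<Omega>" and \<rho>: "0 < \<rho> \<and> \<rho> \<le> r" for x \<rho>
  proof -
    obtain x0 where x0: "x0 \<in> F" "x \<in> ball x0 (rr x0)" using x F(3) closure_subset by blast
    have "r \<le> rr x0" "a \<le> aa x0" unfolding r_def a_def using F x0 by auto
    then obtain z where z: "ball z (aa x0 * \<rho>) \<subseteq> \<Omega> \<inter> ball x \<rho>"
      using ra[of x0] x0 F x \<rho> unfolding good_def by fastforce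
    have "ball z (a * \<rho>) \<subseteq> ball z (aa x0 * \<rho>)"
      using \<open>a \<le> aa x0\<close> \<rho> by (intro subset_ball mult_right_mono) auto
    then show ?thesis using z by blast
  qed
  ultimately show ?thesis by blast
qed

text \<open>The regularity of the boundary acts on the analysis below only through this lower bound
  on the density.\<close>

lemma smooth_bounded_domain_measure_density:
  fixes \<Omega> :: "(real ^ 'n) set"
  assumes "smooth_bounded_domain \<Omega>"
  shows "\<exists>r>0. \<exists>c>0. \<forall>x\<in>\<Omega>. \<forall>\<rho>. 0 < \<rho> \<and> \<rho> \<le> r \<longrightarrow> ennreal (c * \<rho> ^ CARD('n)) \<le> emeasure lborel (\<Omega> \<inter> ball x \<rho>)"
proof -
  obtain r a where ra: "0 < r" "0 < a"
    and z: "\<And>x \<rho>. x \<in> \<Omega> \<Longrightarrow> 0 < \<rho> \<and> \<rho> \<le> r \<Longrightarrow> \<exists>z. ball z (a * \<rho>) \<subseteq> \<Omega> \<inter> ball x \<rho>"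
    using smooth_bounded_domain_interior_balls[OF assms] by blast
  have [measurable]: "\<Omega> \<in> sets borel" using assms by (auto simp: smooth_bounded_domain_def)
  define c where "c = unit_ball_vol (real CARD('n)) * a ^ CARD('n)"
  have "0 < c" using ra by (simp add: c_def)
  moreover have "ennreal (c * \<rho> ^ CARD('n)) \<le> emeasure lborel (\<Omega> \<inter> ball x \<rho>)"
    if x: "x \<in> \<Omega>" "0 < \<rho> \<and> \<rho> \<le> r" for x \<rho>
  proof -
    obtain z where "ball z (a * \<rho>) \<subseteq> \<Omega> \<inter> ball x \<rho>" using z[OF x] by blast
    then have "emeasure lborel (ball z (a * \<rho>)) \<le> emeasure lborel (\<Omega> \<inter> ball x \<rho>)"
      by (intro emeasure_mono) auto
    then show ?thesis using ra x by (simp add: emeasure_ball c_def power_mult_distrib mult_ac)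
  qed
  ultimately show ?thesis using ra by blast
qed

section \<open>Higher integrability of functions of finite energy\<close>

lemma ennreal_half_le:
  assumes "ennreal (2 * a) \<le> e + ennreal a" "0 \<le> a"
  shows "ennreal a \<le> e"
  using assms
  by (cases e) (auto simp flip: ennreal_plus simp: top_unique)

lemma ennreal_mult3:
  assumes "0 \<le> a" "0 \<le> b" "0 \<le> c"
  shows "ennreal (a * (b * c)) = ennreal a * (ennreal b * ennreal c)"
  using assms by (simp add: ennreal_mult)

text \<open>Chebyshev's inequality makes \<open>u\<close> small compared with \<open>u x\<close> on half of a ball around \<open>x\<close>
  whose radius depends on \<open>u x\<close>; the energy density at \<open>x\<close> sees this difference.\<close>

lemma powr_le_energy_density:
  fixes \<Omega> :: "(real ^ 'n) set"
  assumes [measurable]: "\<Omega> \<in> sets borel" and s: "0 < s" and q: "0 < q" and B: "0 \<le> B"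
    and r: "0 < r" and c: "0 < c"
    and dens: "\<And>x \<rho>. x \<in> \<Omega> \<Longrightarrow> 0 < \<rho> \<and> \<rho> \<le> r \<Longrightarrow> ennreal (c * \<rho> ^ CARD('n)) \<le> emeasure lborel (\<Omega> \<inter> ball x \<rho>)"
  shows "\<exists>A\<ge>0. \<exists>T\<ge>0. \<forall>u \<in> borel_measurable borel.
    power_on q \<Omega> u \<le> ennreal B \<longrightarrow>
    (\<forall>x\<in>\<Omega>. ennreal (\<bar>u x\<bar> powr (2 + 2 * s / real CARD('n) * q)) \<le> ennreal A * energy_density s u x + ennreal T)"
proof -
  define N where "N = real CARD('n)"
  have N: "0 < N" by (simp add: N_def)
  define q' where "q' = 2 + 2 * s / N * q"
  have q': "0 < q'" using s q N by (auto simp: q'_def intro!: add_pos_nonneg)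
  define B' where "B' = B + 1"
  have B': "0 < B'" "B \<le> B'" using B by (auto simp: B'_def)
  \<comment> \<open>With \<open>t = \<bar>u x\<bar>\<close> the radius \<rho> will satisfy
    \<open>\<rho> powr N = D / t powr q\<close>. This \<open>D\<close> makes Chebyshev's bound
    \<open>B' / (t / 2) powr q\<close> for the set where \<open>\<bar>u\<bar>\<close> exceeds
    \<open>t / 2\<close> equal to half of the density bound \<open>c * \<rho> ^ CARD('n)\<close>.
    Passing from \<open>B\<close> to \<open>B + 1\<close> keeps \<open>D\<close> positive.\<close>
  define D where "D = 2 * 2 powr q * B' / c"
  have D: "0 < D" using B' c by (simp add: D_def)
  define \<kappa> where "\<kappa> = D powr (- 2 * s / N)"
  have \<kappa>: "0 < \<kappa>" using D by (simp add: \<kappa>_def)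
  define A where "A = 8 / (c * \<kappa>)"
  have A: "0 < A" using c \<kappa> by (simp add: A_def)
  define T where "T = (D / r powr N) powr (q' / q)"
  have T: "0 \<le> T" by (simp add: T_def)
  have "ennreal (\<bar>u x\<bar> powr q') \<le> ennreal A * energy_density s u x + ennreal T"
    if [measurable]: "u \<in> borel_measurable borel" and uB: "power_on q \<Omega> u \<le> ennreal B"
      and x: "x \<in> \<Omega>" for u x
  proof (cases "u x = 0")
    case True
    then show ?thesis by simp
  next
    case False
    define t where "t = \<bar>u x\<bar>"
    have t: "0 < t" using False by (simp add: t_def)
    define \<rho> where "\<rho> = (D / t powr q) powr (1 / N)"
    have \<rho>: "0 < \<rho>" using D t by (simp add: \<rho>_def)
    have \<rho>N: "\<rho> powr N = D / t powr q"
      unfolding \<rho>_def using N D t by (simp add: powr_powr)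
    show ?thesis
    proof (cases "\<rho> \<le> r")
      case False
      have "r powr N \<le> \<rho> powr N" using False r N by (intro powr_mono2) auto
      then have "t powr q \<le> D / r powr N"
        unfolding \<rho>N using r t by (simp add: field_simps)
      then have "(t powr q) powr (q' / q) \<le> (D / r powr N) powr (q' / q)"
        using q q' by (intro powr_mono2) auto
      then have "t powr q' \<le> T" using q by (simp add: powr_powr T_def)
      then have "ennreal (t powr q') \<le> ennreal T" by (rule ennreal_leI)
      then show ?thesis unfolding t_def by (simp add: add_increasing)
    next
      case True
      define S where "S = {y \<in> \<Omega>. t / 2 < \<bar>u y\<bar>}"
      define E where "E = {y \<in> \<Omega> \<inter> ball x \<rho>. \<bar>u y\<bar> \<le> t / 2}"
      have bm [measurable]: "ball x \<rho> \<in> sets borel" by simp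
      have S_meas [measurable]: "S \<in> sets borel" unfolding S_def by measurable
      have E_meas [measurable]: "E \<in> sets borel" unfolding E_def by measurable
      have "ennreal ((t / 2) powr q) * emeasure lborel S = (\<integral>\<^sup>+y. ennreal ((t / 2) powr q) * indicator S y \<partial>lborel)"
        by (subst nn_integral_cmult_indicator) auto
      also have "\<dots> \<le> power_on q \<Omega> u"
        using t q by (intro nn_integral_mono) (auto simp: S_def indicator_def intro!: ennreal_leI powr_mono2)
      also have "\<dots> \<le> ennreal B'" using uB B' by (meson ennreal_leI order_trans)
      finally have "ennreal ((t / 2) powr q) * emeasure lborel S \<le> ennreal B'" .
      then have "ennreal (1 / (t / 2) powr q) * (ennreal ((t / 2) powr q) * emeasure lborel S) \<le> ennreal (1 / (t / 2) powr q) * ennreal B'"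
        by (intro mult_left_mono) auto
      also have "ennreal (1 / (t / 2) powr q) * (ennreal ((t / 2) powr q) * emeasure lborel S) = emeasure lborel S"
        using t by (simp add: mult.assoc[symmetric] ennreal_mult[symmetric])
      also have "ennreal (1 / (t / 2) powr q) * ennreal B' = ennreal (c * \<rho> ^ CARD('n) / 2)"
      proof -
        have "\<rho> ^ CARD('n) = D / t powr q" using \<rho>N \<rho> by (simp add: N_def powr_realpow)
        then have e: "1 / (t / 2) powr q * B' = c * \<rho> ^ CARD('n) / 2"
          using c t by (simp add: D_def powr_divide)
        show ?thesis unfolding e[symmetric] using B' t by (intro ennreal_mult[symmetric]) auto
      qed
      finally have S_le: "emeasure lborel S \<le> ennreal (c * \<rho> ^ CARD('n) / 2)" .
      have "ennreal (2 * (c * \<rho> ^ CARD('n) / 2)) \<le> emeasure lborel (\<Omega> \<inter> ball x \<rho>)"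
        using dens[OF x] \<rho> True by simp
      also have "\<dots> \<le> emeasure lborel (E \<union> S)"
        by (intro emeasure_mono) (auto simp: E_def S_def)
      also have "\<dots> \<le> emeasure lborel E + emeasure lborel S"
        by (intro emeasure_subadditive) auto
      also have "\<dots> \<le> emeasure lborel E + ennreal (c * \<rho> ^ CARD('n) / 2)"
        using S_le by (intro add_left_mono)
      finally have E_ge: "ennreal (c * \<rho> ^ CARD('n) / 2) \<le> emeasure lborel E"
        by (rule ennreal_half_le) (use c \<rho> in simp)
      define m where "m = (t / 2)\<^sup>2 * \<rho> powr - (N + 2 * s)"
      have m: "0 \<le> m" by (simp add: m_def)
      have pw: "ennreal m * indicator E y \<le> ennreal ((u x - u y)\<^sup>2 * kernel s x y)" for y
      proof (cases "y \<in> E")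
        case True
        then have y: "\<bar>u y\<bar> \<le> t / 2" "norm (x - y) \<le> \<rho>" by (auto simp: E_def dist_norm)
        then have "x \<noteq> y" using t by (auto simp: t_def)
        then have 1: "\<rho> powr - (N + 2 * s) \<le> kernel s x y"
          unfolding N_def using y s by (intro kernel_lower_bound) auto
        have "t / 2 \<le> \<bar>u x - u y\<bar>" using y(1) unfolding t_def by linarith
        then have 2: "(t / 2)\<^sup>2 \<le> (u x - u y)\<^sup>2" using t by (simp add: abs_le_square_iff[symmetric])
        have "m \<le> (u x - u y)\<^sup>2 * kernel s x y" unfolding m_def using 1 2 by (intro mult_mono) auto
        then show ?thesis using True by (auto intro: ennreal_leI)
      qed auto
      have meq: "t powr q' = A * (m * (c * \<rho> ^ CARD('n) / 2))"
      proof -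
        have "\<rho> powr - (N + 2 * s) * \<rho> ^ CARD('n) = \<rho> powr (- 2 * s)"
          using \<rho> by (simp add: N_def powr_realpow[OF \<rho>, symmetric] powr_add[symmetric])
        also have "\<dots> = (\<rho> powr N) powr (- 2 * s / N)"
          using N by (simp add: powr_powr)
        also have "\<dots> = (D / t powr q) powr (- 2 * s / N)" unfolding \<rho>N ..
        also have "\<dots> = \<kappa> / (t powr (q * (- 2 * s / N)))"
          using D by (simp add: powr_divide powr_powr \<kappa>_def)
        also have "\<dots> = \<kappa> * t powr (2 * s / N * q)"
          by (simp add: powr_minus divide_inverse mult_ac)
        finally have e: "\<rho> powr - (N + 2 * s) * \<rho> ^ CARD('n) = \<kappa> * t powr (2 * s / N * q)" .
        have "t powr q' = t\<^sup>2 * t powr (2 * s / N * q)"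
          unfolding q'_def powr_add using t by (simp add: powr_numeral)
        moreover have "A * (m * (c * \<rho> ^ CARD('n) / 2)) = A * c / 8 * t\<^sup>2 * (\<rho> powr - (N + 2 * s) * \<rho> ^ CARD('n))"
          by (simp add: m_def power2_eq_square)
        moreover have "A * c / 8 * t\<^sup>2 * (\<kappa> * t powr (2 * s / N * q)) = t\<^sup>2 * t powr (2 * s / N * q)"
          unfolding A_def using c \<kappa> by simp
        ultimately show ?thesis unfolding e by metis
      qed
      have "ennreal (t powr q') = ennreal A * (ennreal m * ennreal (c * \<rho> ^ CARD('n) / 2))"
        unfolding meq using A m c \<rho> by (intro ennreal_mult3) auto
      also have "\<dots> \<le> ennreal A * (ennreal m * emeasure lborel E)"
        using E_ge by (intro mult_left_mono) auto
      also have "ennreal m * emeasure lborel E = (\<integral>\<^sup>+y. ennreal m * indicator E y \<partial>lborel)"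
        by (subst nn_integral_cmult_indicator) auto
      also have "\<dots> \<le> energy_density s u x"
        unfolding energy_density_def by (intro nn_integral_mono pw)
      finally have "ennreal (t powr q') \<le> ennreal A * energy_density s u x"
        by (simp add: mult_left_mono)
      then show ?thesis unfolding t_def by (simp add: add_increasing2)
    qed
  qed
  then show ?thesis using A T unfolding q'_def N_def by (intro exI[of _ A] exI[of _ T]) auto
qed

definition energy_ball :: "real \<Rightarrow> (real ^ 'n) set \<Rightarrow> real \<Rightarrow> (real ^ 'n \<Rightarrow> real) set" where
  "energy_ball s \<Omega> R = {u \<in> borel_measurable borel.
    energy_on s \<Omega> u \<le> ennreal R \<and> square_on \<Omega> u \<le> ennreal R}"

text \<open>The Sobolev embedding as a statement on bounded sets instead of a norm inequality: the
  improvement of exponents is not homogeneous in \<open>u\<close>, and this form can be iterated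
  without tracking constants.\<close>

definition energy_bounds_power :: "real \<Rightarrow> (real ^ 'n) set \<Rightarrow> real \<Rightarrow> bool" where
  "energy_bounds_power s \<Omega> q \<longleftrightarrow> (\<forall>R\<ge>0. \<exists>B\<ge>0. \<forall>u \<in> energy_ball s \<Omega> R. power_on q \<Omega> u \<le> ennreal B)"

text \<open>The pointwise bound is integrated over \<Omega>; the finite measure of \<Omega> absorbs
  the additive constant.\<close>

lemma energy_bounds_power_step:
  fixes \<Omega> :: "(real ^ 'n) set"
  assumes \<Omega> [measurable]: "\<Omega> \<in> sets borel" and fin: "emeasure lborel \<Omega> < \<infinity>"
    and s: "0 < s" and q: "0 < q" and r: "0 < r" and c: "0 < c"
    and dens: "\<And>x \<rho>. x \<in> \<Omega> \<Longrightarrow> 0 < \<rho> \<and> \<rho> \<le> r \<Longrightarrow> ennreal (c * \<rho> ^ CARD('n)) \<le> emeasure lborel (\<Omega> \<inter> ball x \<rho>)"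
    and *: "energy_bounds_power s \<Omega> q"
  shows "energy_bounds_power s \<Omega> (2 + 2 * s / real CARD('n) * q)"
  unfolding energy_bounds_power_def
proof (intro allI impI)
  fix R :: real assume R: "0 \<le> R"
  obtain B where B: "0 \<le> B" "\<And>u. u \<in> energy_ball s \<Omega> R \<Longrightarrow> power_on q \<Omega> u \<le> ennreal B"
    using * R unfolding energy_bounds_power_def by blast
  let ?q = "2 + 2 * s / real CARD('n) * q"
  obtain A T where AT: "0 \<le> A" "0 \<le> T" and pw: "\<And>u x. u \<in> borel_measurable borel \<Longrightarrow>
    power_on q \<Omega> u \<le> ennreal B \<Longrightarrow> x \<in> \<Omega> \<Longrightarrow>
    ennreal (\<bar>u x\<bar> powr ?q) \<le> ennreal A * energy_density s u x + ennreal T"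
    using powr_le_energy_density[OF \<Omega> s q B(1) r c dens] by blast
  define m where "m = measure lborel \<Omega>"
  have m: "emeasure lborel \<Omega> = ennreal m" "0 \<le> m"
    using fin unfolding m_def by (auto simp: emeasure_eq_ennreal_measure)
  have "power_on ?q \<Omega> u \<le> ennreal (A * R + T * m)"
    if u: "u \<in> energy_ball s \<Omega> R" for u
  proof -
    have [measurable]: "u \<in> borel_measurable borel" and u1: "energy_on s \<Omega> u \<le> ennreal R"
      using u by (auto simp: energy_ball_def)
    have "power_on ?q \<Omega> u
       \<le> (\<integral>\<^sup>+x. ennreal A * (energy_density s u x * indicator \<Omega> x) + ennreal T * indicator \<Omega> x \<partial>lborel)"
      using pw[OF _ B(2)[OF u]] by (intro nn_integral_mono) (auto simp: indicator_def)
    also have "\<dots> = ennreal A * energy_on s \<Omega> u + ennreal T * emeasure lborel \<Omega>"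
      by (subst nn_integral_add) (auto simp: nn_integral_cmult)
    also have "\<dots> \<le> ennreal A * ennreal R + ennreal T * ennreal m"
      unfolding m(1) by (intro add_right_mono mult_left_mono u1) auto
    also have "\<dots> = ennreal (A * R + T * m)"
      using AT R m by (simp add: ennreal_mult)
    finally show ?thesis .
  qed
  then show "\<exists>B\<ge>0. \<forall>u \<in> energy_ball s \<Omega> R. power_on ?q \<Omega> u \<le> ennreal B"
    using AT R m(2) by (intro exI[of _ "A * R + T * m"]) auto
qed

lemma energy_bounds_power_le:
  fixes \<Omega> :: "(real ^ 'n) set"
  assumes \<Omega> [measurable]: "\<Omega> \<in> sets borel" and fin: "emeasure lborel \<Omega> < \<infinity>"
    and q: "0 \<le> q" "q \<le> q'" and *: "energy_bounds_power s \<Omega> q'"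
  shows "energy_bounds_power s \<Omega> q"
  unfolding energy_bounds_power_def
proof (intro allI impI)
  fix R :: real assume R: "0 \<le> R"
  obtain B where B: "0 \<le> B" "\<And>u. u \<in> energy_ball s \<Omega> R \<Longrightarrow> power_on q' \<Omega> u \<le> ennreal B"
    using * R unfolding energy_bounds_power_def by blast
  define m where "m = measure lborel \<Omega>"
  have m: "emeasure lborel \<Omega> = ennreal m" "0 \<le> m"
    using fin unfolding m_def by (auto simp: emeasure_eq_ennreal_measure)
  have pw: "\<bar>t\<bar> powr q \<le> 1 + \<bar>t\<bar> powr q'" for t :: real
  proof (cases "\<bar>t\<bar> \<le> 1")
    case True
    then have "\<bar>t\<bar> powr q \<le> 1" using q powr_mono2[of q "\<bar>t\<bar>" 1] by simp
    then show ?thesis by (simp add: add_increasing2)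
  next
    case False
    then have "\<bar>t\<bar> powr q \<le> \<bar>t\<bar> powr q'" using q by (intro powr_mono) auto
    then show ?thesis by simp
  qed
  have "power_on q \<Omega> u \<le> ennreal (m + B)"
    if u: "u \<in> energy_ball s \<Omega> R" for u
  proof -
    have [measurable]: "u \<in> borel_measurable borel"
      using u by (auto simp: energy_ball_def)
    have "power_on q \<Omega> u
       \<le> (\<integral>\<^sup>+x. indicator \<Omega> x + ennreal (\<bar>u x\<bar> powr q') * indicator \<Omega> x \<partial>lborel)"
    proof (intro nn_integral_mono)
      fix x
      have "ennreal (\<bar>u x\<bar> powr q) \<le> ennreal (1 + \<bar>u x\<bar> powr q')" by (intro ennreal_leI pw)
      then show "ennreal (\<bar>u x\<bar> powr q) * indicator \<Omega> x \<le> indicator \<Omega> x + ennreal (\<bar>u x\<bar> powr q') * indicator \<Omega> x"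
        by (auto simp: indicator_def)
    qed
    also have "\<dots> = emeasure lborel \<Omega> + power_on q' \<Omega> u"
      by (subst nn_integral_add) auto
    also have "\<dots> \<le> ennreal m + ennreal B"
      unfolding m(1) by (intro add_left_mono B(2) u)
    also have "\<dots> = ennreal (m + B)"
      using B(1) m by simp
    finally show ?thesis .
  qed
  then show "\<exists>B\<ge>0. \<forall>u \<in> energy_ball s \<Omega> R. power_on q \<Omega> u \<le> ennreal B"
    using B(1) m(2) by (intro exI[of _ "m + B"]) auto
qed

text \<open>The exponents \<open>Q * (1 - \<theta> ^ Suc k)\<close> are the iterates of the
  improvement map. They start at 2, where the bound is part of \<open>energy_ball\<close>, and
  increase to the fixed point \<open>Q = 2 / (1 - \<theta>)\<close>, which is the critical
  exponent.\<close>

lemma subcritical_energy_bounds_power: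
  fixes \<Omega> :: "(real ^ 'n) set"
  assumes \<Omega> [measurable]: "\<Omega> \<in> sets borel" and fin: "emeasure lborel \<Omega> < \<infinity>"
    and s: "0 < s" "2 * s < real CARD('n)" and r: "0 < r" and c: "0 < c"
    and dens: "\<And>x \<rho>. x \<in> \<Omega> \<Longrightarrow> 0 < \<rho> \<and> \<rho> \<le> r \<Longrightarrow> ennreal (c * \<rho> ^ CARD('n)) \<le> emeasure lborel (\<Omega> \<inter> ball x \<rho>)"
    and q: "0 \<le> q" "q < 2 * real CARD('n) / (real CARD('n) - 2 * s)"
  shows "energy_bounds_power s \<Omega> q"
proof -
  define \<theta> where "\<theta> = 2 * s / real CARD('n)"
  have \<theta>: "0 < \<theta>" "\<theta> < 1" using s by (auto simp: \<theta>_def)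
  define Q where "Q = 2 / (1 - \<theta>)"
  have Q: "0 < Q" using \<theta> by (simp add: Q_def)
  have step: "energy_bounds_power s \<Omega> (Q * (1 - \<theta> ^ Suc k))" for k
  proof (induction k)
    case 0
    have "Q * (1 - \<theta> ^ Suc 0) = 2" using \<theta> by (simp add: Q_def field_simps)
    then show ?case by (auto simp: energy_bounds_power_def energy_ball_def)
  next
    case (Suc k)
    have "\<theta> ^ Suc k < 1" using \<theta> by (intro power_Suc_less_one) auto
    then have "0 < Q * (1 - \<theta> ^ Suc k)" using Q by simp
    from energy_bounds_power_step[OF \<Omega> fin s(1) this r c dens Suc]
    have "energy_bounds_power s \<Omega> (2 + \<theta> * (Q * (1 - \<theta> ^ Suc k)))"
      by (simp add: \<theta>_def)
    also have "2 = Q * (1 - \<theta>)" using \<theta> by (simp add: Q_def field_simps)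
    also have "Q * (1 - \<theta>) + \<theta> * (Q * (1 - \<theta> ^ Suc k)) = Q * (1 - \<theta> ^ Suc (Suc k))"
      by (simp add: algebra_simps)
    finally show ?case .
  qed
  have "(\<lambda>k. Q * (1 - \<theta> ^ Suc k)) \<longlonglongrightarrow> Q * (1 - 0)"
    using \<theta> by (intro tendsto_intros LIMSEQ_Suc LIMSEQ_power_zero) auto
  moreover have "q < Q * (1 - 0)"
    using q s by (simp add: Q_def \<theta>_def field_simps)
  ultimately have "eventually (\<lambda>k. q < Q * (1 - \<theta> ^ Suc k)) sequentially"
    by (rule order_tendstoD)
  then obtain k where "q < Q * (1 - \<theta> ^ Suc k)" by (auto simp: eventually_sequentially)
  then show ?thesis
    using energy_bounds_power_le[OF \<Omega> fin q(1) _ step[of k]] by simp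
qed

text \<open>\<open>f\<close> may change sign; \<open>ennreal\<close> sends its negative values to 0,
  which can only increase the integral.\<close>

lemma integral_le_nn_integral:
  assumes "integrable M f"
  shows "ennreal (integral\<^sup>L M f) \<le> (\<integral>\<^sup>+x. ennreal (f x) \<partial>M)"
proof -
  have "integral\<^sup>L M f \<le> (\<integral>x. max 0 (f x) \<partial>M)"
    using assms by (intro integral_mono) auto
  then have "ennreal (integral\<^sup>L M f) \<le> ennreal (\<integral>x. max 0 (f x) \<partial>M)" by (rule ennreal_leI)
  also have "\<dots> = (\<integral>\<^sup>+x. ennreal (max 0 (f x)) \<partial>M)"
    using assms by (intro nn_integral_eq_integral[symmetric]) auto
  also have "\<dots> = (\<integral>\<^sup>+x. ennreal (f x) \<partial>M)"
    by (intro nn_integral_cong) (auto simp: max_def ennreal_neg)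
  finally show ?thesis .
qed

section \<open>Differences of functions, and a weight that controls functions on the whole
  space\<close>

lemma square_diff_le: "(a - b)\<^sup>2 \<le> 2 * a\<^sup>2 + 2 * b\<^sup>2" for a b :: real
  using zero_le_power2[of "a + b"] by (simp add: power2_eq_square algebra_simps)

lemma energy_density_diff:
  fixes u v :: "real ^ 'n \<Rightarrow> real"
  assumes [measurable]: "u \<in> borel_measurable borel" "v \<in> borel_measurable borel"
  shows "energy_density s (\<lambda>x. u x - v x) x
    \<le> 2 * energy_density s u x + 2 * energy_density s v x"
proof -
  have "ennreal ((u x - v x - (u y - v y))\<^sup>2 * kernel s x y)
      \<le> 2 * ennreal ((u x - u y)\<^sup>2 * kernel s x y) + 2 * ennreal ((v x - v y)\<^sup>2 * kernel s x y)" for y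
  proof -
    have "(u x - v x - (u y - v y))\<^sup>2 * kernel s x y
      \<le> (2 * (u x - u y)\<^sup>2 + 2 * (v x - v y)\<^sup>2) * kernel s x y"
      using square_diff_le[of "u x - u y" "v x - v y"]
      by (intro mult_right_mono kernel_nonneg) (simp add: algebra_simps)
    also have "\<dots> = 2 * ((u x - u y)\<^sup>2 * kernel s x y) + 2 * ((v x - v y)\<^sup>2 * kernel s x y)"
      by (simp add: algebra_simps)
    finally have "ennreal ((u x - v x - (u y - v y))\<^sup>2 * kernel s x y) \<le> ennreal \<dots>"
      by (rule ennreal_leI)
    then show ?thesis by (simp add: ennreal_mult kernel_nonneg)
  qed
  then have "energy_density s (\<lambda>x. u x - v x) x \<le>
    (\<integral>\<^sup>+y. 2 * ennreal ((u x - u y)\<^sup>2 * kernel s x y) + 2 * ennreal ((v x - v y)\<^sup>2 * kernel s x y) \<partial>lborel)"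
    unfolding energy_density_def by (intro nn_integral_mono)
  also have "\<dots> = 2 * energy_density s u x + 2 * energy_density s v x"
    unfolding energy_density_def by (subst nn_integral_add) (auto simp: nn_integral_cmult)
  finally show ?thesis .
qed

text \<open>The kernel as seen from a bounded set, with its decay at infinity but without its
  singularity.\<close>

definition decay_weight :: "real \<Rightarrow> real ^ 'n \<Rightarrow> real" where
  "decay_weight s y = (1 + norm y) powr - (real CARD('n) + 2 * s)"

lemma decay_weight_pos: "0 < decay_weight s y"
proof -
  have "0 < 1 + norm y" by (simp add: add_pos_nonneg)
  then show ?thesis by (simp add: decay_weight_def)
qed

lemma measurable_decay_weight [measurable]: "decay_weight s \<in> borel_measurable borel"
  unfolding decay_weight_def by measurable

abbreviation weighted_square :: "real \<Rightarrow> (real ^ 'n \<Rightarrow> real) \<Rightarrow> ennreal" where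
  "weighted_square s u \<equiv> \<integral>\<^sup>+y. ennreal ((u y)\<^sup>2 * decay_weight s y) \<partial>lborel"

text \<open>In the unit ball the weight is at most 1; outside, it is at most the kernel centred at
  0, where the truncation factor with \<open>h = 1\<close> equals 1, so the truncated kernel
  estimate applies.\<close>

lemma decay_weight_integral_finite:
  assumes "0 < s" "s < 1"
  shows "\<exists>W\<ge>0. (\<integral>\<^sup>+y. ennreal (decay_weight s (y :: real ^ 'n)) \<partial>lborel) \<le> ennreal W"
proof -
  obtain C where C: "0 < C" "\<forall>\<epsilon>>0. \<forall>x :: real ^ 'n. (\<integral>\<^sup>+y. ennreal (min 1 ((norm (x - y))\<^sup>2 / \<epsilon>\<^sup>2) * kernel s x y) \<partial>lborel) \<le> ennreal (C * \<epsilon> powr (- 2 * s))"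
    using nn_integral_truncated_kernel[OF assms, where 'n = 'n] by blast
  define \<omega> where "\<omega> = unit_ball_vol (real CARD('n))"
  have \<omega>: "0 \<le> \<omega>" by (simp add: \<omega>_def)
  have le: "ennreal (decay_weight s y) \<le> indicator (cball 0 1) y + ennreal (min 1 ((norm (0 - y))\<^sup>2 / 1\<^sup>2) * kernel s 0 y)" for y :: "real ^ 'n"
  proof (cases "norm y \<le> 1")
    case True
    have "decay_weight s y \<le> (1 + norm y) powr 0"
      unfolding decay_weight_def using assms by (intro powr_mono) auto
    then have "ennreal (decay_weight s y) \<le> ennreal 1" by (intro ennreal_leI) (simp add: add_pos_nonneg split: if_splits)
    also have "\<dots> = indicator (cball 0 1) y" using True by simp
    finally show ?thesis by (simp add: add_increasing2)
  next
    case False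
    have "decay_weight s y \<le> kernel s 0 y"
      unfolding decay_weight_def using assms False by (intro kernel_lower_bound) auto
    moreover have "1 \<le> (norm y)\<^sup>2" using False by (simp add: one_le_power)
    ultimately have "ennreal (decay_weight s y) \<le> ennreal (min 1 ((norm (0 - y))\<^sup>2 / 1\<^sup>2) * kernel s 0 y)"
      by (intro ennreal_leI) simp
    then show ?thesis by (simp add: add_increasing)
  qed
  have "(\<integral>\<^sup>+y. ennreal (decay_weight s (y :: real ^ 'n)) \<partial>lborel)
      \<le> (\<integral>\<^sup>+y. indicator (cball 0 1) y + ennreal (min 1 ((norm (0 - y))\<^sup>2 / 1\<^sup>2) * kernel s 0 y) \<partial>(lborel :: (real ^ 'n) measure))"
    by (intro nn_integral_mono le)
  also have "\<dots> = emeasure lborel (cball 0 1 :: (real ^ 'n) set) + (\<integral>\<^sup>+y. ennreal (min 1 ((norm (0 - y))\<^sup>2 / 1\<^sup>2) * kernel s 0 y) \<partial>(lborel :: (real ^ 'n) measure))"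
    by (subst nn_integral_add) (auto intro!: borel_measurable_indicator)
  also have "\<dots> \<le> ennreal \<omega> + ennreal (C * 1 powr (- 2 * s))"
  proof (intro add_mono)
    show "emeasure lborel (cball 0 1 :: (real ^ 'n) set) \<le> ennreal \<omega>"
      by (simp add: emeasure_cball \<omega>_def)
    show "(\<integral>\<^sup>+y. ennreal (min 1 ((norm (0 - y))\<^sup>2 / 1\<^sup>2) * kernel s 0 y) \<partial>(lborel :: (real ^ 'n) measure)) \<le> ennreal (C * 1 powr (- 2 * s))"
      using C(2)[rule_format, of 1 "0 :: real ^ 'n"] by simp
  qed
  also have "\<dots> = ennreal (\<omega> + C)" using \<omega> C by simp
  finally show ?thesis using \<omega> C by (intro exI[of _ "\<omega> + C"]) auto
qed

text \<open>The distance from \<open>y\<close> to a point of norm at most \<open>A\<close> is at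
  most \<open>(1 + A) * (1 + norm y)\<close>; what matters is that the resulting bound is uniform in
  \<open>x\<close>.\<close>

lemma kernel_ge_decay_weight:
  fixes x y :: "real ^ 'n"
  assumes "0 < s" "norm x \<le> A" "x \<noteq> y"
  shows "(1 + A) powr - (real CARD('n) + 2 * s) * decay_weight s y \<le> kernel s x y"
proof -
  have A: "0 \<le> A" using assms(2) norm_ge_zero[of x] by linarith
  have "norm (x - y) \<le> A + norm y" using norm_triangle_ineq4[of x y] assms by simp
  also have "\<dots> \<le> (1 + A) * (1 + norm y)" using A by (simp add: algebra_simps)
  finally have "((1 + A) * (1 + norm y)) powr - (real CARD('n) + 2 * s) \<le> kernel s x y"
    using assms by (intro kernel_lower_bound) auto
  then show ?thesis using A by (simp add: decay_weight_def powr_mult)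
qed

text \<open>Nonlocality lets the values of \<open>u\<close> in \<open>\<Omega>\<close> control those far away from \<open>\<Omega>\<close>.\<close>

lemma weighted_L2_bound:
  fixes \<Omega> :: "(real ^ 'n) set"
  assumes s: "0 < s" "s < 1" and [measurable]: "\<Omega> \<in> sets borel" and bd: "bounded \<Omega>"
    and pos: "emeasure lborel \<Omega> \<noteq> 0"
  shows "\<exists>C>0. \<forall>u \<in> borel_measurable borel.
    weighted_square s u
      \<le> ennreal C * (energy_on s \<Omega> u + square_on \<Omega> u)"
proof -
  obtain A where A: "\<And>x. x \<in> \<Omega> \<Longrightarrow> norm x \<le> A" "0 < A" using bd unfolding bounded_pos by blast
  obtain W where W: "W \<ge> 0" "(\<integral>\<^sup>+y. ennreal (decay_weight s (y :: real ^ 'n)) \<partial>lborel) \<le> ennreal W"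
    using decay_weight_integral_finite[OF s] by blast
  define c where "c = (1 + A) powr - (real CARD('n) + 2 * s)"
  have c: "0 < c" using A(2) by (simp add: c_def)
  define m where "m = measure lborel \<Omega>"
  have m: "emeasure lborel \<Omega> = ennreal m"
    using emeasure_bounded_finite[OF bd] unfolding m_def by (auto simp: emeasure_eq_ennreal_measure)
  have m0: "0 < m" using pos m ennreal_eq_0_iff by force
  define C where "C = max 2 (2 * c * W) / (c * m)"
  have C: "0 < C" using c m0 by (simp add: C_def less_max_iff_disj)
  have "weighted_square s u
      \<le> ennreal C * (energy_on s \<Omega> u + square_on \<Omega> u)"
    if [measurable]: "u \<in> borel_measurable borel" for u
  proof -
    define I where "I = weighted_square s u"
    have pw: "ennreal c * I \<le> 2 * energy_density s u x + ennreal (2 * c * W) * ennreal ((u x)\<^sup>2)" if x: "x \<in> \<Omega>" for x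
    proof -
      have "ennreal c * ennreal ((u y)\<^sup>2 * decay_weight s y)
         \<le> 2 * ennreal ((u x - u y)\<^sup>2 * kernel s x y) + ennreal (2 * c * (u x)\<^sup>2) * ennreal (decay_weight s y)" for y
      proof -
        have "c * ((u y)\<^sup>2 * decay_weight s y) \<le> 2 * ((u x - u y)\<^sup>2 * kernel s x y) + 2 * c * (u x)\<^sup>2 * decay_weight s y"
        proof (cases "x = y")
          case True
          then show ?thesis using c decay_weight_pos[of s y] by simp
        next
          case False
          have 1: "c * decay_weight s y \<le> kernel s x y"
            unfolding c_def by (intro kernel_ge_decay_weight s A x False)
          have "(u y)\<^sup>2 \<le> 2 * (u x - u y)\<^sup>2 + 2 * (u x)\<^sup>2"
            using square_diff_le[of "u x" "u x - u y"] by simp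
          then have "c * decay_weight s y * (u y)\<^sup>2 \<le> c * decay_weight s y * (2 * (u x - u y)\<^sup>2 + 2 * (u x)\<^sup>2)"
            using c decay_weight_pos[of s y] by (intro mult_left_mono) auto
          also have "\<dots> = 2 * ((u x - u y)\<^sup>2 * (c * decay_weight s y)) + 2 * c * (u x)\<^sup>2 * decay_weight s y"
            by (simp add: algebra_simps)
          also have "\<dots> \<le> 2 * ((u x - u y)\<^sup>2 * kernel s x y) + 2 * c * (u x)\<^sup>2 * decay_weight s y"
            using 1 by (intro add_right_mono mult_left_mono) auto
          finally show ?thesis by (simp add: mult_ac)
        qed
        then have "ennreal (c * ((u y)\<^sup>2 * decay_weight s y)) \<le> ennreal (2 * ((u x - u y)\<^sup>2 * kernel s x y) + 2 * c * (u x)\<^sup>2 * decay_weight s y)"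
          by (rule ennreal_leI)
        then show ?thesis
          using c decay_weight_pos[of s y] kernel_nonneg[of s x y]
          by (simp add: ennreal_mult)
      qed
      then have "ennreal c * I \<le> (\<integral>\<^sup>+y. 2 * ennreal ((u x - u y)\<^sup>2 * kernel s x y) + ennreal (2 * c * (u x)\<^sup>2) * ennreal (decay_weight s y) \<partial>lborel)"
        unfolding I_def by (subst nn_integral_cmult[symmetric]) (auto intro!: nn_integral_mono)
      also have "\<dots> = 2 * energy_density s u x + ennreal (2 * c * (u x)\<^sup>2) * (\<integral>\<^sup>+y. ennreal (decay_weight s (y :: real ^ 'n)) \<partial>lborel)"
        unfolding energy_density_def by (subst nn_integral_add) (auto simp: nn_integral_cmult)
      also have "\<dots> \<le> 2 * energy_density s u x + ennreal (2 * c * (u x)\<^sup>2) * ennreal W"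
        by (intro add_left_mono mult_left_mono W) auto
      also have "ennreal (2 * c * (u x)\<^sup>2) * ennreal W = ennreal (2 * c * W) * ennreal ((u x)\<^sup>2)"
        using c W(1) by (simp add: ennreal_mult[symmetric] mult_ac)
      finally show ?thesis .
    qed
    \<comment> \<open>\<open>I\<close> does not depend on \<open>x\<close>, so integrating the
      pointwise bound over \<Omega> multiplies the left side by the measure \<open>m\<close>. As
      \<open>I\<close> might be infinite, the factor \<open>c * m\<close> is removed by multiplying
      with its reciprocal.\<close>
    have "ennreal c * I * ennreal m = (\<integral>\<^sup>+x. ennreal c * I * indicator \<Omega> x \<partial>lborel)"
      unfolding m[symmetric] by (subst nn_integral_cmult_indicator) auto
    also have "\<dots> \<le> (\<integral>\<^sup>+x. 2 * (energy_density s u x * indicator \<Omega> x) + ennreal (2 * c * W) * (ennreal ((u x)\<^sup>2) * indicator \<Omega> x) \<partial>lborel)"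
      using pw by (intro nn_integral_mono) (auto simp: indicator_def)
    also have "\<dots> = 2 * energy_on s \<Omega> u + ennreal (2 * c * W) * square_on \<Omega> u"
      by (subst nn_integral_add) (auto simp: nn_integral_cmult)
    also have "\<dots> \<le> ennreal (max 2 (2 * c * W)) * energy_on s \<Omega> u + ennreal (max 2 (2 * c * W)) * square_on \<Omega> u"
    proof (intro add_mono mult_right_mono)
      show "2 \<le> ennreal (max 2 (2 * c * W))"
        using ennreal_leI[of 2 "max 2 (2 * c * W)"] by simp
    qed (auto intro!: ennreal_leI)
    finally have I2: "ennreal c * I * ennreal m \<le> ennreal (max 2 (2 * c * W)) * (energy_on s \<Omega> u + square_on \<Omega> u)"
      by (simp add: distrib_left)
    have "I = ennreal (1 / (c * m)) * (ennreal c * I * ennreal m)"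
    proof -
      have "ennreal (1 / (c * m)) * (ennreal c * I * ennreal m) = (ennreal (1 / (c * m)) * (ennreal c * ennreal m)) * I"
        by (simp add: mult_ac)
      also have "ennreal (1 / (c * m)) * (ennreal c * ennreal m) = 1"
        using c m0 by (simp flip: ennreal_mult)
      finally show ?thesis by simp
    qed
    also have "\<dots> \<le> ennreal (1 / (c * m)) * (ennreal (max 2 (2 * c * W)) * (energy_on s \<Omega> u + square_on \<Omega> u))"
      by (intro mult_left_mono I2) auto
    also have "\<dots> = ennreal C * (energy_on s \<Omega> u + square_on \<Omega> u)"
    proof -
      have "ennreal C = ennreal (1 / (c * m)) * ennreal (max 2 (2 * c * W))"
        unfolding C_def using c m0 by (subst ennreal_mult[symmetric]) (auto simp: le_max_iff_disj)
      then show ?thesis by (simp add: mult.assoc)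
    qed
    finally show ?thesis unfolding I_def .
  qed
  then show ?thesis using C by blast
qed

section \<open>Compactness in the square-integrable functions\<close>

text \<open>Integrate \<open>(d x - d y)\<^sup>2\<close> over \<open>y\<close> in the ball, expand,
  and drop the term \<open>(d y)\<^sup>2\<close>: what is left involves \<open>d\<close> only
  through \<open>d x\<close> and its integral over the ball. Points of the ball have distance at
  most \<open>2 * h\<close> from \<open>x\<close>, so the kernel is bounded below there and the
  energy density dominates the integral of the squares.\<close>

lemma square_le_ball_average:
  fixes d :: "real ^ 'n \<Rightarrow> real"
  assumes [measurable]: "d \<in> borel_measurable borel"
    and int: "set_integrable lborel (ball c h) d" and h: "0 < h" and s: "0 < s" and x: "x \<in> ball c h"
    and \<eta>: "\<bar>LINT y:ball c h|lborel. d y\<bar> \<le> \<eta>" and V: "V = unit_ball_vol (real CARD('n)) * h ^ CARD('n)"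
  shows "ennreal ((d x)\<^sup>2) \<le> ennreal (2 / V * (2 * h) powr (real CARD('n) + 2 * s)) * energy_density s d x
    + ennreal (4 * \<eta>\<^sup>2 / V\<^sup>2)"
proof -
  define J where "J = (\<integral>\<^sup>+y\<in>ball c h. ennreal ((d x - d y)\<^sup>2) \<partial>lborel)"
  have V0: "0 < V" using h by (simp add: V)
  have \<eta>0: "0 \<le> \<eta>" using \<eta> by linarith
  have mV: "measure lborel (ball c h) = V" using h by (simp add: content_ball V)
  define I where "I = (LINT y:ball c h|lborel. d y)"
  have bi: "integrable lborel (\<lambda>y. indicator (ball c h) y * (d x)\<^sup>2)"
    using emeasure_lborel_ball_finite[of c h] by (intro integrable_mult_left) auto
  have bi2: "integrable lborel (\<lambda>y. 2 * d x * (indicator (ball c h) y * d y))"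
    using int unfolding set_integrable_def by (intro integrable_mult_right) simp
  have "V * (d x)\<^sup>2 - 2 * d x * I = (\<integral>y. indicator (ball c h) y * (d x)\<^sup>2 - 2 * d x * (indicator (ball c h) y * d y) \<partial>lborel)"
    using mV by (subst Bochner_Integration.integral_diff[OF bi bi2]) (simp add: I_def set_lebesgue_integral_def)
  then have "ennreal (V * (d x)\<^sup>2 - 2 * d x * I) = ennreal (\<integral>y. indicator (ball c h) y * (d x)\<^sup>2 - 2 * d x * (indicator (ball c h) y * d y) \<partial>lborel)"
    by simp
  also have "\<dots> \<le> (\<integral>\<^sup>+y. ennreal (indicator (ball c h) y * (d x)\<^sup>2 - 2 * d x * (indicator (ball c h) y * d y)) \<partial>lborel)"
    using bi bi2 by (intro integral_le_nn_integral Bochner_Integration.integrable_diff)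
  also have "\<dots> \<le> J"
    unfolding J_def
  proof (intro nn_integral_mono)
    fix y
    show "ennreal (indicator (ball c h) y * (d x)\<^sup>2 - 2 * d x * (indicator (ball c h) y * d y)) \<le> ennreal ((d x - d y)\<^sup>2) * indicator (ball c h) y"
      by (auto simp: indicator_def power2_diff intro!: ennreal_leI)
  qed
  finally have J1: "ennreal (V * (d x)\<^sup>2 - 2 * d x * I) \<le> J" .
  \<comment> \<open>The weights are chosen so that half of \<open>V * (d x)\<^sup>2\<close> absorbs
    the mixed term.\<close>
  have "2 * d x * I \<le> V * (d x)\<^sup>2 / 2 + 2 * \<eta>\<^sup>2 / V"
  proof -
    have "2 * d x * I \<le> 2 * (\<bar>d x\<bar> * \<bar>I\<bar>)" using abs_ge_self[of "d x * I"] by (simp add: abs_mult)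
    also have "\<dots> \<le> 2 * (\<bar>d x\<bar> * \<eta>)" using \<eta> unfolding I_def by (intro mult_left_mono) auto
    also have "\<dots> \<le> V * (d x)\<^sup>2 / 2 + 2 * \<eta>\<^sup>2 / V"
    proof -
      have "0 \<le> (V * \<bar>d x\<bar> - 2 * \<eta>)\<^sup>2 / (2 * V)" using V0 by simp
      also have "\<dots> = V * (d x)\<^sup>2 / 2 + 2 * \<eta>\<^sup>2 / V - 2 * (\<bar>d x\<bar> * \<eta>)"
        using V0 by (simp add: field_simps power2_eq_square)
      finally show ?thesis by simp
    qed
    finally show ?thesis .
  qed
  then have "(d x)\<^sup>2 \<le> 2 / V * (V * (d x)\<^sup>2 - 2 * d x * I) + 4 * \<eta>\<^sup>2 / V\<^sup>2"
    using V0 by (simp add: field_simps power2_eq_square)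
  also have "\<dots> \<le> 2 / V * max 0 (V * (d x)\<^sup>2 - 2 * d x * I) + 4 * \<eta>\<^sup>2 / V\<^sup>2"
    using V0 by (intro add_right_mono mult_left_mono) auto
  finally have "ennreal ((d x)\<^sup>2) \<le> ennreal (2 / V * max 0 (V * (d x)\<^sup>2 - 2 * d x * I) + 4 * \<eta>\<^sup>2 / V\<^sup>2)"
    by (rule ennreal_leI)
  also have "\<dots> = ennreal (2 / V) * ennreal (max 0 (V * (d x)\<^sup>2 - 2 * d x * I)) + ennreal (4 * \<eta>\<^sup>2 / V\<^sup>2)"
    using V0 by (subst ennreal_plus) (auto simp: ennreal_mult[symmetric])
  also have "ennreal (max 0 (V * (d x)\<^sup>2 - 2 * d x * I)) = ennreal (V * (d x)\<^sup>2 - 2 * d x * I)"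
    by (auto simp: max_def ennreal_neg)
  finally have 2: "ennreal ((d x)\<^sup>2) \<le> ennreal (2 / V) * ennreal (V * (d x)\<^sup>2 - 2 * d x * I) + ennreal (4 * \<eta>\<^sup>2 / V\<^sup>2)" .
  have J2: "J \<le> ennreal ((2 * h) powr (real CARD('n) + 2 * s)) * energy_density s d x"
  proof -
    have pw: "ennreal ((d x - d y)\<^sup>2) * indicator (ball c h) y
      \<le> ennreal ((2 * h) powr (real CARD('n) + 2 * s)) * ennreal ((d x - d y)\<^sup>2 * kernel s x y)" for y
    proof (cases "y \<in> ball c h \<and> x \<noteq> y")
      case True
      have "norm (x - y) \<le> 2 * h"
        using True x dist_triangle[of x y c] by (auto simp: dist_norm[symmetric] dist_commute)
      then have k: "(2 * h) powr - (real CARD('n) + 2 * s) \<le> kernel s x y"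
        using s True by (intro kernel_lower_bound) auto
      have "(d x - d y)\<^sup>2 = (2 * h) powr (real CARD('n) + 2 * s) * ((d x - d y)\<^sup>2 * (2 * h) powr - (real CARD('n) + 2 * s))"
        using h by (simp only: powr_minus) (simp add: field_simps)
      also have "\<dots> \<le> (2 * h) powr (real CARD('n) + 2 * s) * ((d x - d y)\<^sup>2 * kernel s x y)"
        using k by (intro mult_left_mono) auto
      finally have "ennreal ((d x - d y)\<^sup>2) \<le> ennreal ((2 * h) powr (real CARD('n) + 2 * s) * ((d x - d y)\<^sup>2 * kernel s x y))"
        by (rule ennreal_leI)
      then show ?thesis using True kernel_nonneg[of s x y] by (simp add: ennreal_mult)
    qed auto
    have "J \<le> (\<integral>\<^sup>+y. ennreal ((2 * h) powr (real CARD('n) + 2 * s)) * ennreal ((d x - d y)\<^sup>2 * kernel s x y) \<partial>lborel)"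
      unfolding J_def by (intro nn_integral_mono pw)
    also have "\<dots> = ennreal ((2 * h) powr (real CARD('n) + 2 * s)) * energy_density s d x"
      unfolding energy_density_def by (subst nn_integral_cmult) auto
    finally show ?thesis .
  qed
  note 2
  also have "ennreal (2 / V) * ennreal (V * (d x)\<^sup>2 - 2 * d x * I)
      \<le> ennreal (2 / V) * (ennreal ((2 * h) powr (real CARD('n) + 2 * s)) * energy_density s d x)"
    using J1 J2 by (intro mult_left_mono) auto
  also have "\<dots> = ennreal (2 / V * (2 * h) powr (real CARD('n) + 2 * s)) * energy_density s d x"
    using V0 by (subst ennreal_mult) (auto simp: mult.assoc)
  finally show ?thesis by (simp add: add_right_mono)
qed

text \<open>At each scale, finitely many balls cover the closure of \<Omega>. A diagonal subsequence
  makes the integrals over all these balls converge; the distance of two members is then bounded by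
  \<open>h powr (2 * s)\<close> times the energy plus a term from the differences of the integrals.
  The scale is fixed first, the index afterwards.\<close>

lemma L2_precompact:
  fixes \<Omega> :: "(real ^ 'n) set" and u :: "nat \<Rightarrow> real ^ 'n \<Rightarrow> real"
  assumes s: "0 < s" "s < 1" and \<Omega> [measurable]: "\<Omega> \<in> sets borel" and bd: "bounded \<Omega>"
    and pos: "emeasure lborel \<Omega> \<noteq> 0"
    and u [measurable]: "\<And>k. u k \<in> borel_measurable borel" and R: "0 \<le> R"
    and en: "\<And>k. energy_on s \<Omega> (u k) \<le> ennreal R"
    and L2: "\<And>k. (\<integral>\<^sup>+x\<in>\<Omega>. ennreal ((u k x)\<^sup>2) \<partial>lborel) \<le> ennreal R"
  shows "\<exists>r :: nat \<Rightarrow> nat. strict_mono r \<and> (\<forall>\<delta>>0. \<exists>K. \<forall>i\<ge>K. \<forall>j\<ge>K. (\<integral>\<^sup>+x\<in>\<Omega>. ennreal ((u (r i) x - u (r j) x)\<^sup>2) \<partial>lborel) \<le> ennreal \<delta>)"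
proof -
  obtain A where A: "\<And>x. x \<in> \<Omega> \<Longrightarrow> norm x \<le> A" "0 < A" using bd unfolding bounded_pos by blast
  have clA: "norm x \<le> A" if "x \<in> closure \<Omega>" for x
  proof -
    have "closure \<Omega> \<subseteq> cball 0 A" using A by (intro closure_minimal) auto
    then show ?thesis using that by auto
  qed
  obtain C where C: "0 < C" "\<forall>u \<in> borel_measurable borel.
    weighted_square s u
      \<le> ennreal C * (energy_on s \<Omega> u + square_on \<Omega> u)"
    using weighted_L2_bound[OF s \<Omega> bd pos] by blast
  define d0 where "d0 = (2 + A) powr - (real CARD('n) + 2 * s)"
  have d0: "0 < d0" using A by (simp add: d0_def)
  have d0_le: "d0 \<le> decay_weight s y" if "norm y \<le> A + 1" for y :: "real ^ 'n"
    unfolding d0_def decay_weight_def using that s by (intro powr_mono2') (auto simp: add_pos_nonneg)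
  \<comment> \<open>Covering balls have centres in the closure and radius at most 1, so they may
    leave \<Omega>. All of them lie in \<open>D\<close>, on which the weighted bound controls the
    functions.\<close>
  define D where "D = cball (0 :: real ^ 'n) (A + 1)"
  have [measurable]: "D \<in> sets borel" by (simp add: D_def)
  define mD where "mD = measure lborel D"
  have mD: "emeasure lborel D = ennreal mD" "0 \<le> mD"
    using emeasure_bounded_finite[of D] unfolding mD_def D_def by (auto simp: emeasure_eq_ennreal_measure)
  define M where "M = mD + C * (R + R) / d0"
  have M: "0 \<le> M" using mD C R d0 by (simp add: M_def)
  have L1: "(\<integral>\<^sup>+y\<in>D. ennreal \<bar>u k y\<bar> \<partial>lborel) \<le> ennreal M" for k
  proof -
    have pw: "ennreal \<bar>u k y\<bar> * indicator D y \<le> indicator D y + ennreal (1 / d0) * ennreal ((u k y)\<^sup>2 * decay_weight s y)" for y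
    proof (cases "y \<in> D")
      case True
      have "\<bar>u k y\<bar> \<le> 1 + (u k y)\<^sup>2"
        using zero_le_power2[of "\<bar>u k y\<bar> - 1"] by (simp add: power2_diff)
      also have "(u k y)\<^sup>2 \<le> 1 / d0 * ((u k y)\<^sup>2 * decay_weight s y)"
      proof -
        have "(u k y)\<^sup>2 * d0 \<le> (u k y)\<^sup>2 * decay_weight s y"
          using True by (intro mult_left_mono d0_le) (auto simp: D_def)
        then show ?thesis using d0 by (simp add: field_simps)
      qed
      finally have "ennreal \<bar>u k y\<bar> \<le> ennreal (1 + 1 / d0 * ((u k y)\<^sup>2 * decay_weight s y))"
        by (intro ennreal_leI) simp
      also have "\<dots> = 1 + ennreal (1 / d0) * ennreal ((u k y)\<^sup>2 * decay_weight s y)"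
        using d0 decay_weight_pos[of s y] by (subst ennreal_plus) (auto simp: ennreal_mult[symmetric] mult_nonneg_nonneg)
      finally show ?thesis using True by simp
    qed auto
    have "(\<integral>\<^sup>+y\<in>D. ennreal \<bar>u k y\<bar> \<partial>lborel) \<le> (\<integral>\<^sup>+y. indicator D y + ennreal (1 / d0) * ennreal ((u k y)\<^sup>2 * decay_weight s y) \<partial>lborel)"
      by (intro nn_integral_mono pw)
    also have "\<dots> = emeasure lborel D + ennreal (1 / d0) * weighted_square s (u k)"
      by (subst nn_integral_add) (auto simp: nn_integral_cmult)
    also have "\<dots> \<le> ennreal mD + ennreal (1 / d0) * (ennreal C * (ennreal R + ennreal R))"
      unfolding mD(1)
      by (intro add_left_mono mult_left_mono order_trans[OF C(2)[rule_format, OF u]] add_mono en L2) auto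
    also have "\<dots> = ennreal M"
    proof -
      have "ennreal M = ennreal mD + ennreal (1 / d0 * (C * (R + R)))"
        using d0 C(1) R mD(2) by (subst ennreal_plus[symmetric]) (auto simp: M_def)
      also have "ennreal (1 / d0 * (C * (R + R))) = ennreal (1 / d0) * (ennreal C * ennreal (R + R))"
        using d0 C(1) R by (simp only: ennreal_mult divide_nonneg_pos mult_nonneg_nonneg add_nonneg_nonneg less_imp_le zero_le_one)
      finally show ?thesis unfolding ennreal_plus[OF R R] ..
    qed
    finally show ?thesis .
  qed
  have ball_sub: "ball c h \<subseteq> D" if "norm c \<le> A" "h \<le> 1" for c h
  proof
    fix y assume "y \<in> ball c h"
    then show "y \<in> D" using that norm_triangle_ineq2[of y c] by (auto simp: D_def dist_norm norm_minus_commute)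
  qed
  have int: "set_integrable lborel (ball c h) (u k)" if "norm c \<le> A" "h \<le> 1" for c h k
  proof -
    have "set_integrable lborel D (u k)"
      unfolding set_integrable_def
    proof (rule integrableI_bounded)
      have "(\<integral>\<^sup>+y. ennreal (norm (indicator D y *\<^sub>R u k y)) \<partial>lborel) = (\<integral>\<^sup>+y\<in>D. ennreal \<bar>u k y\<bar> \<partial>lborel)"
        by (intro nn_integral_cong) (auto simp: indicator_def)
      also have "\<dots> < \<infinity>" using L1[of k] by (simp add: le_less_trans[OF _ ennreal_less_top])
      finally show "(\<integral>\<^sup>+y. ennreal (norm (indicator D y *\<^sub>R u k y)) \<partial>lborel) < \<infinity>" .
    qed measurable
    then show ?thesis by (rule set_integrable_subset) (use ball_sub[OF that] in auto)
  qed
  have int_le: "\<bar>LINT y:ball c h|lborel. u k y\<bar> \<le> M" if "norm c \<le> A" "h \<le> 1" for c h k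
  proof -
    have "ennreal \<bar>LINT y:ball c h|lborel. u k y\<bar> \<le> (\<integral>\<^sup>+y. ennreal (norm (indicator (ball c h) y *\<^sub>R u k y)) \<partial>lborel)"
      using int[OF that, of k] integral_norm_bound_ennreal[of lborel "\<lambda>y. indicator (ball c h) y *\<^sub>R u k y"]
      unfolding set_lebesgue_integral_def set_integrable_def by simp
    also have "\<dots> \<le> (\<integral>\<^sup>+y\<in>D. ennreal \<bar>u k y\<bar> \<partial>lborel)"
      using ball_sub[OF that] by (intro nn_integral_mono) (auto simp: indicator_def)
    also have "\<dots> \<le> ennreal M" by (rule L1)
    finally show ?thesis using M by simp
  qed
  define H where "H m = 1 / (real m + 1)" for m :: nat
  have H: "0 < H m" "H m \<le> 1" for m by (auto simp: H_def)
  have "\<exists>F. finite F \<and> F \<subseteq> closure \<Omega> \<and> closure \<Omega> \<subseteq> (\<Union>c\<in>F. ball c (H m))" for m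
  proof -
    have "compact (closure \<Omega>)" using bd by (simp add: compact_closure)
    moreover have "closure \<Omega> \<subseteq> (\<Union>c\<in>closure \<Omega>. ball c (H m))" using H(1)[of m] by fastforce
    ultimately show ?thesis
      using compactE_image[of "closure \<Omega>" "closure \<Omega>" "\<lambda>c. ball c (H m)"] by (metis open_ball)
  qed
  then obtain F where F: "\<And>m. finite (F m)" "\<And>m. F m \<subseteq> closure \<Omega>" "\<And>m. closure \<Omega> \<subseteq> (\<Union>c\<in>F m. ball c (H m))"
    by metis
  define a where "a k z = (LINT y:ball (snd z) (H (fst z))|lborel. u k y)" for k :: nat and z :: "nat \<times> (real ^ 'n)"
  have cnt: "countable (Sigma UNIV F)" using F(1) by (intro countable_SIGMA) (auto intro: countable_finite)
  have abd: "norm (a k z) \<le> M" if "z \<in> Sigma UNIV F" for k z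
  proof -
    have "snd z \<in> F (fst z)" using that by auto
    then have "norm (snd z) \<le> A" using F(2) clA by blast
    then show ?thesis unfolding a_def using int_le H by simp
  qed
  \<comment> \<open>Cantor's diagonal argument over the countably many pairs of a scale and a
    centre, so that the subsequence does not depend on the scale.\<close>
  obtain r where r: "strict_mono r" "\<And>z. z \<in> Sigma UNIV F \<Longrightarrow> \<exists>l. (\<lambda>k. a (r k) z) \<longlonglongrightarrow> l"
    using function_convergent_subsequence[where f = a and M = M, OF cnt abd] by blast
  define m where "m = measure lborel \<Omega>"
  have m: "emeasure lborel \<Omega> = ennreal m" "0 \<le> m"
    using emeasure_bounded_finite[OF bd] unfolding m_def by (auto simp: emeasure_eq_ennreal_measure)
  define \<omega> where "\<omega> = unit_ball_vol (real CARD('n))"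
  have \<omega>: "0 < \<omega>" by (simp add: \<omega>_def)
  have "\<exists>K. \<forall>i\<ge>K. \<forall>j\<ge>K. (\<integral>\<^sup>+x\<in>\<Omega>. ennreal ((u (r i) x - u (r j) x)\<^sup>2) \<partial>lborel) \<le> ennreal \<delta>" if \<delta>: "0 < \<delta>" for \<delta>
  proof -
    define A1 where "A1 = 2 / \<omega> * 2 powr (real CARD('n) + 2 * s)"
    have coeff: "2 / (\<omega> * h ^ CARD('n)) * (2 * h) powr (real CARD('n) + 2 * s) = A1 * h powr (2 * s)" if h: "0 < h" for h
    proof -
      have "(2 * h) powr (real CARD('n) + 2 * s) = 2 powr (real CARD('n) + 2 * s) * (h ^ CARD('n) * h powr (2 * s))"
        using h by (simp add: powr_mult powr_add powr_realpow)
      then show ?thesis using h \<omega> by (simp add: A1_def)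
    qed
    \<comment> \<open>\<open>4 * R\<close> bounds the energy of every difference
      \<open>u (r i) - u (r j)\<close>, so the scale can be chosen before the indices.\<close>
    have "(\<lambda>m. A1 * (inverse (real (Suc m))) powr (2 * s) * (4 * R)) \<longlonglongrightarrow> A1 * 0 powr (2 * s) * (4 * R)"
      using s by (intro tendsto_intros LIMSEQ_inverse_real_of_nat tendsto_powr' ) auto
    then have "(\<lambda>m. A1 * H m powr (2 * s) * (4 * R)) \<longlonglongrightarrow> 0"
      using s by (simp add: H_def inverse_eq_divide add.commute)
    then have "eventually (\<lambda>m. A1 * H m powr (2 * s) * (4 * R) < \<delta> / 2) sequentially"
      using \<delta> by (intro order_tendstoD) auto
    then obtain k where k: "A1 * H k powr (2 * s) * (4 * R) < \<delta> / 2" by (auto simp: eventually_sequentially)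
    define h where "h = H k"
    have h: "0 < h" "h \<le> 1" using H by (auto simp: h_def)
    define V where "V = \<omega> * h ^ CARD('n)"
    have V: "0 < V" using \<omega> h by (simp add: V_def)
    \<comment> \<open>Solves
      \<open>4 * \<eta>\<^sup>2 / V\<^sup>2 * (m + 1) = \<delta> / 2\<close>.\<close>
    define \<eta> where "\<eta> = sqrt (\<delta> * V\<^sup>2 / (8 * (m + 1)))"
    have \<eta>: "0 < \<eta>" using \<delta> V m by (simp add: \<eta>_def)
    have \<eta>2: "4 * \<eta>\<^sup>2 / V\<^sup>2 * m \<le> \<delta> / 2"
    proof -
      define m' where "m' = m + 1"
      have m': "0 < m'" "m \<le> m'" using m(2) by (auto simp: m'_def)
      have "\<eta>\<^sup>2 = \<delta> * V\<^sup>2 / (8 * m')"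
        unfolding \<eta>_def m'_def using \<delta> m(2) by (intro real_sqrt_pow2) auto
      then have "4 * \<eta>\<^sup>2 / V\<^sup>2 * m = \<delta> / 2 * (m / m')"
        using V m' by simp
      also have "\<dots> \<le> \<delta> / 2 * 1"
        using \<delta> m' by (intro mult_left_mono) auto
      finally show ?thesis by simp
    qed
    have "\<exists>K. \<forall>i\<ge>K. \<forall>j\<ge>K. \<bar>a (r i) (k, c) - a (r j) (k, c)\<bar> \<le> \<eta>" if c: "c \<in> F k" for c
    proof -
      have "Cauchy (\<lambda>i. a (r i) (k, c))"
        using r(2)[of "(k, c)"] c by (intro convergent_Cauchy) (auto simp: convergent_def)
      then show ?thesis using \<eta> unfolding Cauchy_def dist_real_def by (meson less_imp_le)
    qed
    then obtain KK where KK: "\<And>c i j. c \<in> F k \<Longrightarrow> KK c \<le> i \<Longrightarrow> KK c \<le> j \<Longrightarrow> \<bar>a (r i) (k, c) - a (r j) (k, c)\<bar> \<le> \<eta>"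
      by metis
    define K where "K = Max (insert 0 (KK ` F k))"
    have K: "KK c \<le> K" if "c \<in> F k" for c unfolding K_def using F(1) that by auto
    have "(\<integral>\<^sup>+x\<in>\<Omega>. ennreal ((u (r i) x - u (r j) x)\<^sup>2) \<partial>lborel) \<le> ennreal \<delta>" if ij: "K \<le> i" "K \<le> j" for i j
    proof -
      define d where "d x = u (r i) x - u (r j) x" for x
      have [measurable]: "d \<in> borel_measurable borel" unfolding d_def by measurable
      have pw: "ennreal ((d x)\<^sup>2) \<le> ennreal (A1 * h powr (2 * s)) * energy_density s d x + ennreal (4 * \<eta>\<^sup>2 / V\<^sup>2)"
        if x: "x \<in> \<Omega>" for x
      proof -
        obtain c where c: "c \<in> F k" "x \<in> ball c h" using F(3)[of k] x closure_subset[of \<Omega>] unfolding h_def by blast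
        then have cA: "norm c \<le> A" using F(2) clA by blast
        have i: "set_integrable lborel (ball c h) (u (r i))" "set_integrable lborel (ball c h) (u (r j))"
          using int[OF cA h(2)] by auto
        have di: "set_integrable lborel (ball c h) d"
          unfolding d_def by (intro set_integral_diff i)
        have "(LINT y:ball c h|lborel. d y) = a (r i) (k, c) - a (r j) (k, c)"
          unfolding d_def using i by (simp add: set_integral_diff a_def h_def)
        then have "\<bar>LINT y:ball c h|lborel. d y\<bar> \<le> \<eta>"
          using KK[OF c(1)] K[OF c(1)] ij by simp
        from square_le_ball_average[OF _ di h(1) s(1) c(2) this V_def[unfolded \<omega>_def]]
        show ?thesis using coeff[OF h(1)] by (simp add: V_def)
      qed
      have dE: "energy_density s d x \<le> 2 * energy_density s (u (r i)) x + 2 * energy_density s (u (r j)) x" for x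
        unfolding d_def by (intro energy_density_diff) auto
      have "energy_on s \<Omega> d
        \<le> (\<integral>\<^sup>+x. 2 * (energy_density s (u (r i)) x * indicator \<Omega> x) + 2 * (energy_density s (u (r j)) x * indicator \<Omega> x) \<partial>lborel)"
        using dE by (intro nn_integral_mono) (auto simp: indicator_def)
      also have "\<dots> = 2 * energy_on s \<Omega> (u (r i)) + 2 * energy_on s \<Omega> (u (r j))"
        by (subst nn_integral_add) (auto simp: nn_integral_cmult)
      also have "\<dots> \<le> 2 * ennreal R + 2 * ennreal R"
        by (intro add_mono mult_left_mono en) auto
      also have "\<dots> = ennreal (4 * R)"
        using R by (simp add: ennreal_mult flip: distrib_right)
      finally have dR: "energy_on s \<Omega> d \<le> ennreal (4 * R)" .
      have A1: "0 \<le> A1" using \<omega> by (simp add: A1_def)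
      have "square_on \<Omega> d
        \<le> (\<integral>\<^sup>+x. ennreal (A1 * h powr (2 * s)) * (energy_density s d x * indicator \<Omega> x) + ennreal (4 * \<eta>\<^sup>2 / V\<^sup>2) * indicator \<Omega> x \<partial>lborel)"
        using pw by (intro nn_integral_mono) (auto simp: indicator_def)
      also have "\<dots> = ennreal (A1 * h powr (2 * s)) * energy_on s \<Omega> d + ennreal (4 * \<eta>\<^sup>2 / V\<^sup>2) * ennreal m"
        by (subst nn_integral_add) (auto simp: nn_integral_cmult m)
      also have "\<dots> \<le> ennreal (A1 * h powr (2 * s)) * ennreal (4 * R) + ennreal (4 * \<eta>\<^sup>2 / V\<^sup>2) * ennreal m"
        by (intro add_right_mono mult_left_mono dR) auto
      also have "\<dots> = ennreal (A1 * h powr (2 * s) * (4 * R) + 4 * \<eta>\<^sup>2 / V\<^sup>2 * m)"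
        using A1 R m by (simp add: ennreal_mult[symmetric])
      also have "\<dots> \<le> ennreal \<delta>"
        using k \<eta>2 unfolding h_def by (intro ennreal_leI) simp
      finally show ?thesis unfolding d_def .
    qed
    then show ?thesis by blast
  qed
  then show ?thesis using r(1) by blast
qed

section \<open>Convexity inequalities and the quadratic form\<close>

text \<open>The convex function \<open>\<bar>t\<bar> powr q\<close> lies above its tangent at
  \<open>a\<close>. By homogeneity this reduces to
  \<open>1 + q * (t - 1) \<le> \<bar>t\<bar> powr q\<close> for \<open>t = b / a\<close>:
  Bernoulli's inequality, obtained for positive \<open>t\<close> from Young's inequality with one
  factor equal to 1.\<close>

lemma powr_tangent_le:
  fixes a b q :: real
  assumes q: "1 < q"
  shows "\<bar>a\<bar> powr q + q * (\<bar>a\<bar> powr (q - 2) * a) * (b - a) \<le> \<bar>b\<bar> powr q"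
proof (cases "a = 0")
  case False
  define t where "t = b / a"
  have b: "b = t * a" using False by (simp add: t_def)
  have a2: "\<bar>a\<bar> powr (q - 2) * a\<^sup>2 = \<bar>a\<bar> powr q"
  proof -
    have "\<bar>a\<bar> powr q = \<bar>a\<bar> powr ((q - 2) + 2)" by simp
    also have "\<dots> = \<bar>a\<bar> powr (q - 2) * \<bar>a\<bar> powr 2" by (rule powr_add)
    also have "\<bar>a\<bar> powr 2 = a\<^sup>2" using False by (simp add: powr_numeral)
    finally show ?thesis by simp
  qed
  have t: "1 + q * (t - 1) \<le> \<bar>t\<bar> powr q"
  proof (cases "0 < t")
    case True
    have "(t powr q) powr (1 / q) * 1 powr (1 - 1 / q) \<le> 1 / q * t powr q + (1 - 1 / q) * 1"
      using q True by (intro Youngs_inequality_0) auto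
    then have "t \<le> 1 / q * t powr q + (1 - 1 / q)" using True q by (simp add: powr_powr)
    then have "q * t \<le> q * (1 / q * t powr q + (1 - 1 / q))" using q by (intro mult_left_mono) auto
    then show ?thesis using True q by (simp add: algebra_simps)
  next
    case False
    then have "q * (t - 1) \<le> q * (- 1)" using q by (intro mult_left_mono) auto
    then have "1 + q * (t - 1) \<le> 0" using q by simp
    then show ?thesis by (rule order_trans) simp
  qed
  have "\<bar>a\<bar> powr q + q * (\<bar>a\<bar> powr (q - 2) * a) * (b - a)
      = \<bar>a\<bar> powr q + q * (\<bar>a\<bar> powr (q - 2) * a\<^sup>2) * (t - 1)"
    by (simp add: b algebra_simps power2_eq_square)
  also have "\<dots> = (1 + q * (t - 1)) * \<bar>a\<bar> powr q" unfolding a2 by (simp add: algebra_simps)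
  also have "\<dots> \<le> \<bar>t\<bar> powr q * \<bar>a\<bar> powr q" using t by (intro mult_right_mono) auto
  also have "\<dots> = \<bar>b\<bar> powr q" by (simp add: b abs_mult powr_mult)
  finally show ?thesis .
qed simp

lemma abs_powr_mult_self:
  fixes a q :: real
  assumes "1 < q"
  shows "\<bar>\<bar>a\<bar> powr (q - 2) * a\<bar> = \<bar>a\<bar> powr (q - 1)"
proof (cases "a = 0")
  case False
  have "\<bar>a\<bar> powr (q - 1) = \<bar>a\<bar> powr ((q - 2) + 1)" by simp
  also have "\<dots> = \<bar>a\<bar> powr (q - 2) * \<bar>a\<bar>" using False unfolding powr_add by simp
  finally show ?thesis by (simp add: abs_mult)
qed (use assms in simp)

text \<open>Whichever of \<open>\<bar>h\<bar>\<close> and \<open>\<theta> * \<bar>a\<bar>\<close> is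
  larger bounds the product by one of the two terms. The constants are not optimal, but they are
  explicit in \<theta>.\<close>

lemma powr_young:
  fixes a h q \<theta> :: real
  assumes q: "1 < q" and \<theta>: "0 < \<theta>"
  shows "\<bar>a\<bar> powr (q - 1) * \<bar>h\<bar> \<le> \<theta> * \<bar>a\<bar> powr q + \<theta> powr (1 - q) * \<bar>h\<bar> powr q"
proof -
  have mulq: "x powr (q - 1) * x = x powr q" if "0 \<le> x" for x :: real
  proof (cases "x = 0")
    case False
    then have "x powr q = x powr ((q - 1) + 1)" by simp
    also have "\<dots> = x powr (q - 1) * x" using False that unfolding powr_add by simp
    finally show ?thesis by simp
  qed simp
  show ?thesis
  proof (cases "\<bar>h\<bar> \<le> \<theta> * \<bar>a\<bar>")
    case True
    have "\<bar>a\<bar> powr (q - 1) * \<bar>h\<bar> \<le> \<bar>a\<bar> powr (q - 1) * (\<theta> * \<bar>a\<bar>)"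
      using True by (intro mult_left_mono) auto
    also have "\<dots> = \<theta> * \<bar>a\<bar> powr q" using mulq[of "\<bar>a\<bar>"] by (simp add: mult_ac)
    finally show ?thesis by (simp add: add_increasing2)
  next
    case False
    then have "\<bar>a\<bar> \<le> \<bar>h\<bar> / \<theta>" using \<theta> by (simp add: field_simps)
    then have "\<bar>a\<bar> powr (q - 1) * \<bar>h\<bar> \<le> (\<bar>h\<bar> / \<theta>) powr (q - 1) * \<bar>h\<bar>"
      using q by (intro mult_right_mono powr_mono2) auto
    also have "\<dots> = \<theta> powr (1 - q) * (\<bar>h\<bar> powr (q - 1) * \<bar>h\<bar>)"
      using \<theta> by (simp add: powr_divide powr_diff field_simps)
    also have "\<dots> = \<theta> powr (1 - q) * \<bar>h\<bar> powr q" using mulq[of "\<bar>h\<bar>"] by simp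
    finally show ?thesis using \<theta> by (simp add: add_increasing)
  qed
qed

text \<open>The tangent inequality at \<open>a\<close>, with the linear term absorbed by
  \<open>powr_young\<close>. Integrated, it says that a perturbation small in the q-th power cannot
  lower the constraint integral by much.\<close>

lemma powr_add_ge:
  fixes a h q \<theta> :: real
  assumes q: "1 < q" and \<theta>: "0 < \<theta>"
  shows "(1 - q * \<theta>) * \<bar>a\<bar> powr q - q * \<theta> powr (1 - q) * \<bar>h\<bar> powr q \<le> \<bar>a + h\<bar> powr q"
proof -
  have "- (q * (\<bar>a\<bar> powr (q - 2) * a) * h) \<le> q * (\<bar>a\<bar> powr (q - 1) * \<bar>h\<bar>)"
  proof -
    have "- (q * (\<bar>a\<bar> powr (q - 2) * a) * h) \<le> \<bar>q * (\<bar>a\<bar> powr (q - 2) * a) * h\<bar>" by (rule abs_ge_minus_self)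
    also have "\<dots> = q * (\<bar>a\<bar> powr (q - 1) * \<bar>h\<bar>)"
      unfolding abs_mult[of _ h] abs_mult[of q] abs_powr_mult_self[OF q] using q by simp
    finally show ?thesis .
  qed
  also have "\<dots> \<le> q * (\<theta> * \<bar>a\<bar> powr q + \<theta> powr (1 - q) * \<bar>h\<bar> powr q)"
    using powr_young[OF q \<theta>] q by (intro mult_left_mono) auto
  finally show ?thesis
    using powr_tangent_le[OF q, of a "a + h"] by (simp add: algebra_simps)
qed

text \<open>Split at height \<open>T\<close>. A bound for the power \<open>q1\<close> makes the part
  above \<open>T\<close> small for large \<open>T\<close>; smallness of the square integral then
  handles the part below.\<close>

lemma powr_interpolation:
  fixes t T q q1 :: real
  assumes "2 \<le> q" "q \<le> q1" "0 < T"
  shows "\<bar>t\<bar> powr q \<le> T powr (q - 2) * t\<^sup>2 + T powr (q - q1) * \<bar>t\<bar> powr q1"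
proof (cases "t = 0")
  case False
  show ?thesis
  proof (cases "\<bar>t\<bar> \<le> T")
    case True
    have "\<bar>t\<bar> powr q = \<bar>t\<bar> powr ((q - 2) + 2)" by simp
    also have "\<dots> = \<bar>t\<bar> powr (q - 2) * \<bar>t\<bar> powr 2" by (rule powr_add)
    also have "\<bar>t\<bar> powr 2 = t\<^sup>2" using False by (simp add: powr_numeral)
    also have "\<bar>t\<bar> powr (q - 2) * t\<^sup>2 \<le> T powr (q - 2) * t\<^sup>2"
      using True assms by (intro mult_right_mono powr_mono2) auto
    finally show ?thesis by (simp add: add_increasing2)
  next
    case False
    have "\<bar>t\<bar> powr q = \<bar>t\<bar> powr ((q - q1) + q1)" by simp
    also have "\<dots> = \<bar>t\<bar> powr (q - q1) * \<bar>t\<bar> powr q1" by (rule powr_add)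
    also have "\<dots> \<le> T powr (q - q1) * \<bar>t\<bar> powr q1"
      using False assms by (intro mult_right_mono powr_mono2') auto
    finally show ?thesis by (simp add: add_increasing)
  qed
qed simp

section \<open>The expansion of squares, and Borel representatives of Lebesgue measurable
  functions\<close>

lemma integrable_mult_of_squares:
  fixes f g :: "'a \<Rightarrow> real"
  assumes [measurable]: "f \<in> borel_measurable M" "g \<in> borel_measurable M"
    and "integrable M (\<lambda>x. (f x)\<^sup>2)" "integrable M (\<lambda>x. (g x)\<^sup>2)"
  shows "integrable M (\<lambda>x. f x * g x)"
proof (rule Bochner_Integration.integrable_bound)
  show "integrable M (\<lambda>x. (f x)\<^sup>2 + (g x)\<^sup>2)" using assms by simp
  have "\<bar>a * b\<bar> \<le> a\<^sup>2 + b\<^sup>2" for a b :: real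
    using sum_squares_bound[of "\<bar>a\<bar>" "\<bar>b\<bar>"] mult_nonneg_nonneg[OF abs_ge_zero[of a] abs_ge_zero[of b]]
    unfolding abs_mult power2_abs by linarith
  then show "AE x in M. norm (f x * g x) \<le> norm ((f x)\<^sup>2 + (g x)\<^sup>2)" by simp
qed measurable

lemma square_expand:
  fixes f g :: "'a \<Rightarrow> real" and t :: real
  assumes "f \<in> borel_measurable M" "g \<in> borel_measurable M"
    and "integrable M (\<lambda>x. (f x)\<^sup>2)" "integrable M (\<lambda>x. (g x)\<^sup>2)"
  shows "integrable M (\<lambda>x. (f x + t * g x)\<^sup>2)"
    and "(\<integral>x. (f x + t * g x)\<^sup>2 \<partial>M) = (\<integral>x. f x * f x \<partial>M) + 2 * t * (\<integral>x. f x * g x \<partial>M) + t\<^sup>2 * (\<integral>x. g x * g x \<partial>M)"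
proof -
  have i: "integrable M (\<lambda>x. f x * f x)" "integrable M (\<lambda>x. g x * g x)" "integrable M (\<lambda>x. f x * g x)"
    using assms integrable_mult_of_squares by (auto simp: power2_eq_square)
  have e: "(f x + t * g x)\<^sup>2 = f x * f x + 2 * t * (f x * g x) + t\<^sup>2 * (g x * g x)" for x
    by (simp add: power2_eq_square algebra_simps)
  show "integrable M (\<lambda>x. (f x + t * g x)\<^sup>2)" unfolding e using i by simp
  show "(\<integral>x. (f x + t * g x)\<^sup>2 \<partial>M) = (\<integral>x. f x * f x \<partial>M) + 2 * t * (\<integral>x. f x * g x \<partial>M) + t\<^sup>2 * (\<integral>x. g x * g x \<partial>M)"
    unfolding e using i by simp
qed

text \<open>The exceptional set lies in two strips over a null set, of measure
  \<open>0 * \<infinity> = 0\<close>. Hence double integrals depend only on the class of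
  \<open>u\<close>.\<close>

lemma AE_lborel_prod:
  fixes P :: "'a::euclidean_space \<Rightarrow> bool"
  assumes "AE x in lborel. P x"
  shows "AE z in (lborel :: ('a \<times> 'a) measure). P (fst z) \<and> P (snd z)"
proof -
  obtain N where N: "{x \<in> space lborel. \<not> P x} \<subseteq> N" "emeasure lborel N = 0" "N \<in> sets lborel"
    using assms by (rule AE_E)
  have [measurable]: "N \<in> sets borel" using N by simp
  have n1: "N \<times> (UNIV :: 'a set) \<in> null_sets lborel" 
  proof (rule null_setsI)
    have "emeasure (lborel \<Otimes>\<^sub>M lborel) (N \<times> (UNIV :: 'a set)) = emeasure lborel N * emeasure lborel (UNIV :: 'a set)"
      by (intro lborel.emeasure_pair_measure_Times) auto
    then show "emeasure lborel (N \<times> (UNIV :: 'a set)) = 0" using N by (simp add: lborel_prod)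
    show "N \<times> (UNIV :: 'a set) \<in> sets lborel" unfolding sets_lborel borel_prod[symmetric] by auto
  qed
  have n2: "(UNIV :: 'a set) \<times> N \<in> null_sets lborel" 
  proof (rule null_setsI)
    have "emeasure (lborel \<Otimes>\<^sub>M lborel) ((UNIV :: 'a set) \<times> N) = emeasure lborel (UNIV :: 'a set) * emeasure lborel N"
      by (intro lborel.emeasure_pair_measure_Times) auto
    then show "emeasure lborel ((UNIV :: 'a set) \<times> N) = 0" using N by (simp add: lborel_prod)
    show "(UNIV :: 'a set) \<times> N \<in> sets lborel" unfolding sets_lborel borel_prod[symmetric] by auto
  qed
  show ?thesis
    using AE_not_in[OF n1] AE_not_in[OF n2]
  proof eventually_elim
    case (elim z)
    then show ?case using N(1) by (cases z) auto
  qed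
qed

text \<open>The bridge from \<open>lebesgue\<close> to \<open>lborel\<close>. Measurability of
  \<open>g\<close> is a consequence: the completed measure makes any function that agrees almost
  everywhere with a Borel function measurable.\<close>

lemma lebesgue_integral_AE_borel:
  fixes f g :: "'a::euclidean_space \<Rightarrow> real"
  assumes f [measurable]: "f \<in> borel_measurable borel" and ae: "AE x in lborel. f x = g x"
  shows "integrable lebesgue g \<longleftrightarrow> integrable lborel f" "integral\<^sup>L lebesgue g = integral\<^sup>L lborel f"
proof -
  have f': "f \<in> borel_measurable lebesgue" using f by (intro measurable_completion) simp
  have ae': "AE x in lebesgue. f x = g x" using ae by (rule AE_completion)
  have g': "g \<in> borel_measurable lebesgue" by (rule borel_measurable_AE[OF f' ae'])
  have ae2: "AE x in lebesgue. g x = f x" using ae' by eventually_elim simp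
  have "integrable lebesgue g \<longleftrightarrow> integrable lebesgue f"
    by (rule integrable_cong_AE[OF g' f' ae2])
  also have "\<dots> \<longleftrightarrow> integrable lborel f" by (rule integrable_completion) simp
  finally show "integrable lebesgue g \<longleftrightarrow> integrable lborel f" .
  have "integral\<^sup>L lebesgue g = integral\<^sup>L lebesgue f"
    by (rule integral_cong_AE[OF g' f' ae2])
  also have "\<dots> = integral\<^sup>L lborel f" by (rule integral_completion) simp
  finally show "integral\<^sup>L lebesgue g = integral\<^sup>L lborel f" .
qed

text \<open>With the square root of the kernel the Gagliardo form becomes an ordinary integral of a
  product. Together with \<open>restriction\<close> this represents the inner product by two
  square-integrable functions that depend linearly on \<open>u\<close>.\<close>

definition cross_difference :: "real \<Rightarrow> (real ^ 'n) set \<Rightarrow> (real ^ 'n \<Rightarrow> real) \<Rightarrow> (real ^ 'n) \<times> (real ^ 'n) \<Rightarrow> real" where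
  "cross_difference s \<Omega> u z = indicator (cross_set \<Omega>) z * ((u (fst z) - u (snd z)) * sqrt (kernel s (fst z) (snd z)))"

definition restriction :: "(real ^ 'n) set \<Rightarrow> (real ^ 'n \<Rightarrow> real) \<Rightarrow> real ^ 'n \<Rightarrow> real" where
  "restriction \<Omega> u x = indicator \<Omega> x * u x"

lemma sets_cross_set [measurable]: 
  assumes [measurable]: "\<Omega> \<in> sets borel" shows "cross_set \<Omega> \<in> sets borel"
proof -
  have "(- \<Omega>) \<times> (- \<Omega>) \<in> sets (borel \<Otimes>\<^sub>M borel)" by measurable
  then show ?thesis unfolding cross_set_def borel_prod by simp
qed

lemma measurable_cross_difference [measurable]:
  assumes [measurable]: "\<Omega> \<in> sets borel" "u \<in> borel_measurable borel"
  shows "cross_difference s \<Omega> u \<in> borel_measurable borel"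
proof -
  have f: "(fst :: (real ^ 'n) \<times> (real ^ 'n) \<Rightarrow> _) \<in> borel_measurable borel"
    and g: "(snd :: (real ^ 'n) \<times> (real ^ 'n) \<Rightarrow> _) \<in> borel_measurable borel"
    by (intro borel_measurable_continuous_onI continuous_intros)+
  note [measurable] = measurable_compose[OF f assms(2)] measurable_compose[OF g assms(2)]
  have [measurable]: "(\<lambda>z :: (real ^ 'n) \<times> (real ^ 'n). kernel s (fst z) (snd z)) \<in> borel_measurable borel"
    by (rule measurable_kernel[OF f g])
  show ?thesis unfolding cross_difference_def by measurable
qed

lemma measurable_restriction [measurable]:
  assumes [measurable]: "\<Omega> \<in> sets borel" "u \<in> borel_measurable borel"
  shows "restriction \<Omega> u \<in> borel_measurable borel"
  unfolding restriction_def by measurable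

lemma cross_difference_mult:
  "cross_difference s \<Omega> u z * cross_difference s \<Omega> v z
    = indicator (cross_set \<Omega>) z * ((u (fst z) - u (snd z)) * (v (fst z) - v (snd z)) * kernel s (fst z) (snd z))"
  by (auto simp: cross_difference_def indicator_def kernel_nonneg)

lemma restriction_mult: "restriction \<Omega> u x * restriction \<Omega> v x = indicator \<Omega> x * (u x * v x)"
  by (auto simp: restriction_def indicator_def)

lemma cross_difference_linear:
  "cross_difference s \<Omega> (\<lambda>x. u x + t * v x) z = cross_difference s \<Omega> u z + t * cross_difference s \<Omega> v z"
  by (simp add: cross_difference_def algebra_simps)

lemma restriction_linear: "restriction \<Omega> (\<lambda>x. u x + t * v x) x = restriction \<Omega> u x + t * restriction \<Omega> v x"
  by (simp add: restriction_def algebra_simps)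

lemma gagliardo_form_AE_borel:
  fixes \<Omega> :: "(real ^ 'n) set"
  assumes [measurable]: "\<Omega> \<in> sets borel" "u' \<in> borel_measurable borel" "v' \<in> borel_measurable borel"
    and u: "AE x in lborel. u x = u' x" and v: "AE x in lborel. v x = v' x"
  shows "gagliardo_form s \<Omega> u v = (\<integral>z. cross_difference s \<Omega> u' z * cross_difference s \<Omega> v' z \<partial>lborel)"
  unfolding gagliardo_form_def set_lebesgue_integral_def
proof (rule lebesgue_integral_AE_borel(2))
  show "(\<lambda>z. cross_difference s \<Omega> u' z * cross_difference s \<Omega> v' z) \<in> borel_measurable borel" by measurable
  show "AE z in lborel. cross_difference s \<Omega> u' z * cross_difference s \<Omega> v' z =
      indicator (cross_set \<Omega>) z *\<^sub>R (case z of (x, y) \<Rightarrow> (u x - u y) * (v x - v y) * kernel s x y)"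
    using AE_lborel_prod[OF u] AE_lborel_prod[OF v]
    by eventually_elim (auto simp: cross_difference_mult)
qed

lemma L2_inner_AE_borel:
  fixes \<Omega> :: "(real ^ 'n) set"
  assumes [measurable]: "\<Omega> \<in> sets borel" "u' \<in> borel_measurable borel" "v' \<in> borel_measurable borel"
    and u: "AE x in lborel. u x = u' x" and v: "AE x in lborel. v x = v' x"
  shows "set_lebesgue_integral lebesgue \<Omega> (\<lambda>x. u x * v x) = (\<integral>x. restriction \<Omega> u' x * restriction \<Omega> v' x \<partial>lborel)"
  unfolding set_lebesgue_integral_def
proof (rule lebesgue_integral_AE_borel(2))
  show "(\<lambda>x. restriction \<Omega> u' x * restriction \<Omega> v' x) \<in> borel_measurable borel" by measurable
  show "AE x in lborel. restriction \<Omega> u' x * restriction \<Omega> v' x = indicator \<Omega> x *\<^sub>R (u x * v x)"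
    using u v by eventually_elim (auto simp: restriction_mult)
qed

lemma Hs_space_AE_borel_iff:
  fixes \<Omega> :: "(real ^ 'n) set"
  assumes [measurable]: "\<Omega> \<in> sets borel" "u' \<in> borel_measurable borel"
    and u: "AE x in lborel. u x = u' x"
  shows "u \<in> Hs_space s \<Omega> \<longleftrightarrow> integrable lborel (\<lambda>z. (cross_difference s \<Omega> u' z)\<^sup>2) \<and> integrable lborel (\<lambda>x. (restriction \<Omega> u' x)\<^sup>2)"
proof -
  have "u' \<in> borel_measurable lebesgue" by (intro measurable_completion) simp
  moreover have "AE x in lebesgue. u' x = u x" using u by (intro AE_completion) (simp add: eq_commute)
  ultimately have "u \<in> borel_measurable lebesgue" by (rule borel_measurable_AE)
  moreover have "set_integrable lebesgue (cross_set \<Omega>) (\<lambda>(x, y). (u x - u y)\<^sup>2 * kernel s x y)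
      \<longleftrightarrow> integrable lborel (\<lambda>z. (cross_difference s \<Omega> u' z)\<^sup>2)"
    unfolding set_integrable_def
  proof (rule lebesgue_integral_AE_borel(1))
    show "(\<lambda>z. (cross_difference s \<Omega> u' z)\<^sup>2) \<in> borel_measurable borel" by measurable
    show "AE z in lborel. (cross_difference s \<Omega> u' z)\<^sup>2 =
        indicator (cross_set \<Omega>) z *\<^sub>R (case z of (x, y) \<Rightarrow> (u x - u y)\<^sup>2 * kernel s x y)"
      using AE_lborel_prod[OF u] unfolding power2_eq_square
      by eventually_elim (auto simp: cross_difference_mult)
  qed
  moreover have "set_integrable lebesgue \<Omega> (\<lambda>x. (u x)\<^sup>2) \<longleftrightarrow> integrable lborel (\<lambda>x. (restriction \<Omega> u' x)\<^sup>2)"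
    unfolding set_integrable_def
  proof (rule lebesgue_integral_AE_borel(1))
    show "(\<lambda>x. (restriction \<Omega> u' x)\<^sup>2) \<in> borel_measurable borel" by measurable
    show "AE x in lborel. (restriction \<Omega> u' x)\<^sup>2 = indicator \<Omega> x *\<^sub>R (u x)\<^sup>2"
      using u unfolding power2_eq_square by eventually_elim (auto simp: restriction_mult)
  qed
  ultimately show ?thesis unfolding Hs_space_def by simp
qed

lemma Hs_space_borel_representative:
  fixes \<Omega> :: "(real ^ 'n) set"
  assumes "u \<in> Hs_space s \<Omega>"
  obtains u' where "u' \<in> borel_measurable borel" "AE x in lborel. u x = u' x"
  using assms completion_ex_borel_measurable_real[of u lborel] unfolding Hs_space_def by auto

abbreviation cross_square :: "real \<Rightarrow> (real ^ 'n) set \<Rightarrow> (real ^ 'n \<Rightarrow> real) \<Rightarrow> ennreal" where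
  "cross_square s \<Omega> u \<equiv> \<integral>\<^sup>+z. ennreal ((cross_difference s \<Omega> u z)\<^sup>2) \<partial>lborel"

abbreviation restriction_square :: "(real ^ 'n) set \<Rightarrow> (real ^ 'n \<Rightarrow> real) \<Rightarrow> ennreal" where
  "restriction_square \<Omega> u \<equiv> \<integral>\<^sup>+x. ennreal ((restriction \<Omega> u x)\<^sup>2) \<partial>lborel"

text \<open>\<open>cross_set \<Omega>\<close> lies between the pairs with first point in \<Omega>
  and all pairs. The first bound feeds the integrability and compactness estimates, the second the
  test function.\<close>

lemma nn_integral_energy_density_le:
  fixes \<Omega> :: "(real ^ 'n) set"
  assumes [measurable]: "\<Omega> \<in> sets borel" "u \<in> borel_measurable borel"
  shows "energy_on s \<Omega> u \<le> cross_square s \<Omega> u"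
    and "cross_square s \<Omega> u \<le> (\<integral>\<^sup>+x. energy_density s u x \<partial>lborel)"
proof -
  have [measurable]: "cross_difference s \<Omega> u \<in> borel_measurable (borel \<Otimes>\<^sub>M borel)"
    unfolding borel_prod by measurable
  have e: "(cross_difference s \<Omega> u (x, y))\<^sup>2 = indicator (cross_set \<Omega>) (x, y) * ((u x - u y)\<^sup>2 * kernel s x y)" for x y
    unfolding power2_eq_square cross_difference_mult by simp
  have I: "cross_square s \<Omega> u = (\<integral>\<^sup>+x. \<integral>\<^sup>+y. ennreal ((cross_difference s \<Omega> u (x, y))\<^sup>2) \<partial>lborel \<partial>lborel)"
    unfolding lborel_prod[symmetric] by (subst lborel.nn_integral_fst) auto
  show "energy_on s \<Omega> u \<le> cross_square s \<Omega> u"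
    unfolding I energy_density_def
  proof (rule nn_integral_mono)
    fix x
    show "(\<integral>\<^sup>+y. ennreal ((u x - u y)\<^sup>2 * kernel s x y) \<partial>lborel) * indicator \<Omega> x
      \<le> (\<integral>\<^sup>+y. ennreal ((cross_difference s \<Omega> u (x, y))\<^sup>2) \<partial>lborel)"
      by (cases "x \<in> \<Omega>") (auto simp: e cross_set_def intro!: nn_integral_mono)
  qed
  show "cross_square s \<Omega> u \<le> (\<integral>\<^sup>+x. energy_density s u x \<partial>lborel)"
    unfolding I energy_density_def
    by (intro nn_integral_mono ennreal_leI) (auto simp: e indicator_def kernel_nonneg)
qed

section \<open>The constrained minimisation problem\<close>

text \<open>Only the sum of the two integrals is bounded, so Fatou's lemma cannot be applied with a
  separate constant to each. Both lower limits are written as suprema of increasing sequences of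
  infima, and such suprema add.\<close>

lemma nn_integral_add_Fatou:
  fixes f :: "nat \<Rightarrow> 'a \<Rightarrow> real" and g :: "nat \<Rightarrow> 'b \<Rightarrow> real"
  assumes [measurable]: "\<And>j. f j \<in> borel_measurable M" "\<And>j. g j \<in> borel_measurable M'"
    and f: "AE x in M. (\<lambda>j. f j x) \<longlonglongrightarrow> f' x" and g: "AE x in M'. (\<lambda>j. g j x) \<longlonglongrightarrow> g' x"
    and le: "\<And>j. J \<le> j \<Longrightarrow> c * (\<integral>\<^sup>+x. ennreal (f j x) \<partial>M) + (\<integral>\<^sup>+x. ennreal (g j x) \<partial>M') \<le> C"
  shows "c * (\<integral>\<^sup>+x. ennreal (f' x) \<partial>M) + (\<integral>\<^sup>+x. ennreal (g' x) \<partial>M') \<le> C"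
proof -
  define a where "a n = (INF j\<in>{n..}. \<integral>\<^sup>+x. ennreal (f j x) \<partial>M)" for n
  define b where "b n = (INF j\<in>{n..}. \<integral>\<^sup>+x. ennreal (g j x) \<partial>M')" for n
  have mono: "incseq a" "incseq b"
    unfolding a_def b_def incseq_def by (auto intro!: INF_superset_mono)
  have fa: "(\<integral>\<^sup>+x. ennreal (f' x) \<partial>M) \<le> (SUP n. a n)"
  proof -
    have "(\<integral>\<^sup>+x. ennreal (f' x) \<partial>M) = (\<integral>\<^sup>+x. liminf (\<lambda>j. ennreal (f j x)) \<partial>M)"
    proof (intro nn_integral_cong_AE)
      show "AE x in M. ennreal (f' x) = liminf (\<lambda>j. ennreal (f j x))"
        using f
      proof eventually_elim
        case (elim x)
        then show ?case by (intro lim_imp_Liminf[symmetric] tendsto_ennrealI) auto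
      qed
    qed
    also have "\<dots> \<le> liminf (\<lambda>j. \<integral>\<^sup>+x. ennreal (f j x) \<partial>M)" by (intro nn_integral_liminf) measurable
    also have "\<dots> = (SUP n. a n)" unfolding liminf_SUP_INF a_def by simp
    finally show ?thesis .
  qed
  have gb: "(\<integral>\<^sup>+x. ennreal (g' x) \<partial>M') \<le> (SUP n. b n)"
  proof -
    have "(\<integral>\<^sup>+x. ennreal (g' x) \<partial>M') = (\<integral>\<^sup>+x. liminf (\<lambda>j. ennreal (g j x)) \<partial>M')"
    proof (intro nn_integral_cong_AE)
      show "AE x in M'. ennreal (g' x) = liminf (\<lambda>j. ennreal (g j x))"
        using g
      proof eventually_elim
        case (elim x)
        then show ?case by (intro lim_imp_Liminf[symmetric] tendsto_ennrealI) auto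
      qed
    qed
    also have "\<dots> \<le> liminf (\<lambda>j. \<integral>\<^sup>+x. ennreal (g j x) \<partial>M')" by (intro nn_integral_liminf) measurable
    also have "\<dots> = (SUP n. b n)" unfolding liminf_SUP_INF b_def by simp
    finally show ?thesis .
  qed
  have "c * (\<integral>\<^sup>+x. ennreal (f' x) \<partial>M) + (\<integral>\<^sup>+x. ennreal (g' x) \<partial>M') \<le> c * (SUP n. a n) + (SUP n. b n)"
    using fa gb by (intro add_mono mult_left_mono) auto
  also have "\<dots> = (SUP n. c * a n) + (SUP n. b n)" by (simp add: SUP_mult_left_ennreal)
  also have "\<dots> = (SUP n. c * a n + b n)"
    using mono by (intro ennreal_SUP_add[symmetric]) (auto simp: incseq_def intro: mult_left_mono)
  also have "\<dots> \<le> C"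
  proof (rule SUP_least)
    fix n
    have "a n \<le> (\<integral>\<^sup>+x. ennreal (f (max n J) x) \<partial>M)" "b n \<le> (\<integral>\<^sup>+x. ennreal (g (max n J) x) \<partial>M')"
      unfolding a_def b_def by (auto intro: INF_lower)
    then have "c * a n + b n \<le> c * (\<integral>\<^sup>+x. ennreal (f (max n J) x) \<partial>M) + (\<integral>\<^sup>+x. ennreal (g (max n J) x) \<partial>M')"
      by (intro add_mono mult_left_mono) auto
    also have "\<dots> \<le> C" by (intro le) simp
    finally show "c * a n + b n \<le> C" .
  qed
  finally show ?thesis .
qed

lemma nn_integral_Fatou_le:
  fixes f :: "nat \<Rightarrow> 'a \<Rightarrow> real"
  assumes "\<And>j. f j \<in> borel_measurable M" and "AE x in M. (\<lambda>j. f j x) \<longlonglongrightarrow> f' x"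
    and "\<And>j. J \<le> j \<Longrightarrow> (\<integral>\<^sup>+x. ennreal (f j x) \<partial>M) \<le> C"
  shows "(\<integral>\<^sup>+x. ennreal (f' x) \<partial>M) \<le> C"
  using nn_integral_add_Fatou[of f M "\<lambda>_ _. 0" M f' "\<lambda>_. 0" J 1 C] assms by simp

lemma emeasure_open_nonzero:
  fixes \<Omega> :: "(real ^ 'n) set"
  assumes "open \<Omega>" "\<Omega> \<noteq> {}"
  shows "emeasure lborel \<Omega> \<noteq> 0"
proof -
  obtain x e where "0 < e" "ball x e \<subseteq> \<Omega>" using assms open_contains_ball by blast
  then have "emeasure lborel (ball x e) \<le> emeasure lborel \<Omega>" using assms by (intro emeasure_mono) auto
  moreover have "emeasure lborel (ball x e) \<noteq> 0" using \<open>0 < e\<close> by (simp add: emeasure_ball ennreal_eq_0_iff not_le)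
  ultimately show ?thesis by auto
qed

text \<open>The parameter \<epsilon> is hidden in \<kappa>, which becomes
  \<open>frac_const CARD('n) s * \<epsilon> powr (2 * s) / 2\<close>; \<open>q\<close> becomes
  \<open>p + 1\<close>. The second exponent \<open>q1\<close> leaves room above \<open>q\<close>:
  interpolation between 2 and \<open>q1\<close> turns compactness in the square-integrable functions
  into compactness for the power \<open>q\<close>.\<close>

locale subcritical_domain =
  fixes \<Omega> :: "(real ^ 'n) set" and s \<kappa> q q1 :: real
  assumes open_domain: "open \<Omega>" and bounded_domain: "bounded \<Omega>" and nonempty: "\<Omega> \<noteq> {}"
    and s: "0 < s" "s < 1" and \<kappa>: "0 < \<kappa>" and q: "2 < q" "q < q1"
    and embedding: "energy_bounds_power s \<Omega> q1"
begin

lemma sets_domain [measurable]: "\<Omega> \<in> sets borel"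
  using open_domain by simp

lemma emeasure_domain: "emeasure lborel \<Omega> \<noteq> 0" "emeasure lborel \<Omega> < \<infinity>"
  using emeasure_open_nonzero[OF open_domain nonempty] emeasure_bounded_finite[OF bounded_domain] by auto

text \<open>Borel functions and not classes, so that pointwise limits make sense;
  \<open>form\<close> is then positive semidefinite only.\<close>

definition H :: "(real ^ 'n \<Rightarrow> real) set" where
  "H = {u \<in> borel_measurable borel. integrable lborel (\<lambda>z. (cross_difference s \<Omega> u z)\<^sup>2)
    \<and> integrable lborel (\<lambda>x. (restriction \<Omega> u x)\<^sup>2)}"

definition form :: "(real ^ 'n \<Rightarrow> real) \<Rightarrow> (real ^ 'n \<Rightarrow> real) \<Rightarrow> real" where
  "form u v = \<kappa> * (\<integral>z. cross_difference s \<Omega> u z * cross_difference s \<Omega> v z \<partial>lborel)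
    + (\<integral>x. restriction \<Omega> u x * restriction \<Omega> v x \<partial>lborel)"

definition power_integral :: "(real ^ 'n \<Rightarrow> real) \<Rightarrow> real" where
  "power_integral u = (\<integral>x. indicator \<Omega> x * \<bar>u x\<bar> powr q \<partial>lborel)"

lemma zero_in_H: "(\<lambda>x. 0) \<in> H"
  by (simp add: H_def cross_difference_def restriction_def)

lemma H_add_mult:
  assumes "u \<in> H" "v \<in> H"
  shows "(\<lambda>x. u x + t * v x) \<in> H"
proof -
  have [measurable]: "u \<in> borel_measurable borel" "v \<in> borel_measurable borel"
    using assms by (auto simp: H_def)
  show ?thesis
    using assms unfolding H_def
    by (auto simp: cross_difference_linear restriction_linear intro!: square_expand(1))
qed

lemma H_mult: "u \<in> H \<Longrightarrow> (\<lambda>x. t * u x) \<in> H"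
  using H_add_mult[OF zero_in_H, of u t] by simp

lemma form_add_mult:
  assumes "u \<in> H" "v \<in> H"
  shows "form (\<lambda>x. u x + t * v x) (\<lambda>x. u x + t * v x) = form u u + 2 * t * form u v + t\<^sup>2 * form v v"
proof -
  have [measurable]: "u \<in> borel_measurable borel" "v \<in> borel_measurable borel"
    using assms by (auto simp: H_def)
  have 1: "(\<integral>z. (cross_difference s \<Omega> u z + t * cross_difference s \<Omega> v z)\<^sup>2 \<partial>lborel)
     = (\<integral>z. cross_difference s \<Omega> u z * cross_difference s \<Omega> u z \<partial>lborel)
      + 2 * t * (\<integral>z. cross_difference s \<Omega> u z * cross_difference s \<Omega> v z \<partial>lborel)
      + t\<^sup>2 * (\<integral>z. cross_difference s \<Omega> v z * cross_difference s \<Omega> v z \<partial>lborel)"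
    using assms unfolding H_def by (intro square_expand(2)) auto
  have 2: "(\<integral>z. (restriction \<Omega> u z + t * restriction \<Omega> v z)\<^sup>2 \<partial>lborel)
     = (\<integral>z. restriction \<Omega> u z * restriction \<Omega> u z \<partial>lborel)
      + 2 * t * (\<integral>z. restriction \<Omega> u z * restriction \<Omega> v z \<partial>lborel)
      + t\<^sup>2 * (\<integral>z. restriction \<Omega> v z * restriction \<Omega> v z \<partial>lborel)"
    using assms unfolding H_def by (intro square_expand(2)) auto
  show ?thesis
    unfolding form_def cross_difference_linear restriction_linear power2_eq_square[symmetric]
    unfolding 1 2 by (simp add: power2_eq_square algebra_simps)
qed

lemma form_nonneg: "0 \<le> form u u"
  unfolding form_def power2_eq_square[symmetric] using \<kappa> by (intro add_nonneg_nonneg mult_nonneg_nonneg Bochner_Integration.integral_nonneg) auto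

lemma form_mult: "form (\<lambda>x. t * u x) (\<lambda>x. t * v x) = t\<^sup>2 * form u v"
proof -
  have c: "cross_difference s \<Omega> (\<lambda>x. t * w x) z = t * cross_difference s \<Omega> w z" for w z
    by (simp add: cross_difference_def algebra_simps)
  have r: "restriction \<Omega> (\<lambda>x. t * w x) x = t * restriction \<Omega> w x" for w x
    by (simp add: restriction_def)
  have e: "t * a * (t * b) = t\<^sup>2 * (a * b)" for a b :: real by (simp add: power2_eq_square)
  show ?thesis unfolding form_def c r e integral_mult_right_zero by (simp add: algebra_simps)
qed

lemma form_nn_integral:
  assumes "u \<in> H"
  shows "ennreal (form u u) = ennreal \<kappa> * cross_square s \<Omega> u
    + restriction_square \<Omega> u"
proof -
  have 1: "cross_square s \<Omega> u = ennreal (\<integral>z. (cross_difference s \<Omega> u z)\<^sup>2 \<partial>lborel)"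
    using assms unfolding H_def by (intro nn_integral_eq_integral) auto
  have 2: "restriction_square \<Omega> u = ennreal (\<integral>z. (restriction \<Omega> u z)\<^sup>2 \<partial>lborel)"
    using assms unfolding H_def by (intro nn_integral_eq_integral) auto
  show ?thesis
    unfolding 1 2 form_def power2_eq_square[symmetric] using \<kappa>
    by (simp add: ennreal_mult[symmetric] flip: ennreal_plus)
qed

lemma H_if_nn_integral_finite:
  assumes [measurable]: "u \<in> borel_measurable borel"
    and "ennreal \<kappa> * cross_square s \<Omega> u
    + restriction_square \<Omega> u < \<infinity>"
  shows "u \<in> H"
proof -
  have "cross_square s \<Omega> u < \<infinity>" "restriction_square \<Omega> u < \<infinity>"
    using assms(2) \<kappa> by (auto simp: ennreal_mult_less_top ennreal_eq_0_iff)
  then show ?thesis unfolding H_def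
    by (auto intro!: integrableI_bounded)
qed

lemma nn_integral_le_of_form_le:
  assumes "u \<in> H" "form u u \<le> R"
  shows "cross_square s \<Omega> u \<le> ennreal (R / \<kappa>)"
    and "energy_on s \<Omega> u \<le> ennreal (R / \<kappa>)"
    and "square_on \<Omega> u \<le> ennreal R"
proof -
  have [measurable]: "u \<in> borel_measurable borel" using assms by (simp add: H_def)
  define c where "c = (\<integral>z. cross_difference s \<Omega> u z * cross_difference s \<Omega> u z \<partial>lborel)"
  define r where "r = (\<integral>x. restriction \<Omega> u x * restriction \<Omega> u x \<partial>lborel)"
  have cr: "0 \<le> c" "0 \<le> r" "\<kappa> * c + r \<le> R"
    using assms unfolding c_def r_def form_def by auto
  moreover have "0 \<le> \<kappa> * c" using cr \<kappa> by simp
  ultimately have "\<kappa> * c \<le> R" "r \<le> R" by linarith+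
  then have cR: "c \<le> R / \<kappa>" using \<kappa> by (simp add: field_simps)
  have "cross_square s \<Omega> u = ennreal c"
    using assms unfolding H_def c_def power2_eq_square by (intro nn_integral_eq_integral) auto
  also have "\<dots> \<le> ennreal (R / \<kappa>)" using cR by (rule ennreal_leI)
  finally show c: "cross_square s \<Omega> u \<le> ennreal (R / \<kappa>)" .
  then show "energy_on s \<Omega> u \<le> ennreal (R / \<kappa>)"
    by (intro order_trans[OF nn_integral_energy_density_le(1)]) auto
  have "square_on \<Omega> u = restriction_square \<Omega> u"
    by (intro nn_integral_cong) (auto simp: restriction_def indicator_def)
  also have "\<dots> = ennreal r"
    using assms unfolding H_def r_def power2_eq_square by (intro nn_integral_eq_integral) auto
  also have "\<dots> \<le> ennreal R" using \<open>r \<le> R\<close> by (rule ennreal_leI)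
  finally show "square_on \<Omega> u \<le> ennreal R" .
qed

lemma uniform_power_bound:
  assumes "0 \<le> R"
  shows "\<exists>B\<ge>0. \<forall>u\<in>H. form u u \<le> R \<longrightarrow> power_on q1 \<Omega> u \<le> ennreal B"
proof -
  have "0 \<le> max R (R / \<kappa>)" using assms by simp
  then obtain B where B: "0 \<le> B" "\<And>u. u \<in> energy_ball s \<Omega> (max R (R / \<kappa>)) \<Longrightarrow> power_on q1 \<Omega> u \<le> ennreal B"
    using embedding unfolding energy_bounds_power_def by blast
  have "power_on q1 \<Omega> u \<le> ennreal B" if "u \<in> H" "form u u \<le> R" for u
  proof (rule B(2))
    have "energy_on s \<Omega> u \<le> ennreal (max R (R / \<kappa>))" "square_on \<Omega> u \<le> ennreal (max R (R / \<kappa>))"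
      using nn_integral_le_of_form_le(2,3)[OF that] by (auto elim!: order_trans intro: ennreal_leI)
    then show "u \<in> energy_ball s \<Omega> (max R (R / \<kappa>))" using that by (simp add: energy_ball_def H_def)
  qed
  then show ?thesis using B(1) by blast
qed

lemma nn_integral_power_le:
  assumes "u \<in> H" "0 < T" "power_on q1 \<Omega> u \<le> ennreal B" "0 \<le> B"
    and "square_on \<Omega> u \<le> ennreal \<eta>" "0 \<le> \<eta>"
  shows "power_on q \<Omega> u \<le> ennreal (T powr (q - 2) * \<eta> + T powr (q - q1) * B)"
proof -
  have [measurable]: "u \<in> borel_measurable borel" using assms by (simp add: H_def)
  have "power_on q \<Omega> u
    \<le> (\<integral>\<^sup>+x. ennreal (T powr (q - 2)) * (ennreal ((u x)\<^sup>2) * indicator \<Omega> x)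
        + ennreal (T powr (q - q1)) * (ennreal (\<bar>u x\<bar> powr q1) * indicator \<Omega> x) \<partial>lborel)"
  proof (intro nn_integral_mono)
    fix x
    have "ennreal (\<bar>u x\<bar> powr q) \<le> ennreal (T powr (q - 2) * (u x)\<^sup>2 + T powr (q - q1) * \<bar>u x\<bar> powr q1)"
      using q assms(2) by (intro ennreal_leI powr_interpolation) auto
    then show "ennreal (\<bar>u x\<bar> powr q) * indicator \<Omega> x \<le> ennreal (T powr (q - 2)) * (ennreal ((u x)\<^sup>2) * indicator \<Omega> x)
        + ennreal (T powr (q - q1)) * (ennreal (\<bar>u x\<bar> powr q1) * indicator \<Omega> x)"
      by (auto simp: indicator_def ennreal_mult)
  qed
  also have "\<dots> = ennreal (T powr (q - 2)) * square_on \<Omega> u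
      + ennreal (T powr (q - q1)) * power_on q1 \<Omega> u"
    by (subst nn_integral_add) (auto simp: nn_integral_cmult)
  also have "\<dots> \<le> ennreal (T powr (q - 2)) * ennreal \<eta> + ennreal (T powr (q - q1)) * ennreal B"
    using assms by (intro add_mono mult_left_mono) auto
  also have "\<dots> = ennreal (T powr (q - 2) * \<eta> + T powr (q - q1) * B)"
    using assms by (simp add: ennreal_mult[symmetric] flip: ennreal_plus)
  finally show ?thesis .
qed

lemma integrable_power:
  assumes "u \<in> H"
  shows "integrable lborel (\<lambda>x. indicator \<Omega> x * \<bar>u x\<bar> powr q)"
proof -
  have [measurable]: "u \<in> borel_measurable borel" using assms by (simp add: H_def)
  obtain B where B: "0 \<le> B" "power_on q1 \<Omega> u \<le> ennreal B"
    using uniform_power_bound[OF form_nonneg[of u]] assms by blast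
  have "power_on q \<Omega> u \<le> ennreal (1 powr (q - 2) * form u u + 1 powr (q - q1) * B)"
    by (intro nn_integral_power_le assms B form_nonneg nn_integral_le_of_form_le(3)) auto
  also have "\<dots> < \<infinity>" by simp
  also have "power_on q \<Omega> u = (\<integral>\<^sup>+x. ennreal (norm (indicator \<Omega> x * \<bar>u x\<bar> powr q)) \<partial>lborel)"
    by (intro nn_integral_cong) (auto simp: indicator_def)
  finally show ?thesis by (intro integrableI_bounded) auto
qed

lemma power_integral_nn:
  assumes "u \<in> H"
  shows "(\<integral>\<^sup>+x. ennreal (indicator \<Omega> x * \<bar>u x\<bar> powr q) \<partial>lborel) = ennreal (power_integral u)"
    and "power_on q \<Omega> u = ennreal (power_integral u)"
proof -
  show 1: "(\<integral>\<^sup>+x. ennreal (indicator \<Omega> x * \<bar>u x\<bar> powr q) \<partial>lborel) = ennreal (power_integral u)"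
    unfolding power_integral_def by (intro nn_integral_eq_integral integrable_power assms) auto
  show "power_on q \<Omega> u = ennreal (power_integral u)"
    unfolding 1[symmetric] by (intro nn_integral_cong) (auto simp: indicator_def)
qed

lemma power_integral_nonneg: "0 \<le> power_integral u"
  unfolding power_integral_def by (intro Bochner_Integration.integral_nonneg) auto

lemma power_integral_mult: "power_integral (\<lambda>x. t * u x) = \<bar>t\<bar> powr q * power_integral u"
proof -
  have e: "indicator \<Omega> x * \<bar>t * u x\<bar> powr q = \<bar>t\<bar> powr q * (indicator \<Omega> x * \<bar>u x\<bar> powr q)" for x
    by (simp add: abs_mult powr_mult)
  show ?thesis unfolding power_integral_def e by simp
qed

lemma power_integral_small:
  assumes R: "0 \<le> R" and \<theta>: "0 < \<theta>"
  shows "\<exists>\<eta>>0. \<forall>d\<in>H. form d d \<le> R \<longrightarrow> square_on \<Omega> d \<le> ennreal \<eta> \<longrightarrow> power_integral d \<le> \<theta>"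
proof -
  obtain B where B: "0 \<le> B" "\<And>u. u \<in> H \<Longrightarrow> form u u \<le> R \<Longrightarrow> power_on q1 \<Omega> u \<le> ennreal B"
    using uniform_power_bound[OF R] by blast
  \<comment> \<open>Solves \<open>T powr (q - q1) * (B + 1) = \<theta> / 2\<close>, which controls
    the part above \<open>T\<close>; the bound \<eta> for the squares is chosen afterwards,
    depending on \<open>T\<close>.\<close>
  define T where "T = ((B + 1) / (\<theta> / 2)) powr (1 / (q1 - q))"
  have T: "0 < T" using B(1) \<theta> by (simp add: T_def)
  have "1 / (q1 - q) * (q - q1) = - 1" using q by (simp add: field_simps)
  then have "T powr (q - q1) = ((B + 1) / (\<theta> / 2)) powr - 1"
    by (simp only: T_def powr_powr)
  also have "\<dots> = (\<theta> / 2) / (B + 1)" using B(1) \<theta> by (simp add: powr_minus)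
  finally have "T powr (q - q1) * B = \<theta> / 2 * (B / (B + 1))" by simp
  also have "\<dots> \<le> \<theta> / 2 * 1" using B(1) \<theta> by (intro mult_left_mono) auto
  finally have 2: "T powr (q - q1) * B \<le> \<theta> / 2" by simp
  define \<eta> where "\<eta> = \<theta> / 2 / T powr (q - 2)"
  have \<eta>: "0 < \<eta>" "T powr (q - 2) * \<eta> = \<theta> / 2" using \<theta> T by (auto simp: \<eta>_def)
  have "power_integral d \<le> \<theta>"
    if d: "d \<in> H" "form d d \<le> R" "square_on \<Omega> d \<le> ennreal \<eta>" for d
  proof -
    have "ennreal (power_integral d) \<le> ennreal (T powr (q - 2) * \<eta> + T powr (q - q1) * B)"
      unfolding power_integral_nn(2)[OF d(1), symmetric]
      using d B T \<eta> by (intro nn_integral_power_le) auto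
    also have "\<dots> \<le> ennreal \<theta>" using 2 \<eta> by (intro ennreal_leI) simp
    finally show ?thesis using \<theta> by simp
  qed
  then show ?thesis using \<eta>(1) by blast
qed

lemma power_integral_add_ge:
  assumes "a \<in> H" "h \<in> H" "0 < \<theta>"
  shows "(1 - q * \<theta>) * power_integral a - q * \<theta> powr (1 - q) * power_integral h \<le> power_integral (\<lambda>x. a x + h x)"
proof -
  have ah: "(\<lambda>x. a x + h x) \<in> H" using H_add_mult[OF assms(1,2), of 1] by simp
  have "(1 - q * \<theta>) * power_integral a - q * \<theta> powr (1 - q) * power_integral h
    = (\<integral>x. (1 - q * \<theta>) * (indicator \<Omega> x * \<bar>a x\<bar> powr q) - q * \<theta> powr (1 - q) * (indicator \<Omega> x * \<bar>h x\<bar> powr q) \<partial>lborel)"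
    unfolding power_integral_def using integrable_power[OF assms(1)] integrable_power[OF assms(2)] by simp
  also have "\<dots> \<le> power_integral (\<lambda>x. a x + h x)"
    unfolding power_integral_def
  proof (rule integral_mono)
    show "integrable lborel (\<lambda>x. (1 - q * \<theta>) * (indicator \<Omega> x * \<bar>a x\<bar> powr q) - q * \<theta> powr (1 - q) * (indicator \<Omega> x * \<bar>h x\<bar> powr q))"
      using integrable_power[OF assms(1)] integrable_power[OF assms(2)] by simp
    show "integrable lborel (\<lambda>x. indicator \<Omega> x * \<bar>a x + h x\<bar> powr q)" using integrable_power[OF ah] .
    show "(1 - q * \<theta>) * (indicator \<Omega> x * \<bar>a x\<bar> powr q) - q * \<theta> powr (1 - q) * (indicator \<Omega> x * \<bar>h x\<bar> powr q)
      \<le> indicator \<Omega> x * \<bar>a x + h x\<bar> powr q" for x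
      using powr_add_ge[of q \<theta> "a x" "h x"] q assms(3) by (auto simp: indicator_def)
  qed
  finally show ?thesis .
qed

section \<open>Homogeneity, minimising sequences and the existence of a minimiser\<close>

lemma power_integral_normalize:
  assumes "0 < power_integral v"
  defines "c \<equiv> power_integral v powr (- 1 / q)"
  shows "0 < c" "power_integral (\<lambda>x. c * v x) = 1"
proof -
  show c: "0 < c" using assms by (simp add: c_def)
  have "- 1 / q * q = - 1" using q by simp
  then have "c powr q = power_integral v powr - 1" by (simp only: c_def powr_powr)
  then show "power_integral (\<lambda>x. c * v x) = 1"
    unfolding power_integral_mult using assms c by (simp add: powr_minus)
qed

text \<open>The scale-invariant version of the constrained lower bound: \<open>form\<close> is
  homogeneous of degree 2 and \<open>power_integral\<close> of degree \<open>q\<close>.\<close>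

lemma form_ge_power_integral:
  assumes low: "\<And>v. v \<in> H \<Longrightarrow> power_integral v = 1 \<Longrightarrow> S \<le> form v v"
    and v: "v \<in> H" "0 < power_integral v"
  shows "S * power_integral v powr (2 / q) \<le> form v v"
proof -
  define c where "c = power_integral v powr (- 1 / q)"
  have "power_integral (\<lambda>x. c * v x) = 1"
    unfolding c_def by (rule power_integral_normalize(2)[OF v(2)])
  then have "S \<le> c\<^sup>2 * form v v" using low[OF H_mult[OF v(1)]] by (simp add: form_mult)
  moreover have "c\<^sup>2 = power_integral v powr (- (2 / q))"
    unfolding c_def using v by (simp add: powr_powr flip: powr_numeral)
  ultimately have "S \<le> form v v / power_integral v powr (2 / q)" by (simp add: powr_minus divide_inverse mult.commute)
  then show ?thesis using v by (simp add: field_simps)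
qed


text \<open>The midpoint is written as \<open>u - (u - v) / 2\<close> so that both \<open>v\<close>
  and the midpoint are \<open>u\<close> plus a multiple of the same difference.\<close>

lemma form_midpoint_identity:
  assumes "u \<in> H" "v \<in> H"
  defines "d \<equiv> \<lambda>x. u x + (- 1) * v x" and "m \<equiv> \<lambda>x. u x + (- 1 / 2) * (u x + (- 1) * v x)"
  shows "form d d = 2 * (form u u + form v v) - 4 * form m m"
proof -
  have d: "d \<in> H" unfolding d_def by (intro H_add_mult assms(1,2))
  have "form m m = form u u - form u d + form d d / 4"
    using form_add_mult[OF assms(1) d, of "- 1 / 2"] unfolding m_def d_def by (simp add: power2_eq_square)
  moreover have "form v v = form u u - 2 * form u d + form d d"
    using form_add_mult[OF assms(1) d, of "- 1"] unfolding d_def by simp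
  ultimately show ?thesis by simp
qed

text \<open>A minimising sequence converges in \<open>L\<^sup>q(\<Omega>)\<close> by compactness; then the midpoints are almost
  admissible, so the parallelogram identity makes the sequence Cauchy for the form itself.\<close>

lemma minimizing_sequence_Cauchy:
  assumes vH: "\<And>k. v k \<in> H" and v1: "\<And>k. power_integral (v k) = 1"
    and S: "0 \<le> S" and low: "\<And>u. u \<in> H \<Longrightarrow> power_integral u = 1 \<Longrightarrow> S \<le> form u u"
    and vS: "\<And>k. form (v k) (v k) \<le> S + 1 / (real k + 1)"
    and Lq: "\<And>\<theta>. 0 < \<theta> \<Longrightarrow> \<exists>K. \<forall>i\<ge>K. \<forall>j\<ge>K. power_integral (\<lambda>x. v i x + (- 1) * v j x) \<le> \<theta>"
    and \<delta>: "0 < \<delta>"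
  shows "\<exists>K. \<forall>i\<ge>K. \<forall>j\<ge>K. form (\<lambda>x. v i x + (- 1) * v j x) (\<lambda>x. v i x + (- 1) * v j x) \<le> \<delta>"
proof -
  \<comment> \<open>The estimate will end with
    \<open>4 * (S + \<delta> / 8) - 4 * (S - S * \<eta>)\<close>, so
    \<open>4 * (S * \<eta>) \<le> \<delta> / 2\<close> is wanted; the bound \<open>1 / 2\<close>
    keeps \<open>1 - \<eta>\<close> positive, and \<open>S + 1\<close> avoids division by 0.\<close>
  define \<eta> where "\<eta> = min (1 / 2) (\<delta> / (8 * (S + 1)))"
  have \<eta>: "0 < \<eta>" using \<delta> S by (auto simp: \<eta>_def)
  have \<eta>_half: "\<eta> \<le> 1 / 2" unfolding \<eta>_def by (rule min.cobounded1)
  have "\<eta> * (S + 1) \<le> \<delta> / (8 * (S + 1)) * (S + 1)" using S by (intro mult_right_mono) (auto simp: \<eta>_def)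
  also have "\<dots> = \<delta> / 8"
  proof -
    have "x / (8 * y) * y = x / 8" if "0 < y" for x y :: real using that by simp
    then show ?thesis using S by (simp only: add_nonneg_pos zero_less_one)
  qed
  finally have "S * \<eta> \<le> \<delta> / 8" using \<eta> by (simp add: algebra_simps)
  then have \<eta>S: "4 * (S * \<eta>) \<le> \<delta> / 2" by simp
  define \<theta> where "\<theta> = \<eta> / (2 * q)"
  have \<theta>: "0 < \<theta>" "q * \<theta> = \<eta> / 2" using \<eta> q by (auto simp: \<theta>_def)
  define c where "c = q * \<theta> powr (1 - q)"
  have c: "0 < c" using q \<theta> by (simp add: c_def)
  have "0 < \<eta> / (2 * c)" using c \<eta> by simp
  then obtain K1 where K1: "\<And>i j. K1 \<le> i \<Longrightarrow> K1 \<le> j \<Longrightarrow> power_integral (\<lambda>x. v i x + (- 1) * v j x) \<le> \<eta> / (2 * c)"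
    using Lq by meson
  obtain K2 :: nat where K2: "8 / \<delta> < real K2" using reals_Archimedean2 by blast
  have "form (\<lambda>x. v i x + (- 1) * v j x) (\<lambda>x. v i x + (- 1) * v j x) \<le> \<delta>"
    if i: "max K1 K2 \<le> i" and j: "max K1 K2 \<le> j" for i j
  proof -
    define d where "d = (\<lambda>x. v i x + (- 1) * v j x)"
    define m where "m = (\<lambda>x. v i x + (- 1 / 2) * d x)"
    have d: "d \<in> H" unfolding d_def by (intro H_add_mult vH)
    have m: "m \<in> H" unfolding m_def by (intro H_add_mult vH d)
    have "(1 - q * \<theta>) * power_integral (v i) - q * \<theta> powr (1 - q) * power_integral (\<lambda>x. (- 1 / 2) * d x) \<le> power_integral m"
      unfolding m_def by (intro power_integral_add_ge vH H_mult d \<theta>)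
    moreover have "power_integral (\<lambda>x. (- 1 / 2) * d x) \<le> power_integral d"
    proof -
      have "\<bar>- 1 / 2 :: real\<bar> powr q \<le> 1" using q by (simp add: powr_le1)
      then show ?thesis unfolding power_integral_mult
        using mult_right_mono[of "\<bar>- 1 / 2 :: real\<bar> powr q" 1 "power_integral d"] power_integral_nonneg[of d] by simp
    qed
    then have "c * power_integral (\<lambda>x. (- 1 / 2) * d x) \<le> c * (\<eta> / (2 * c))"
      using c K1[of i j] i j unfolding d_def by (intro mult_left_mono) auto
    moreover have "c * (\<eta> / (2 * c)) = \<eta> / 2" using c by simp
    ultimately have Qm: "1 - \<eta> \<le> power_integral m" unfolding v1 \<theta>(2) c_def by simp
    \<comment> \<open>Since \<open>1 - \<eta>\<close> lies below 1 and \<open>2 / q < 1\<close>,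
      raising it to this power only increases it.\<close>
    have "S * (1 - \<eta>) \<le> S * power_integral m powr (2 / q)"
    proof (intro mult_left_mono S)
      have "1 - \<eta> = (1 - \<eta>) powr 1" using \<eta> \<eta>_half by simp
      also have "\<dots> \<le> (1 - \<eta>) powr (2 / q)" using \<eta> \<eta>_half q by (intro powr_mono') auto
      also have "\<dots> \<le> power_integral m powr (2 / q)" using \<eta>_half q Qm by (intro powr_mono2) auto
      finally show "1 - \<eta> \<le> power_integral m powr (2 / q)" .
    qed
    also have "\<dots> \<le> form m m" using Qm \<eta>_half by (intro form_ge_power_integral low m) auto
    finally have "S - S * \<eta> \<le> form m m" by (simp add: algebra_simps)
    moreover have "form d d = 2 * (form (v i) (v i) + form (v j) (v j)) - 4 * form m m"
      unfolding d_def m_def by (intro form_midpoint_identity vH)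
    moreover have "form (v k) (v k) \<le> S + \<delta> / 8" if "K2 \<le> k" for k
    proof -
      have "8 / \<delta> \<le> real k + 1" using K2 that by linarith
      then have "1 / (real k + 1) \<le> \<delta> / 8" using \<delta> by (simp add: field_simps)
      then show ?thesis using vS[of k] by linarith
    qed
    then have "form (v i) (v i) \<le> S + \<delta> / 8" "form (v j) (v j) \<le> S + \<delta> / 8" using i j by auto
    ultimately have "form d d \<le> 2 * ((S + \<delta> / 8) + (S + \<delta> / 8)) - 4 * (S - S * \<eta>)" by (simp only: mult_left_mono add_mono diff_mono zero_le_numeral)
    also have "\<dots> = \<delta> / 2 + 4 * (S * \<eta>)" by (simp add: algebra_simps)
    also have "\<dots> \<le> \<delta>" using \<eta>S by simp
    finally have "form d d \<le> \<delta>" .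
    then show ?thesis unfolding d_def .
  qed
  then show ?thesis by blast
qed

text \<open>The form controls the weighted square integral on the whole space, and the weight has
  finite mass, so the sequence times the weight is Cauchy in the integral norm. A subsequence
  converges almost everywhere, and the positive weight can be divided out.\<close>

lemma Cauchy_AE_convergent_subseq:
  assumes vH: "\<And>k. v k \<in> H"
    and Cauchy: "\<And>\<delta>. 0 < \<delta> \<Longrightarrow> \<exists>K. \<forall>i\<ge>K. \<forall>j\<ge>K. form (\<lambda>x. v i x + (- 1) * v j x) (\<lambda>x. v i x + (- 1) * v j x) \<le> \<delta>"
  shows "\<exists>r :: nat \<Rightarrow> nat. strict_mono r \<and> (AE x in lborel. convergent (\<lambda>i. v (r i) x))"
proof -
  have [measurable]: "v k \<in> borel_measurable borel" for k using vH by (simp add: H_def)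
  obtain C where C: "0 < C" "\<And>u. u \<in> borel_measurable borel \<Longrightarrow>
    weighted_square s u
      \<le> ennreal C * (energy_on s \<Omega> u + square_on \<Omega> u)"
    using weighted_L2_bound[OF s sets_domain bounded_domain emeasure_domain(1)] by blast
  obtain W where W: "W \<ge> 0" "(\<integral>\<^sup>+y. ennreal (decay_weight s (y :: real ^ 'n)) \<partial>lborel) \<le> ennreal W"
    using decay_weight_integral_finite[OF s] by blast
  \<comment> \<open>The inequality
    \<open>\<bar>u y\<bar> \<le> \<tau> * (u y)\<^sup>2 + 1 / \<tau>\<close> with free \<tau>
    replaces the Cauchy-Schwarz inequality.\<close>
  have L1: "(\<integral>\<^sup>+y. ennreal (\<bar>u y\<bar> * decay_weight s y) \<partial>lborel) \<le> ennreal (\<tau> * (C * (R / \<kappa> + R)) + W / \<tau>)"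
    if u: "u \<in> H" "form u u \<le> R" and \<tau>: "0 < \<tau>" for u R \<tau>
  proof -
    have [measurable]: "u \<in> borel_measurable borel" using u by (simp add: H_def)
    have R: "0 \<le> R" using form_nonneg[of u] u by linarith
    have "ennreal (\<bar>u y\<bar> * decay_weight s y)
      \<le> ennreal \<tau> * ennreal ((u y)\<^sup>2 * decay_weight s y) + ennreal (1 / \<tau>) * ennreal (decay_weight s y)" for y
    proof -
      have "0 \<le> (\<tau> * \<bar>u y\<bar> - 1)\<^sup>2 / \<tau> + \<bar>u y\<bar>" using \<tau> by simp
      then have "\<bar>u y\<bar> \<le> \<tau> * (u y)\<^sup>2 + 1 / \<tau>"
        using \<tau> by (simp add: power2_diff field_simps power2_eq_square)
      then have "\<bar>u y\<bar> * decay_weight s y \<le> (\<tau> * (u y)\<^sup>2 + 1 / \<tau>) * decay_weight s y"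
        using decay_weight_pos[of s y] by (intro mult_right_mono) auto
      also have "\<dots> = \<tau> * ((u y)\<^sup>2 * decay_weight s y) + 1 / \<tau> * decay_weight s y" by (simp add: algebra_simps)
      finally have "ennreal (\<bar>u y\<bar> * decay_weight s y) \<le> ennreal (\<tau> * ((u y)\<^sup>2 * decay_weight s y) + 1 / \<tau> * decay_weight s y)"
        by (rule ennreal_leI)
      also have "\<dots> = ennreal \<tau> * ennreal ((u y)\<^sup>2 * decay_weight s y) + ennreal (1 / \<tau>) * ennreal (decay_weight s y)"
        using \<tau> decay_weight_pos[of s y] by (simp only: ennreal_plus ennreal_mult mult_nonneg_nonneg less_imp_le zero_le_power2 divide_nonneg_pos zero_le_one)
      finally show ?thesis .
    qed
    then have "(\<integral>\<^sup>+y. ennreal (\<bar>u y\<bar> * decay_weight s y) \<partial>lborel)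
       \<le> (\<integral>\<^sup>+y. ennreal \<tau> * ennreal ((u y)\<^sup>2 * decay_weight s y) + ennreal (1 / \<tau>) * ennreal (decay_weight s y) \<partial>lborel)"
      by (intro nn_integral_mono)
    also have "\<dots> = ennreal \<tau> * weighted_square s u + ennreal (1 / \<tau>) * (\<integral>\<^sup>+y. ennreal (decay_weight s (y :: real ^ 'n)) \<partial>lborel)"
      by (subst nn_integral_add) (auto simp: nn_integral_cmult)
    also have "\<dots> \<le> ennreal \<tau> * (ennreal C * (ennreal (R / \<kappa>) + ennreal R)) + ennreal (1 / \<tau>) * ennreal W"
      by (intro add_mono mult_left_mono W order_trans[OF C(2)] nn_integral_le_of_form_le(2,3) u) auto
    also have "\<dots> = ennreal (\<tau> * (C * (R / \<kappa> + R)) + W / \<tau>)"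
    proof -
      have "ennreal (\<tau> * (C * (R / \<kappa> + R)) + 1 / \<tau> * W) = ennreal \<tau> * (ennreal C * (ennreal (R / \<kappa>) + ennreal R)) + ennreal (1 / \<tau>) * ennreal W"
        using \<tau> C(1) \<kappa> R W(1) by (simp only: ennreal_plus ennreal_mult mult_nonneg_nonneg add_nonneg_nonneg less_imp_le divide_nonneg_pos zero_le_one)
      then show ?thesis by simp
    qed
    finally show ?thesis .
  qed
  define f where "f k y = v k y * decay_weight s y" for k y
  have fint: "integrable lborel (f k)" for k
  proof (rule integrableI_bounded)
    have "(\<integral>\<^sup>+y. ennreal (norm (f k y)) \<partial>lborel) = (\<integral>\<^sup>+y. ennreal (\<bar>v k y\<bar> * decay_weight s y) \<partial>lborel)"
      by (intro nn_integral_cong) (simp add: f_def abs_mult abs_of_pos[OF decay_weight_pos])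
    also have "\<dots> \<le> ennreal (1 * (C * (form (v k) (v k) / \<kappa> + form (v k) (v k))) + W / 1)"
      by (intro L1 vH) auto
    also have "\<dots> < \<infinity>" by simp
    finally show "(\<integral>\<^sup>+y. ennreal (norm (f k y)) \<partial>lborel) < \<infinity>" .
  qed (simp add: f_def[abs_def])
  have fC: "\<exists>K. \<forall>i\<ge>K. \<forall>j\<ge>K. (LINT y|lborel. norm (f i y - f j y)) < e" if e: "0 < e" for e
  proof -
    \<comment> \<open>First \<tau> is taken so large that the part independent of \<open>u\<close>
      is at most \<open>e / 4\<close>; then the form of the differences is made small relative to
      \<tau>.\<close>
    define \<tau> where "\<tau> = (W + 1) / (e / 4)"
    have \<tau>: "0 < \<tau>" using W(1) e by (simp add: \<tau>_def)
    have "W / \<tau> = e / 4 * (W / (W + 1))"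
    proof -
      have "a / (b / k) = k * (a / b)" for a b k :: real by simp
      then show ?thesis unfolding \<tau>_def .
    qed
    also have "\<dots> \<le> e / 4 * 1" using W(1) e by (intro mult_left_mono) auto
    finally have 1: "W / \<tau> \<le> e / 4" by simp
    define D where "D = \<tau> * (C * (1 / \<kappa> + 1))"
    have D: "0 < D" using \<tau> C(1) \<kappa> by (simp add: D_def add_pos_pos)
    have "0 < e / 4 / D" using D e by simp
    then obtain K where K: "\<And>i j. K \<le> i \<Longrightarrow> K \<le> j \<Longrightarrow> form (\<lambda>x. v i x + (- 1) * v j x) (\<lambda>x. v i x + (- 1) * v j x) \<le> e / 4 / D"
      using Cauchy by meson
    have "(LINT y|lborel. norm (f i y - f j y)) < e" if "K \<le> i" "K \<le> j" for i j
    proof -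
      define d where "d = (\<lambda>x. v i x + (- 1) * v j x)"
      have d: "d \<in> H" unfolding d_def by (intro H_add_mult vH)
      have "ennreal (LINT y|lborel. norm (f i y - f j y)) = (\<integral>\<^sup>+y. ennreal (norm (f i y - f j y)) \<partial>lborel)"
        using fint by (intro nn_integral_eq_integral[symmetric]) auto
      also have "\<dots> = (\<integral>\<^sup>+y. ennreal (\<bar>d y\<bar> * decay_weight s y) \<partial>lborel)"
      proof (intro nn_integral_cong)
        fix y :: "real ^ 'n"
        have "f i y - f j y = d y * decay_weight s y" by (simp add: f_def d_def algebra_simps)
        then show "ennreal (norm (f i y - f j y)) = ennreal (\<bar>d y\<bar> * decay_weight s y)"
          using decay_weight_pos[of s y] by (simp add: abs_mult)
      qed
      also have "\<dots> \<le> ennreal (\<tau> * (C * ((e / 4 / D) / \<kappa> + e / 4 / D)) + W / \<tau>)"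
        using K[OF that] by (intro L1 d \<tau>) (simp add: d_def)
      also have "\<tau> * (C * ((e / 4 / D) / \<kappa> + e / 4 / D)) = e / 4"
      proof -
        have h: "\<tau> * (C * (y / \<kappa> + y)) = D * y" for y by (simp add: D_def algebra_simps)
        show ?thesis unfolding h using D by simp
      qed
      also have "ennreal (e / 4 + W / \<tau>) \<le> ennreal (e / 2)" using 1 by (intro ennreal_leI) linarith
      finally show ?thesis using e by simp
    qed
    then show ?thesis by blast
  qed
  obtain r where r: "strict_mono r" "AE x in lborel. Cauchy (\<lambda>i. f (r i) x)"
    using cauchy_L1_AE_cauchy_subseq[of lborel f, OF fint fC] by blast
  have "AE x in lborel. convergent (\<lambda>i. v (r i) x)"
    using r(2)
  proof eventually_elim
    case (elim x)
    then obtain l where "(\<lambda>i. f (r i) x) \<longlonglongrightarrow> l" using Cauchy_convergent by (auto simp: convergent_def)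
    then have "(\<lambda>i. f (r i) x / decay_weight s x) \<longlonglongrightarrow> l / decay_weight s x"
      using decay_weight_pos[of s x] by (intro tendsto_divide) auto
    then show ?case using decay_weight_pos[of s x] by (auto simp: f_def convergent_def)
  qed
  then show ?thesis using r(1) by blast
qed

text \<open>Fatou's lemma yields only upper bounds, \<open>form w w \<le> S\<close> and
  \<open>power_integral w \<le> 1\<close>. For the reverse constraint it is applied to the
  differences from a fixed late member \<open>z K\<close>; \<open>power_integral_add_ge\<close> then
  shows that no mass is lost in the limit.\<close>

lemma exists_minimizer:
  assumes u0: "u0 \<in> H" "power_integral u0 = 1"
  shows "\<exists>w\<in>H. power_integral w = 1 \<and> (\<forall>v\<in>H. power_integral v = 1 \<longrightarrow> form w w \<le> form v v)"
proof -
  define A where "A = {form u u | u. u \<in> H \<and> power_integral u = 1}"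
  have A: "A \<noteq> {}" "bdd_below A" using u0 form_nonneg unfolding A_def bdd_below_def by blast+
  define S where "S = Inf A"
  have S: "0 \<le> S" unfolding S_def using A(1) form_nonneg by (intro cInf_greatest) (auto simp: A_def)
  have low: "S \<le> form u u" if "u \<in> H" "power_integral u = 1" for u
    unfolding S_def using A(2) that by (intro cInf_lower) (auto simp: A_def)
  have "\<exists>u. u \<in> H \<and> power_integral u = 1 \<and> form u u \<le> S + 1 / (real k + 1)" for k :: nat
  proof -
    have "Inf A < S + 1 / (real k + 1)" by (simp add: S_def)
    then obtain a where "a \<in> A" "a < S + 1 / (real k + 1)" using A cInf_less_iff by blast
    then show ?thesis unfolding A_def by auto
  qed
  then obtain w where w: "\<And>k. w k \<in> H" "\<And>k. power_integral (w k) = 1" "\<And>k. form (w k) (w k) \<le> S + 1 / (real k + 1)"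
    by metis
  have wR: "form (w k) (w k) \<le> S + 1" for k
    by (rule order_trans[OF w(3)]) simp
  define R where "R = max (S + 1) ((S + 1) / \<kappa>)"
  have R: "0 \<le> R" using S by (simp add: R_def le_max_iff_disj)
  obtain r :: "nat \<Rightarrow> nat" where r: "strict_mono r"
    and rC: "\<And>\<delta>. 0 < \<delta> \<Longrightarrow> \<exists>K. \<forall>i\<ge>K. \<forall>j\<ge>K. (\<integral>\<^sup>+x\<in>\<Omega>. ennreal ((w (r i) x - w (r j) x)\<^sup>2) \<partial>lborel) \<le> ennreal \<delta>"
  proof -
    have "\<exists>r :: nat \<Rightarrow> nat. strict_mono r \<and> (\<forall>\<delta>>0. \<exists>K. \<forall>i\<ge>K. \<forall>j\<ge>K. (\<integral>\<^sup>+x\<in>\<Omega>. ennreal ((w (r i) x - w (r j) x)\<^sup>2) \<partial>lborel) \<le> ennreal \<delta>)"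
    proof (rule L2_precompact[OF s sets_domain bounded_domain emeasure_domain(1) _ R])
      show "w k \<in> borel_measurable borel" for k using w(1) by (simp add: H_def)
      show "energy_on s \<Omega> (w k) \<le> ennreal R" for k
        by (rule order_trans[OF nn_integral_le_of_form_le(2)[OF w(1) wR]]) (simp add: R_def ennreal_leI)
      show "(\<integral>\<^sup>+x\<in>\<Omega>. ennreal ((w k x)\<^sup>2) \<partial>lborel) \<le> ennreal R" for k
        by (rule order_trans[OF nn_integral_le_of_form_le(3)[OF w(1) wR]]) (simp add: R_def ennreal_leI)
    qed
    then show thesis using that by blast
  qed
  define v where "v k = w (r k)" for k
  have vH: "v k \<in> H" and v1: "power_integral (v k) = 1" for k using w by (auto simp: v_def)
  have vS: "form (v k) (v k) \<le> S + 1 / (real k + 1)" for k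
  proof -
    have "1 / (real (r k) + 1) \<le> 1 / (real k + 1)"
      using seq_suble[OF r, of k] by (intro divide_left_mono) auto
    then show ?thesis using w(3)[of "r k"] by (simp add: v_def)
  qed
  have vR: "form (v k) (v k) \<le> S + 1" for k using wR by (simp add: v_def)
  have dR: "form (\<lambda>x. v i x + (- 1) * v j x) (\<lambda>x. v i x + (- 1) * v j x) \<le> 4 * (S + 1)" for i j
  proof -
    define d m where "d = (\<lambda>x. v i x + (- 1) * v j x)" and "m = (\<lambda>x. v i x + (- 1 / 2) * (v i x + (- 1) * v j x))"
    have "form d d = 2 * (form (v i) (v i) + form (v j) (v j)) - 4 * form m m"
      unfolding d_def m_def by (intro form_midpoint_identity vH)
    then have "form d d \<le> 4 * (S + 1)" using form_nonneg[of m] vR[of i] vR[of j] by simp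
    then show ?thesis unfolding d_def .
  qed
  have Lq: "\<exists>K. \<forall>i\<ge>K. \<forall>j\<ge>K. power_integral (\<lambda>x. v i x + (- 1) * v j x) \<le> \<theta>" if \<theta>: "0 < \<theta>" for \<theta>
  proof -
    have "0 \<le> 4 * (S + 1)" using S by simp
    then obtain \<eta> where \<eta>: "0 < \<eta>" and small: "\<And>d. d \<in> H \<Longrightarrow> form d d \<le> 4 * (S + 1) \<Longrightarrow>
        square_on \<Omega> d \<le> ennreal \<eta> \<Longrightarrow> power_integral d \<le> \<theta>"
      using power_integral_small[OF _ \<theta>] by meson
    obtain K where K: "\<And>i j. K \<le> i \<Longrightarrow> K \<le> j \<Longrightarrow> (\<integral>\<^sup>+x\<in>\<Omega>. ennreal ((w (r i) x - w (r j) x)\<^sup>2) \<partial>lborel) \<le> ennreal \<eta>"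
      using rC[OF \<eta>] by blast
    have "power_integral (\<lambda>x. v i x + (- 1) * v j x) \<le> \<theta>" if "K \<le> i" "K \<le> j" for i j
      using K[OF that] by (intro small H_add_mult vH dR) (simp add: v_def)
    then show ?thesis by blast
  qed
  note Cauchy_form = minimizing_sequence_Cauchy[OF vH v1 S low vS Lq]
  obtain r2 :: "nat \<Rightarrow> nat" where r2: "strict_mono r2" "AE x in lborel. convergent (\<lambda>i. v (r2 i) x)"
    using Cauchy_AE_convergent_subseq[OF vH Cauchy_form] by blast
  define z where "z i = v (r2 i)" for i
  have zH: "z k \<in> H" and z1: "power_integral (z k) = 1" for k using vH v1 by (auto simp: z_def)
  have r2_ge: "k \<le> r2 k" for k by (rule seq_suble[OF r2(1)])
  have [measurable]: "z k \<in> borel_measurable borel" for k using zH by (simp add: H_def)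
  \<comment> \<open>The name of the original minimising sequence is reused for the limit. On the
    null set of divergence \<open>lim\<close> is an unspecified value, but the function is Borel
    measurable all the same.\<close>
  define w where "w x = lim (\<lambda>i. z i x)" for x
  have [measurable]: "w \<in> borel_measurable borel" unfolding w_def by measurable
  have conv: "AE x in lborel. (\<lambda>i. z i x) \<longlonglongrightarrow> w x"
    using r2(2) by eventually_elim (simp add: z_def w_def convergent_LIMSEQ_iff)
  have conv_c: "AE y in lborel. (\<lambda>i. (cross_difference s \<Omega> (z i) y)\<^sup>2) \<longlonglongrightarrow> (cross_difference s \<Omega> w y)\<^sup>2"
    using AE_lborel_prod[OF conv] unfolding cross_difference_def
    by eventually_elim (auto intro!: tendsto_intros)
  have conv_r: "AE x in lborel. (\<lambda>i. (restriction \<Omega> (z i) x)\<^sup>2) \<longlonglongrightarrow> (restriction \<Omega> w x)\<^sup>2"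
    using conv unfolding restriction_def by eventually_elim (auto intro!: tendsto_intros)
  have NN: "ennreal \<kappa> * cross_square s \<Omega> w
      + restriction_square \<Omega> w \<le> ennreal (S + \<delta>)" if \<delta>: "0 < \<delta>" for \<delta>
  proof -
    obtain K :: nat where K: "1 / \<delta> < real K" using reals_Archimedean2 by blast
    show ?thesis
    proof (rule nn_integral_add_Fatou[OF _ _ conv_c conv_r])
      fix j assume "K \<le> j"
      then have "1 / \<delta> \<le> real (r2 j) + 1" using K r2_ge[of j] by linarith
      then have "1 / (real (r2 j) + 1) \<le> \<delta>" using \<delta> by (simp add: field_simps)
      then have "form (z j) (z j) \<le> S + \<delta>" using vS[of "r2 j"] by (simp add: z_def)
      then show "ennreal \<kappa> * cross_square s \<Omega> (z j)
          + restriction_square \<Omega> (z j) \<le> ennreal (S + \<delta>)"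
        unfolding form_nn_integral[OF zH, symmetric] by (rule ennreal_leI)
    qed measurable
  qed
  have wH: "w \<in> H"
  proof (rule H_if_nn_integral_finite)
    show "ennreal \<kappa> * cross_square s \<Omega> w
      + restriction_square \<Omega> w < \<infinity>"
      by (rule le_less_trans[OF NN[of 1]]) (simp_all del: ennreal_plus)
  qed measurable
  have wS: "form w w \<le> S"
  proof (rule field_le_epsilon)
    fix \<delta> :: real assume "0 < \<delta>"
    then show "form w w \<le> S + \<delta>"
      using NN[of \<delta>] S unfolding form_nn_integral[OF wH, symmetric] by (simp del: ennreal_plus)
  qed
  have "power_integral w \<le> 1"
  proof -
    have "(\<integral>\<^sup>+x. ennreal (indicator \<Omega> x * \<bar>w x\<bar> powr q) \<partial>lborel) \<le> ennreal 1"
    proof (rule nn_integral_Fatou_le[where f = "\<lambda>j x. indicator \<Omega> x * \<bar>z j x\<bar> powr q" and J = 0])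
      show "AE x in lborel. (\<lambda>j. indicator \<Omega> x * \<bar>z j x\<bar> powr q) \<longlonglongrightarrow> indicator \<Omega> x * \<bar>w x\<bar> powr q"
        using conv by eventually_elim (use q in \<open>auto intro!: tendsto_intros\<close>)
      show "(\<integral>\<^sup>+x. ennreal (indicator \<Omega> x * \<bar>z j x\<bar> powr q) \<partial>lborel) \<le> ennreal 1" for j
        unfolding power_integral_nn(1)[OF zH] z1 ..
    qed measurable
    then show ?thesis unfolding power_integral_nn(1)[OF wH] by simp
  qed
  moreover have "1 \<le> power_integral w"
  proof (rule field_le_epsilon)
    fix \<delta> :: real assume \<delta>: "0 < \<delta>"
    define \<theta> where "\<theta> = \<delta> / 2 / q"
    have \<theta>: "0 < \<theta>" "q * \<theta> = \<delta> / 2" using \<delta> q by (auto simp: \<theta>_def)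
    define c where "c = q * \<theta> powr (1 - q)"
    have c: "0 < c" using q \<theta> by (simp add: c_def)
    have "0 < \<delta> / 2 / c" using c \<delta> by simp
    then obtain K where K: "\<And>i j. K \<le> i \<Longrightarrow> K \<le> j \<Longrightarrow> power_integral (\<lambda>x. v i x + (- 1) * v j x) \<le> \<delta> / 2 / c"
      using Lq by meson
    define h where "h x = w x + (- 1) * z K x" for x
    have h: "h \<in> H" unfolding h_def by (intro H_add_mult wH zH)
    have "power_integral h \<le> \<delta> / 2 / c"
    proof -
      have dH: "(\<lambda>x. z j x + (- 1) * z K x) \<in> H" for j by (intro H_add_mult zH)
      have "(\<integral>\<^sup>+x. ennreal (indicator \<Omega> x * \<bar>h x\<bar> powr q) \<partial>lborel) \<le> ennreal (\<delta> / 2 / c)"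
      proof (rule nn_integral_Fatou_le[where f = "\<lambda>j x. indicator \<Omega> x * \<bar>z j x + (- 1) * z K x\<bar> powr q" and J = K])
        show "AE x in lborel. (\<lambda>j. indicator \<Omega> x * \<bar>z j x + (- 1) * z K x\<bar> powr q) \<longlonglongrightarrow> indicator \<Omega> x * \<bar>h x\<bar> powr q"
          using conv unfolding h_def by eventually_elim (use q in \<open>auto intro!: tendsto_intros\<close>)
        fix j assume "K \<le> j"
        then have "power_integral (\<lambda>x. z j x + (- 1) * z K x) \<le> \<delta> / 2 / c"
          unfolding z_def using r2_ge[of K] r2_ge[of j] by (intro K) auto
        then show "(\<integral>\<^sup>+x. ennreal (indicator \<Omega> x * \<bar>z j x + (- 1) * z K x\<bar> powr q) \<partial>lborel) \<le> ennreal (\<delta> / 2 / c)"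
          unfolding power_integral_nn(1)[OF dH] by (rule ennreal_leI)
      qed measurable
      then show ?thesis unfolding power_integral_nn(1)[OF h] using \<delta> c by simp
    qed
    then have "c * power_integral h \<le> c * (\<delta> / 2 / c)" using c by (intro mult_left_mono) auto
    moreover have "c * (\<delta> / 2 / c) = \<delta> / 2" using c by simp
    moreover have "(1 - q * \<theta>) * power_integral (z K) - q * \<theta> powr (1 - q) * power_integral h \<le> power_integral (\<lambda>x. z K x + h x)"
      by (intro power_integral_add_ge zH h \<theta>)
    moreover have "(\<lambda>x. z K x + h x) = w" by (simp add: h_def)
    ultimately show "1 \<le> power_integral w + \<delta>" unfolding z1 \<theta>(2) c_def by simp
  qed
  ultimately have "power_integral w = 1" by simp
  then show ?thesis using wH wS low by (intro bexI[of _ w]) (auto intro: order_trans)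
qed

end

section \<open>The Euler-Lagrange equation\<close>

context subcritical_domain
begin

text \<open>Since \<open>\<bar>\<bar>a\<bar> - \<bar>b\<bar>\<bar> \<le> \<bar>a - b\<bar>\<close>,
  a minimiser may be replaced by its absolute value, which has the same constraint integral.\<close>

lemma abs_in_H:
  assumes "u \<in> H"
  shows "(\<lambda>x. \<bar>u x\<bar>) \<in> H" and "form (\<lambda>x. \<bar>u x\<bar>) (\<lambda>x. \<bar>u x\<bar>) \<le> form u u"
proof -
  have [measurable]: "u \<in> borel_measurable borel" using assms by (simp add: H_def)
  have cint: "integrable lborel (\<lambda>z. (cross_difference s \<Omega> u z)\<^sup>2)" and rint: "integrable lborel (\<lambda>x. (restriction \<Omega> u x)\<^sup>2)"
    using assms by (auto simp: H_def)
  have c: "(cross_difference s \<Omega> (\<lambda>x. \<bar>u x\<bar>) z)\<^sup>2 \<le> (cross_difference s \<Omega> u z)\<^sup>2" for z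
    unfolding cross_difference_def power_mult_distrib
    by (intro mult_left_mono mult_right_mono) (auto simp: abs_le_square_iff[symmetric] abs_triangle_ineq3)
  have r: "(restriction \<Omega> (\<lambda>x. \<bar>u x\<bar>) x)\<^sup>2 = (restriction \<Omega> u x)\<^sup>2" for x
    by (simp add: restriction_def power_mult_distrib)
  have c2: "integrable lborel (\<lambda>z. (cross_difference s \<Omega> (\<lambda>x. \<bar>u x\<bar>) z)\<^sup>2)"
    using c by (intro Bochner_Integration.integrable_bound[OF cint]) auto
  show "(\<lambda>x. \<bar>u x\<bar>) \<in> H" unfolding H_def using c2 rint by (simp add: r)
  have "(\<integral>z. (cross_difference s \<Omega> (\<lambda>x. \<bar>u x\<bar>) z)\<^sup>2 \<partial>lborel) \<le> (\<integral>z. (cross_difference s \<Omega> u z)\<^sup>2 \<partial>lborel)"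
    by (intro integral_mono c c2 cint)
  then show "form (\<lambda>x. \<bar>u x\<bar>) (\<lambda>x. \<bar>u x\<bar>) \<le> form u u"
    unfolding form_def power2_eq_square[symmetric] r using \<kappa> by simp
qed

lemma integrable_nonlinear_term:
  assumes "u \<in> H" "v \<in> H"
  shows "integrable lborel (\<lambda>x. indicator \<Omega> x * (\<bar>u x\<bar> powr (q - 2) * u x * v x))"
proof (rule Bochner_Integration.integrable_bound)
  have [measurable]: "u \<in> borel_measurable borel" "v \<in> borel_measurable borel" using assms by (auto simp: H_def)
  show "integrable lborel (\<lambda>x. indicator \<Omega> x * \<bar>u x\<bar> powr q + indicator \<Omega> x * \<bar>v x\<bar> powr q)"
    using assms by (intro Bochner_Integration.integrable_add integrable_power)
  show "(\<lambda>x. indicator \<Omega> x * (\<bar>u x\<bar> powr (q - 2) * u x * v x)) \<in> borel_measurable lborel" by measurable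
  have "\<bar>\<bar>u x\<bar> powr (q - 2) * u x * v x\<bar> \<le> \<bar>u x\<bar> powr q + \<bar>v x\<bar> powr q" for x
    using powr_young[of q 1 "u x" "v x"] abs_powr_mult_self[of q "u x"] q
    unfolding abs_mult[of _ "v x"] by simp
  then show "AE x in lborel. norm (indicator \<Omega> x * (\<bar>u x\<bar> powr (q - 2) * u x * v x))
      \<le> norm (indicator \<Omega> x * \<bar>u x\<bar> powr q + indicator \<Omega> x * \<bar>v x\<bar> powr q)"
    by (auto simp: indicator_def)
qed

text \<open>Convexity of \<open>t \<mapsto> \<bar>t\<bar>\<^sup>q\<close> replaces differentiation under the integral sign: the quotient
  functional along \<open>w + t v\<close> is bounded below by an explicit function of \<open>t\<close> that touches it at \<open>0\<close>.\<close>

lemma minimizer_Euler_Lagrange: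
  assumes w: "w \<in> H" "power_integral w = 1"
    and low: "\<And>v. v \<in> H \<Longrightarrow> power_integral v = 1 \<Longrightarrow> form w w \<le> form v v"
    and v: "v \<in> H"
  shows "form w v = form w w * (\<integral>x. indicator \<Omega> x * (\<bar>w x\<bar> powr (q - 2) * w x * v x) \<partial>lborel)"
proof -
  define S where "S = form w w"
  have S: "0 \<le> S" unfolding S_def by (rule form_nonneg)
  define J where "J = (\<integral>x. indicator \<Omega> x * (\<bar>w x\<bar> powr (q - 2) * w x * v x) \<partial>lborel)"
  have tangent: "1 + t * q * J \<le> power_integral (\<lambda>x. w x + t * v x)" for t
  proof -
    have "1 + t * q * J = (\<integral>x. indicator \<Omega> x * \<bar>w x\<bar> powr q + t * q * (indicator \<Omega> x * (\<bar>w x\<bar> powr (q - 2) * w x * v x)) \<partial>lborel)"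
      using integrable_power[OF w(1)] integrable_nonlinear_term[OF w(1) v] w(2)
      unfolding J_def power_integral_def by simp
    also have "\<dots> \<le> power_integral (\<lambda>x. w x + t * v x)"
      unfolding power_integral_def
    proof (rule integral_mono)
      show "integrable lborel (\<lambda>x. indicator \<Omega> x * \<bar>w x\<bar> powr q + t * q * (indicator \<Omega> x * (\<bar>w x\<bar> powr (q - 2) * w x * v x)))"
        using integrable_power[OF w(1)] integrable_nonlinear_term[OF w(1) v] by simp
      show "integrable lborel (\<lambda>x. indicator \<Omega> x * \<bar>w x + t * v x\<bar> powr q)"
        by (intro integrable_power H_add_mult w v)
      show "indicator \<Omega> x * \<bar>w x\<bar> powr q + t * q * (indicator \<Omega> x * (\<bar>w x\<bar> powr (q - 2) * w x * v x))
          \<le> indicator \<Omega> x * \<bar>w x + t * v x\<bar> powr q" for x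
        using powr_tangent_le[of q "w x" "w x + t * v x"] q by (auto simp: indicator_def algebra_simps)
    qed
    finally show ?thesis .
  qed
  \<comment> \<open>\<open>F 0 = 0\<close>, and minimality makes \<open>F\<close> nonnegative for
    \<open>\<bar>t\<bar> < d\<close>; the choice of \<open>d\<close> keeps the base
    \<open>1 + t * q * J\<close> positive there. The vanishing derivative at 0 is the
    equation.\<close>
  define F where "F t = S + 2 * t * form w v + t\<^sup>2 * form v v - S * (1 + t * q * J) powr (2 / q)" for t
  define d where "d = 1 / (q * \<bar>J\<bar> + 1)"
  have qJ: "0 < q * \<bar>J\<bar> + 1" using q by (intro add_nonneg_pos mult_nonneg_nonneg) auto
  then have d: "0 < d" by (simp add: d_def)
  have F_nonneg: "F 0 \<le> F t" if "\<bar>0 - t\<bar> < d" for t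
  proof -
    have "\<bar>t\<bar> * (q * \<bar>J\<bar> + 1) < 1" using that qJ by (simp add: d_def field_simps)
    then have "\<bar>t * q * J\<bar> < 1" using q abs_ge_zero[of t] by (simp add: abs_mult algebra_simps)
    then have pos: "0 < 1 + t * q * J" by linarith
    have "S * (1 + t * q * J) powr (2 / q) \<le> S * power_integral (\<lambda>x. w x + t * v x) powr (2 / q)"
      using tangent[of t] pos q S by (intro mult_left_mono powr_mono2) auto
    also have "\<dots> \<le> form (\<lambda>x. w x + t * v x) (\<lambda>x. w x + t * v x)"
      unfolding S_def using tangent[of t] pos by (intro form_ge_power_integral low H_add_mult w v) auto
    also have "\<dots> = S + 2 * t * form w v + t\<^sup>2 * form v v"
      unfolding S_def by (intro form_add_mult w v)
    finally show ?thesis by (simp add: F_def)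
  qed
  have "(F has_real_derivative (2 * form w v - S * (2 * J))) (at 0)"
    unfolding F_def using q by (auto intro!: derivative_eq_intros)
  then have "2 * form w v - S * (2 * J) = 0"
    by (rule DERIV_local_min[OF _ d]) (use F_nonneg in blast)
  then show ?thesis unfolding S_def J_def by simp
qed

text \<open>The Lagrange multiplier \<open>S\<close> is removed by the factor \<open>t\<close> with
  \<open>t powr (q - 2) = S\<close>, available because \<open>q\<close> differs from 2. The squared
  norm becomes \<open>S powr (q / (q - 2))\<close>, and any admissible \<phi> bounds
  \<open>S\<close> from above by its quotient.\<close>

lemma exists_nonneg_solution:
  assumes \<phi>: "\<phi> \<in> H" "0 < power_integral \<phi>"
  shows "\<exists>u\<in>H. (\<forall>x. 0 \<le> u x) \<and> 0 < form u u \<and> form u u = power_integral u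
    \<and> form u u \<le> (form \<phi> \<phi> / power_integral \<phi> powr (2 / q)) powr (q / (q - 2))
    \<and> (\<forall>v\<in>H. form u v = (\<integral>x. indicator \<Omega> x * (\<bar>u x\<bar> powr (q - 2) * u x * v x) \<partial>lborel))"
proof -
  define c where "c = power_integral \<phi> powr (- 1 / q)"
  have "power_integral (\<lambda>x. c * \<phi> x) = 1"
    unfolding c_def by (rule power_integral_normalize(2)[OF \<phi>(2)])
  then obtain w0 where w0: "w0 \<in> H" "power_integral w0 = 1"
    and low0: "\<And>v. v \<in> H \<Longrightarrow> power_integral v = 1 \<Longrightarrow> form w0 w0 \<le> form v v"
    using exists_minimizer[OF H_mult[OF \<phi>(1), of c]] by blast
  define w where "w x = \<bar>w0 x\<bar>" for x
  have w: "w \<in> H" "power_integral w = 1"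
    using abs_in_H(1)[OF w0(1)] w0(2) by (simp_all add: w_def[abs_def] power_integral_def)
  have low: "form w w \<le> form v v" if "v \<in> H" "power_integral v = 1" for v
    using abs_in_H(2)[OF w0(1)] low0[OF that] by (simp add: w_def[abs_def])
  define S where "S = form w w"
  \<comment> \<open>If the form vanished at \<open>w\<close>, so would the square integral over
    \<Omega>, and then \<open>power_integral_small\<close> with bound 0 would contradict the
    constraint.\<close>
  have S: "0 < S"
  proof (rule ccontr)
    assume "\<not> 0 < S"
    then have S0: "form w w \<le> 0" by (simp add: S_def)
    obtain \<eta> where \<eta>: "0 < \<eta>" "\<And>d. d \<in> H \<Longrightarrow> form d d \<le> 0 \<Longrightarrow> square_on \<Omega> d \<le> ennreal \<eta> \<Longrightarrow> power_integral d \<le> 1 / 2"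
      using power_integral_small[of 0 "1 / 2"] by auto
    have "square_on \<Omega> w \<le> ennreal 0"
      by (rule nn_integral_le_of_form_le(3)[OF w(1) S0])
    also have "\<dots> \<le> ennreal \<eta>" by simp
    finally show False using \<eta>(2)[OF w(1) S0] w(2) by simp
  qed
  define t where "t = S powr (1 / (q - 2))"
  have t: "0 < t" using S by (simp add: t_def)
  have tS: "t powr (q - 2) = S" unfolding t_def using S q by (simp add: powr_powr)
  have tq: "t powr q = t\<^sup>2 * S"
  proof -
    have "t powr q = t powr (2 + (q - 2))" by simp
    also have "\<dots> = t powr 2 * t powr (q - 2)" by (rule powr_add)
    finally show ?thesis using t by (simp add: tS powr_numeral)
  qed
  define u where "u x = t * w x" for x
  have u: "u \<in> H" unfolding u_def[abs_def] by (intro H_mult w)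
  have uu: "form u u = t\<^sup>2 * S" unfolding u_def[abs_def] form_mult S_def ..
  have Qu: "power_integral u = t\<^sup>2 * S" unfolding u_def[abs_def] power_integral_mult using t w(2) tq by simp
  have "t\<^sup>2 * S = S powr (q / (q - 2))"
  proof -
    have "t\<^sup>2 * S = t powr q" by (simp add: tq)
    also have "\<dots> = S powr (1 / (q - 2) * q)" unfolding t_def powr_powr ..
    finally show ?thesis by simp
  qed
  also have "\<dots> \<le> (form \<phi> \<phi> / power_integral \<phi> powr (2 / q)) powr (q / (q - 2))"
  proof (rule powr_mono2)
    have "S * power_integral \<phi> powr (2 / q) \<le> form \<phi> \<phi>"
      unfolding S_def by (intro form_ge_power_integral low \<phi>)
    then show "S \<le> form \<phi> \<phi> / power_integral \<phi> powr (2 / q)" using \<phi>(2) by (simp add: field_simps)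
  qed (use S q in auto)
  finally have bound: "form u u \<le> (form \<phi> \<phi> / power_integral \<phi> powr (2 / q)) powr (q / (q - 2))"
    unfolding uu .
  have eq: "form u v = (\<integral>x. indicator \<Omega> x * (\<bar>u x\<bar> powr (q - 2) * u x * v x) \<partial>lborel)" if v: "v \<in> H" for v
  proof -
    have "form u v = t\<^sup>2 * form w (\<lambda>x. (1 / t) * v x)"
    proof -
      have "v = (\<lambda>x. t * ((1 / t) * v x))" using t by simp
      then have "form u v = form (\<lambda>x. t * w x) (\<lambda>x. t * ((1 / t) * v x))" by (simp add: u_def[abs_def])
      then show ?thesis unfolding form_mult .
    qed
    also have "form w (\<lambda>x. (1 / t) * v x) = S * (\<integral>x. indicator \<Omega> x * (\<bar>w x\<bar> powr (q - 2) * w x * ((1 / t) * v x)) \<partial>lborel)"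
      unfolding S_def by (intro minimizer_Euler_Lagrange w low H_mult v)
    also have "t\<^sup>2 * \<dots> = (\<integral>x. t\<^sup>2 * S * (indicator \<Omega> x * (\<bar>w x\<bar> powr (q - 2) * w x * ((1 / t) * v x))) \<partial>lborel)"
      by simp
    also have "\<dots> = (\<integral>x. indicator \<Omega> x * (\<bar>u x\<bar> powr (q - 2) * u x * v x) \<partial>lborel)"
    proof (intro Bochner_Integration.integral_cong refl)
      fix x
      have "\<bar>u x\<bar> powr (q - 2) = S * \<bar>w x\<bar> powr (q - 2)"
        using t by (simp add: u_def abs_mult powr_mult tS)
      then show "t\<^sup>2 * S * (indicator \<Omega> x * (\<bar>w x\<bar> powr (q - 2) * w x * ((1 / t) * v x)))
        = indicator \<Omega> x * (\<bar>u x\<bar> powr (q - 2) * u x * v x)"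
        using t by (simp add: u_def power2_eq_square)
    qed
    finally show ?thesis .
  qed
  have "0 \<le> u x" for x using t by (simp add: u_def w_def)
  then show ?thesis
    using u bound eq uu Qu S t by (intro bexI[of _ u]) auto
qed

text \<open>Testing the equation with the constant 1 forces a constant solution to satisfy
  \<open>c = \<bar>c\<bar> powr (q - 2) * c\<close>. The value 0 is excluded by the positive form,
  and \<open>\<bar>c\<bar> = 1\<close> would make the form equal to the measure of \<Omega>.\<close>

lemma nonneg_solution_nonconstant:
  assumes u: "u \<in> H" "\<And>x. 0 \<le> u x" "0 < form u u" "form u u = power_integral u"
    and eq: "\<And>v. v \<in> H \<Longrightarrow> form u v = (\<integral>x. indicator \<Omega> x * (\<bar>u x\<bar> powr (q - 2) * u x * v x) \<partial>lborel)"
    and small: "form u u < measure lborel \<Omega>"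
  shows "\<not> (AE x in lborel. u x = c)"
proof
  assume ae: "AE x in lborel. u x = c"
  define m where "m = measure lborel \<Omega>"
  have m: "0 < m" using emeasure_domain by (auto simp: m_def emeasure_eq_ennreal_measure zero_less_measure_iff)
  have [measurable]: "u \<in> borel_measurable borel" using u by (simp add: H_def)
  have ind: "integrable lborel (indicator \<Omega> :: _ \<Rightarrow> real)" using emeasure_domain(2) by simp
  have ind_int: "(\<integral>x. indicator \<Omega> x * k \<partial>lborel) = m * k" for k :: real
    by (simp add: m_def)
  have one: "(\<lambda>x. 1) \<in> H"
  proof -
    have "(restriction \<Omega> (\<lambda>x. 1) x)\<^sup>2 = indicator \<Omega> x" for x by (auto simp: restriction_def indicator_def)
    then show ?thesis unfolding H_def using ind by (simp add: cross_difference_def)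
  qed
  have "form u (\<lambda>x. 1) = (\<integral>x. indicator \<Omega> x * u x \<partial>lborel)"
    unfolding form_def restriction_mult by (simp add: cross_difference_def)
  also have "\<dots> = (\<integral>x. indicator \<Omega> x * c \<partial>lborel)"
    using ae by (intro integral_cong_AE) (auto elim: eventually_mono)
  finally have "form u (\<lambda>x. 1) = m * c" using ind_int by simp
  moreover have "form u (\<lambda>x. 1) = (\<integral>x. indicator \<Omega> x * (\<bar>c\<bar> powr (q - 2) * c) \<partial>lborel)"
    unfolding eq[OF one] using ae by (intro integral_cong_AE) (auto elim: eventually_mono)
  ultimately have 1: "m * c = m * (\<bar>c\<bar> powr (q - 2) * c)" unfolding ind_int by metis
  have Q: "power_integral u = m * \<bar>c\<bar> powr q"
  proof -
    have "power_integral u = (\<integral>x. indicator \<Omega> x * \<bar>c\<bar> powr q \<partial>lborel)"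
      unfolding power_integral_def using ae by (intro integral_cong_AE) (auto elim: eventually_mono)
    then show ?thesis using ind_int by simp
  qed
  then have c: "c \<noteq> 0" using u by auto
  then have "\<bar>c\<bar> powr (q - 2) = 1" using 1 m by simp
  then have "\<bar>c\<bar> powr (q - 2) = 1 powr (q - 2)" by simp
  then have "\<bar>c\<bar> = 1" using powr_inj[of "q - 2"] q by (smt (verit) abs_ge_zero powr_less_mono2)
  then show False using Q u small m by (simp add: m_def)
qed

end

section \<open>The normalization constant, the test function and the final choice of
  constants\<close>

lemma frac_const_pos:
  assumes "0 < s" "s < 1"
  shows "0 < frac_const n s"
proof -
  \<comment> \<open>In HOL \<open>Gamma\<close> takes the value 0 exactly at its poles, so the
    denominator is nonzero because \<open>- s\<close> is no integer.\<close>
  have "- s \<notin> \<int>\<^sub>\<le>\<^sub>0"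
  proof
    assume "- s \<in> \<int>\<^sub>\<le>\<^sub>0"
    then obtain k :: int where "- s = of_int k" by (auto elim: nonpos_Ints_cases)
    then have "of_int (- k) = s" by simp
    then have "0 < - k" "- k < 1" using assms by linarith+
    then show False by simp
  qed
  then have "Gamma (- s) \<noteq> 0" by (simp add: Gamma_eq_zero_iff)
  moreover have "0 < Gamma (real n / 2 + s)" using assms by (intro Gamma_real_pos) (auto intro: add_nonneg_pos)
  ultimately show ?thesis unfolding frac_const_def by simp
qed

context subcritical_domain
begin

text \<open>The upper bounds hold wherever the bump is centred. The lower bound looks only at the
  ball of half the radius, where the bump is at least \<open>1 / 2\<close>.\<close>

lemma bump_in_H:
  fixes C h x0
  defines "\<omega> \<equiv> unit_ball_vol (real CARD('n))" and "\<phi> \<equiv> bump x0 h"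
  assumes h: "0 < h" and C: "0 < C"
    and en: "(\<integral>\<^sup>+x. energy_density s (bump x0 h) x \<partial>lborel) \<le> ennreal (C * h powr (real CARD('n) - 2 * s))"
  shows "\<phi> \<in> H" and "form \<phi> \<phi> \<le> \<kappa> * (C * h powr (real CARD('n) - 2 * s)) + \<omega> * h ^ CARD('n)"
    and "ball x0 h \<subseteq> \<Omega> \<Longrightarrow> (1 / 2) powr q * (\<omega> * (h / 2) ^ CARD('n)) \<le> power_integral \<phi>"
proof -
  have [measurable]: "\<phi> \<in> borel_measurable borel" unfolding \<phi>_def by measurable
  have bm [measurable]: "ball x0 r \<in> sets borel" for r by simp
  have \<omega>: "0 < \<omega>" by (simp add: \<omega>_def)
  have "restriction_square \<Omega> \<phi> \<le> (\<integral>\<^sup>+x. indicator (ball x0 h) x \<partial>lborel)"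
  proof (intro nn_integral_mono)
    fix x
    show "ennreal ((restriction \<Omega> \<phi> x)\<^sup>2) \<le> indicator (ball x0 h) x"
    proof (cases "x \<in> ball x0 h")
      case True
      have "(restriction \<Omega> \<phi> x)\<^sup>2 \<le> 1"
        using bump_bounds[OF h, of x0 x] by (auto simp: restriction_def \<phi>_def indicator_def abs_square_le_1)
      then have "ennreal ((restriction \<Omega> \<phi> x)\<^sup>2) \<le> ennreal 1" by (rule ennreal_leI)
      then show ?thesis using True by simp
    next
      case False
      then have "\<phi> x = 0" unfolding \<phi>_def by (intro bump_eq_0 h)
      then show ?thesis by (simp add: restriction_def)
    qed
  qed
  also have "\<dots> = ennreal (\<omega> * h ^ CARD('n))"
    using h by (simp add: emeasure_ball \<omega>_def)
  finally have r: "restriction_square \<Omega> \<phi> \<le> ennreal (\<omega> * h ^ CARD('n))" .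
  have c: "cross_square s \<Omega> \<phi> \<le> ennreal (C * h powr (real CARD('n) - 2 * s))"
    using en unfolding \<phi>_def by (intro order_trans[OF nn_integral_energy_density_le(2)]) auto
  have le: "ennreal \<kappa> * cross_square s \<Omega> \<phi> + restriction_square \<Omega> \<phi>
      \<le> ennreal (\<kappa> * (C * h powr (real CARD('n) - 2 * s)) + \<omega> * h ^ CARD('n))"
  proof -
    have "ennreal (\<kappa> * (C * h powr (real CARD('n) - 2 * s)) + \<omega> * h ^ CARD('n))
      = ennreal \<kappa> * ennreal (C * h powr (real CARD('n) - 2 * s)) + ennreal (\<omega> * h ^ CARD('n))"
      using \<kappa> C \<omega> h by (subst ennreal_plus) (auto simp: ennreal_mult)
    then show ?thesis using c r by (auto intro!: add_mono mult_left_mono)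
  qed
  show \<phi>H: "\<phi> \<in> H"
  proof (rule H_if_nn_integral_finite)
    show "ennreal \<kappa> * cross_square s \<Omega> \<phi> + restriction_square \<Omega> \<phi> < \<infinity>"
      by (rule le_less_trans[OF le]) (simp del: ennreal_plus)
  qed measurable
  have "0 \<le> \<kappa> * (C * h powr (real CARD('n) - 2 * s)) + \<omega> * h ^ CARD('n)"
    using \<kappa> C \<omega> h by (intro add_nonneg_nonneg mult_nonneg_nonneg) auto
  then show "form \<phi> \<phi> \<le> \<kappa> * (C * h powr (real CARD('n) - 2 * s)) + \<omega> * h ^ CARD('n)"
    using le unfolding form_nn_integral[OF \<phi>H, symmetric] by (simp del: ennreal_plus)
  show "(1 / 2) powr q * (\<omega> * (h / 2) ^ CARD('n)) \<le> power_integral \<phi>" if sub: "ball x0 h \<subseteq> \<Omega>"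
  proof -
    have "(1 / 2) powr q * (\<omega> * (h / 2) ^ CARD('n)) = (\<integral>x. (1 / 2) powr q * indicator (ball x0 (h / 2)) x \<partial>lborel)"
      using h by (simp add: content_ball \<omega>_def)
    also have "\<dots> \<le> power_integral \<phi>"
      unfolding power_integral_def
    proof (rule integral_mono)
      show "integrable lborel (\<lambda>x. (1 / 2) powr q * indicator (ball x0 (h / 2)) x)"
        using emeasure_lborel_ball_finite[of x0 "h / 2"] by (intro integrable_mult_right) auto
      show "integrable lborel (\<lambda>x. indicator \<Omega> x * \<bar>\<phi> x\<bar> powr q)" by (rule integrable_power[OF \<phi>H])
      fix x
      show "(1 / 2) powr q * indicator (ball x0 (h / 2)) x \<le> indicator \<Omega> x * \<bar>\<phi> x\<bar> powr q"
      proof (cases "x \<in> ball x0 (h / 2)")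
        case True
        moreover have "ball x0 (h / 2) \<subseteq> ball x0 h" using h by (intro subset_ball) auto
        ultimately have "x \<in> \<Omega>" using sub by blast
        moreover have "1 / 2 \<le> \<bar>\<phi> x\<bar>" using bump_ge_half[OF h True] by (simp add: \<phi>_def)
        then have "(1 / 2) powr q \<le> \<bar>\<phi> x\<bar> powr q" using q by (intro powr_mono2) auto
        ultimately show ?thesis using True by simp
      qed auto
    qed
    finally show ?thesis .
  qed
qed

end

theorem theorem1p1:
  fixes \<Omega> :: "(real ^ 'n) set" and s p :: real
  assumes "CARD('n) \<ge> 2"
    and "0 < s" and "s < 1"
    and "1 < p" and "p < (real CARD('n) + 2 * s) / (real CARD('n) - 2 * s)"
    and "smooth_bounded_domain \<Omega>"
  shows "\<exists>\<epsilon>0 > 0. \<exists>C1 > 0. \<exists>C2 > 0. \<forall>\<epsilon>. 0 < \<epsilon> \<and> \<epsilon> < \<epsilon>0 \<longrightarrow>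
    (\<exists>u :: real ^ 'n \<Rightarrow> real.
       weak_solution s p \<epsilon> \<Omega> u \<and>
       (AE x in lebesgue. 0 \<le> u x) \<and>
       0 < energy s p \<epsilon> \<Omega> u \<and> energy s p \<epsilon> \<Omega> u \<le> C1 * \<epsilon> ^ CARD('n) \<and>
       \<not> (\<exists>c. AE x in lebesgue. u x = c) \<and>
       Hs_norm s \<epsilon> \<Omega> u \<le> C2 * \<epsilon> powr (real CARD('n) / 2))"
proof -
  define N where "N = real CARD('n)"
  have N: "2 \<le> N" "2 * s < N" using assms by (auto simp: N_def)
  have \<Omega>: "open \<Omega>" "\<Omega> \<noteq> {}" "bounded \<Omega>" using assms(6) by (auto simp: smooth_bounded_domain_def)
  then have \<Omega>b [measurable]: "\<Omega> \<in> sets borel" by simp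
  have fin: "emeasure lborel \<Omega> < \<infinity>" using emeasure_bounded_finite[OF \<Omega>(3)] by simp
  obtain r c where rc: "0 < r" "0 < c"
    and dens: "\<And>x \<rho>. x \<in> \<Omega> \<Longrightarrow> 0 < \<rho> \<and> \<rho> \<le> r \<Longrightarrow> ennreal (c * \<rho> ^ CARD('n)) \<le> emeasure lborel (\<Omega> \<inter> ball x \<rho>)"
    using smooth_bounded_domain_measure_density[OF assms(6)] by blast
  define q where "q = p + 1"
  \<comment> \<open>The hypothesis on \<open>p\<close> says that \<open>q = p + 1\<close> lies below
    the critical exponent; \<open>q1\<close> is the midpoint between the two.\<close>
  define q1 where "q1 = (q + 2 * N / (N - 2 * s)) / 2"
  have "q < 2 * N / (N - 2 * s)"
    using assms(5) N by (simp add: q_def N_def field_simps)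
  then have q: "2 < q" "q < q1" "q1 < 2 * N / (N - 2 * s)" using assms(4) by (auto simp: q1_def q_def)
  have q2: "q - 2 = p - 1" by (simp add: q_def)
  have emb: "energy_bounds_power s \<Omega> q1"
    using subcritical_energy_bounds_power[OF \<Omega>b fin assms(2) _ rc dens, of q1] q N by (simp add: N_def)
  define F where "F = frac_const CARD('n) s"
  have F: "0 < F" unfolding F_def by (rule frac_const_pos[OF assms(2,3)])
  obtain C where C: "0 < C" "\<And>\<epsilon> x0. 0 < \<epsilon> \<Longrightarrow>
    (\<integral>\<^sup>+x. energy_density s (bump (x0 :: real ^ 'n) \<epsilon>) x \<partial>lborel) \<le> ennreal (C * \<epsilon> powr (real CARD('n) - 2 * s))"
    using bump_energy_bound[OF assms(2,3), where 'n = 'n] by blast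
  obtain x0 where "x0 \<in> \<Omega>" using \<Omega>(2) by blast
  then obtain \<epsilon>1 where \<epsilon>1: "0 < \<epsilon>1" "ball x0 \<epsilon>1 \<subseteq> \<Omega>" using \<Omega>(1) open_contains_ball by blast
  define \<omega> where "\<omega> = unit_ball_vol N"
  have \<omega>: "0 < \<omega>" using N by (simp add: \<omega>_def)
  \<comment> \<open>For the bump of radius \<epsilon>, \<open>a * \<epsilon> powr N\<close> bounds
    the form from above and \<open>b * \<epsilon> powr N\<close> the constraint integral from below;
    \<open>D\<close> is the bound for the solution with all powers of \<epsilon> taken out.\<close>
  define a where "a = F / 2 * C + \<omega>"
  define b where "b = (1 / 2) powr q * (\<omega> * (1 / 2) ^ CARD('n))"
  have ab: "0 < a" "0 < b" using F C \<omega> by (auto simp: a_def b_def add_pos_pos)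
  define D where "D = (a / b powr (2 / q)) powr (q / (q - 2))"
  have D: "0 < D" using ab by (simp add: D_def)
  define m where "m = measure lborel \<Omega>"
  have m: "0 < m"
    using emeasure_open_nonzero[OF \<Omega>(1,2)] fin by (auto simp: m_def emeasure_eq_ennreal_measure zero_less_measure_iff)
  \<comment> \<open>The three entries keep the bump inside \<Omega>, give
    \<open>\<epsilon> ^ CARD('n) \<le> \<epsilon>\<close>, and make \<open>D * \<epsilon>\<close>
    smaller than the measure of \<Omega>, which rules out constant solutions.\<close>
  define \<epsilon>0 where "\<epsilon>0 = min \<epsilon>1 (min 1 (m / D))"
  have \<epsilon>0: "0 < \<epsilon>0" using \<epsilon>1 m D by (simp add: \<epsilon>0_def)
  have "\<exists>u :: real ^ 'n \<Rightarrow> real.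
       weak_solution s p \<epsilon> \<Omega> u \<and>
       (AE x in lebesgue. 0 \<le> u x) \<and>
       0 < energy s p \<epsilon> \<Omega> u \<and> energy s p \<epsilon> \<Omega> u \<le> D * \<epsilon> ^ CARD('n) \<and>
       \<not> (\<exists>c. AE x in lebesgue. u x = c) \<and>
       Hs_norm s \<epsilon> \<Omega> u \<le> sqrt D * \<epsilon> powr (real CARD('n) / 2)"
    if \<epsilon>: "0 < \<epsilon>" "\<epsilon> < \<epsilon>0" for \<epsilon>
  proof -
    define \<kappa> where "\<kappa> = F * \<epsilon> powr (2 * s) / 2"
    have \<kappa>: "0 < \<kappa>" using F \<epsilon> by (simp add: \<kappa>_def)
    interpret subcritical_domain \<Omega> s \<kappa> q q1
      by unfold_locales (use \<Omega> assms \<kappa> q emb in auto)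
    define \<phi> where "\<phi> = bump x0 \<epsilon>"
    have \<phi>: "\<phi> \<in> H" "form \<phi> \<phi> \<le> \<kappa> * (C * \<epsilon> powr (real CARD('n) - 2 * s)) + \<omega> * \<epsilon> ^ CARD('n)"
      using bump_in_H(1,2)[OF \<epsilon>(1) C(1) C(2)[OF \<epsilon>(1)], of x0] by (simp_all add: \<phi>_def \<omega>_def N_def)
    note \<phi>(2)
    also have "\<kappa> * (C * \<epsilon> powr (real CARD('n) - 2 * s)) = F / 2 * C * \<epsilon> ^ CARD('n)"
      using \<epsilon> by (simp add: \<kappa>_def powr_diff powr_realpow)
    also have "F / 2 * C * \<epsilon> ^ CARD('n) + \<omega> * \<epsilon> ^ CARD('n) = a * \<epsilon> powr N"
      using \<epsilon> by (simp add: a_def N_def powr_realpow algebra_simps)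
    finally have form_\<phi>: "form \<phi> \<phi> \<le> a * \<epsilon> powr N" .
    have "ball x0 \<epsilon> \<subseteq> \<Omega>" using \<epsilon> \<epsilon>1(2) subset_ball[of \<epsilon> \<epsilon>1 x0] by (auto simp: \<epsilon>0_def)
    from bump_in_H(3)[OF \<epsilon>(1) C(1) C(2)[OF \<epsilon>(1)] this]
    have "b * \<epsilon> ^ CARD('n) \<le> power_integral \<phi>"
      by (simp add: \<phi>_def b_def \<omega>_def N_def power_divide mult_ac)
    then have Q_\<phi>: "b * \<epsilon> powr N \<le> power_integral \<phi>" using \<epsilon> by (simp add: N_def powr_realpow)
    have "0 < b * \<epsilon> powr N" using ab \<epsilon> by simp
    then have "0 < power_integral \<phi>" using Q_\<phi> by linarith
    from exists_nonneg_solution[OF \<phi>(1) this]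
    obtain u where u: "u \<in> H" "\<And>x. 0 \<le> u x" "0 < form u u" "form u u = power_integral u"
      and bound: "form u u \<le> (form \<phi> \<phi> / power_integral \<phi> powr (2 / q)) powr (q / (q - 2))"
      and eq: "\<And>v. v \<in> H \<Longrightarrow> form u v = (\<integral>x. indicator \<Omega> x * (\<bar>u x\<bar> powr (q - 2) * u x * v x) \<partial>lborel)"
      by blast
    have uB [measurable]: "u \<in> borel_measurable borel" using u(1) by (simp add: H_def)
    have D_bound: "form u u \<le> D * \<epsilon> ^ CARD('n)"
    proof -
      have "form \<phi> \<phi> / power_integral \<phi> powr (2 / q) \<le> (a * \<epsilon> powr N) / (b * \<epsilon> powr N) powr (2 / q)"
        using form_\<phi> Q_\<phi> \<open>0 < b * \<epsilon> powr N\<close> form_nonneg[of \<phi>] q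
        by (intro frac_le powr_mono2) auto
      also have "\<dots> = a / b powr (2 / q) * (\<epsilon> powr N) powr (1 - 2 / q)"
        using ab \<epsilon> by (simp add: powr_mult powr_diff)
      finally have "form u u \<le> (a / b powr (2 / q) * (\<epsilon> powr N) powr (1 - 2 / q)) powr (q / (q - 2))"
        using q form_nonneg[of \<phi>] by (intro order_trans[OF bound] powr_mono2) auto
      also have "\<dots> = D * ((\<epsilon> powr N) powr (1 - 2 / q)) powr (q / (q - 2))"
        unfolding D_def by (rule powr_mult)
      also have "((\<epsilon> powr N) powr (1 - 2 / q)) powr (q / (q - 2)) = \<epsilon> powr N"
      proof -
        have "(1 - 2 / q) * (q / (q - 2)) = 1" using q by (simp add: field_simps)
        then have "N * (1 - 2 / q) * (q / (q - 2)) = N" by (simp only: mult.assoc mult_1_right)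
        then show ?thesis unfolding powr_powr by (simp only:)
      qed
      finally show ?thesis using \<epsilon> by (simp add: N_def powr_realpow)
    qed
    \<comment> \<open>Test functions of the weak formulation are only Lebesgue measurable;
      \<open>v'\<close> is a Borel representative of \<open>v\<close>, while \<open>u\<close> is
      Borel by construction.\<close>
    have inner: "Hs_inner s \<epsilon> \<Omega> u v = form u v'"
      and nonlin: "set_integrable lebesgue \<Omega> (\<lambda>x. \<bar>u x\<bar> powr (p - 1) * u x * v x)"
        "set_lebesgue_integral lebesgue \<Omega> (\<lambda>x. \<bar>u x\<bar> powr (p - 1) * u x * v x) = form u v'"
      if v': "v' \<in> H" and ae: "AE x in lborel. v x = v' x" for v v'
    proof -
      have [measurable]: "v' \<in> borel_measurable borel" using v' by (simp add: H_def)
      show "Hs_inner s \<epsilon> \<Omega> u v = form u v'"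
        unfolding Hs_inner_def form_def
          gagliardo_form_AE_borel[OF \<Omega>b uB \<open>v' \<in> borel_measurable borel\<close> AE_I2[OF refl] ae]
          L2_inner_AE_borel[OF \<Omega>b uB \<open>v' \<in> borel_measurable borel\<close> AE_I2[OF refl] ae]
        by (simp add: \<kappa>_def F_def)
      have meas: "(\<lambda>x. indicator \<Omega> x * (\<bar>u x\<bar> powr (q - 2) * u x * v' x)) \<in> borel_measurable borel" by measurable
      have ae': "AE x in lborel. indicator \<Omega> x * (\<bar>u x\<bar> powr (q - 2) * u x * v' x) = indicator \<Omega> x *\<^sub>R (\<bar>u x\<bar> powr (p - 1) * u x * v x)"
        using ae by eventually_elim (simp add: q2)
      show "set_integrable lebesgue \<Omega> (\<lambda>x. \<bar>u x\<bar> powr (p - 1) * u x * v x)"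
        unfolding set_integrable_def lebesgue_integral_AE_borel(1)[OF meas ae']
        by (rule integrable_nonlinear_term[OF u(1) v'])
      show "set_lebesgue_integral lebesgue \<Omega> (\<lambda>x. \<bar>u x\<bar> powr (p - 1) * u x * v x) = form u v'"
        unfolding set_lebesgue_integral_def eq[OF v'] by (rule lebesgue_integral_AE_borel(2)[OF meas ae'])
    qed
    have "u \<in> Hs_space s \<Omega>"
      using Hs_space_AE_borel_iff[OF \<Omega>b uB AE_I2[OF refl]] u(1) by (auto simp: H_def)
    moreover have "set_integrable lebesgue \<Omega> (\<lambda>x. \<bar>u x\<bar> powr (p - 1) * u x * v x) \<and>
        frac_const CARD('n) s * \<epsilon> powr (2 * s) / 2 * gagliardo_form s \<Omega> u v
        + set_lebesgue_integral lebesgue \<Omega> (\<lambda>x. u x * v x)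
        - set_lebesgue_integral lebesgue \<Omega> (\<lambda>x. \<bar>u x\<bar> powr (p - 1) * u x * v x) = 0"
      if v: "v \<in> Hs_space s \<Omega>" for v
    proof -
      obtain v' where v': "v' \<in> borel_measurable borel" "AE x in lborel. v x = v' x"
        using Hs_space_borel_representative[OF v] by blast
      then have "v' \<in> H" using v Hs_space_AE_borel_iff[OF \<Omega>b v'] by (auto simp: H_def)
      from inner[OF this v'(2)] nonlin[OF this v'(2)] show ?thesis unfolding Hs_inner_def by simp
    qed
    ultimately have weak: "weak_solution s p \<epsilon> \<Omega> u" unfolding weak_solution_def by blast
    have inner_u: "Hs_inner s \<epsilon> \<Omega> u u = form u u" by (rule inner[OF u(1)]) simp
    \<comment> \<open>The solution satisfies \<open>form u u = power_integral u\<close>, so the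
      three terms of the energy combine; \<open>q > 2\<close> makes the factor positive, and it is
      bounded by 1 for the upper estimate.\<close>
    have energy: "energy s p \<epsilon> \<Omega> u = (1 / 2 - 1 / q) * form u u"
    proof -
      have "set_lebesgue_integral lebesgue \<Omega> (\<lambda>x. \<bar>u x\<bar> powr (p + 1)) = (\<integral>x. indicator \<Omega> x * \<bar>u x\<bar> powr q \<partial>lborel)"
        unfolding set_lebesgue_integral_def
        by (rule lebesgue_integral_AE_borel(2)) (measurable, simp add: q_def)
      also have "\<dots> = form u u" unfolding u(4) power_integral_def ..
      finally have 1: "set_lebesgue_integral lebesgue \<Omega> (\<lambda>x. \<bar>u x\<bar> powr (p + 1)) = form u u" .
      have "energy s p \<epsilon> \<Omega> u = 1 / 2 * Hs_inner s \<epsilon> \<Omega> u u - 1 / q * form u u"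
        unfolding energy_def Hs_inner_def gagliardo_form_def 1 power2_abs power2_eq_square
        by (simp add: q_def algebra_simps)
      then show ?thesis unfolding inner_u by (simp add: algebra_simps)
    qed
    have "1 / q < 1 / 2" using q by (simp add: field_simps)
    then have pos: "0 < energy s p \<epsilon> \<Omega> u" unfolding energy using u(3) by simp
    have "0 < 1 / q" using q by simp
    then have "energy s p \<epsilon> \<Omega> u \<le> 1 * form u u"
      unfolding energy using u(3) by (intro mult_right_mono) linarith+
    then have le: "energy s p \<epsilon> \<Omega> u \<le> D * \<epsilon> ^ CARD('n)" using D_bound by simp
    have "Hs_norm s \<epsilon> \<Omega> u \<le> sqrt (D * \<epsilon> ^ CARD('n))"
      unfolding Hs_norm_def inner_u using D_bound by simp
    also have "\<dots> = sqrt D * \<epsilon> powr (real CARD('n) / 2)"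
      using \<epsilon> by (simp add: real_sqrt_mult powr_half_sqrt[symmetric] powr_powr powr_realpow[symmetric])
    finally have norm: "Hs_norm s \<epsilon> \<Omega> u \<le> sqrt D * \<epsilon> powr (real CARD('n) / 2)" .
    have "\<epsilon> ^ CARD('n) \<le> \<epsilon> ^ 1" using \<epsilon> by (intro power_decreasing) (auto simp: \<epsilon>0_def)
    then have "D * \<epsilon> ^ CARD('n) \<le> D * \<epsilon>" using D by simp
    also have "\<dots> < m" using \<epsilon> D by (simp add: \<epsilon>0_def field_simps)
    finally have "form u u < measure lborel \<Omega>" using D_bound by (simp add: m_def)
    then have "\<not> (AE x in lebesgue. u x = c)" for c
      using nonneg_solution_nonconstant[OF u eq] by (simp add: AE_completion_iff)
    then show ?thesis
      using weak pos le norm u(2) by (intro exI[of _ u]) auto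
  qed
  then show ?thesis
    using \<epsilon>0 D by (intro exI[of _ \<epsilon>0] conjI exI[of _ D] exI[of _ "sqrt D"]) auto
qed

end
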